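(* Let $f\in\mathbb{C}[x]$ be a polynomial of degree $d\ge 2$, and let $\mathbf{a},\mathbf{b}\in\mathbb{C}[\lambda]$ be two polynomials of the same degree and with the same leading coefficient. If there exist infinitely many $\lambda\in\mathbb{C}$ such that both $\mathbf{a}(\lambda)$ and $\mathbf{b}(\lambda)$ are preperiodic for $f$, then $\mathbf{a}=\mathbf{b}$.
   Context: For a polynomial $f$, $f^n$ denotes the $n$-th iterate under composition. A point $x\in\mathbb{C}$ is preperiodic for $f$ if $f^i(x)=f^j(x)$ for some distinct nonnegative integers $i,j$. *)

theory Defs
  imports Complex_Main "HOL-Computational_Algebra.Polynomial"
begin

definition preperiodic :: "complex poly \<Rightarrow> complex \<Rightarrow> bool" where
  "preperiodic f x \<longleftrightarrow> (\<exists>i j :: nat. i \<noteq> j \<and> (poly f ^^ i) x = (poly f ^^ j) x)"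

end

theory Submission
  imports Defs "HOL-Complex_Analysis.Complex_Analysis"
    "HOL-Computational_Algebra.Fundamental_Theorem_Algebra" "HOL-Real_Asymp.Real_Asymp"
begin

text \<open>
  Conjugating \<open>f\<close> and rescaling the parameter, one may assume that \<open>f\<close>, \<open>a\<close>, \<open>b\<close> are monic. Suppose
  \<open>a \<noteq> b\<close> and let \<open>d = degree f\<close>. The polynomials \<open>f\<^sup>k(a)\<close> and \<open>f\<^sup>k(b)\<close> are uniformly bounded at the
  common preperiodic parameters, while \<open>f\<^sup>k(a) - f\<^sup>k(b)\<close> has leading coefficient \<open>d\<^sup>k\<close> times that of
  \<open>a - b\<close>. Dividing by it yields, for large \<open>k\<close>, a monic polynomial that is at most \<open>1/2\<close> in absolute value at all
  these parameters. By Fekete's argument the product of the differences of \<open>N\<close> such parameters is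
  at most \<open>exp (- c N\<^sup>2)\<close>, and this persists when the coefficients are moved slightly by a field embedding.

  On the other hand, let \<open>K\<close> be a finitely generated field containing the coefficients. For a set of
  parameters stable under conjugation over \<open>K\<close>, this product is a nonzero element of \<open>K\<close>. Using
  Fekete's argument with powers of \<open>f\<^sup>k(a)\<close> as test polynomials in every valuation ring, its
  denominator is bounded by \<open>exp (\<epsilon> N\<^sup>2)\<close>, with \<open>\<epsilon>\<close> as small as desired for large \<open>k\<close>; the same
  test polynomials bound all its conjugates. A Liouville inequality for \<open>K\<close>, which allows moving to
  nearby embeddings and is proved along a tower of generators, contradicts the upper bound.\<close>

section \<open>Subfields of the complex numbers, polynomials and embeddings\<close>

text \<open>For algebraic coefficients the product formula would finish the proof: the norm of the
  denominator-free product of differences is a nonzero integer. A transcendental coefficient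
  destroys this, since a nonzero element of \<open>K\<close> may be far smaller at the given
  embedding than its denominators and its other images suggest. The lower bound is therefore claimed
  only for some embedding near the identity, which is why upper bounds must hold for all embeddings
  at once and the small test polynomial must survive a perturbation.

  The constants must be chosen in the right order. The test polynomial, of degree \<open>m\<close>,
  gains about \<open>exp (- N^2 ln 4 / (2 m))\<close> and works on a neighbourhood of the identity;
  the Liouville constant \<open>r\<close> depends on that neighbourhood and on the growth of the
  coefficients. Only then is the degree \<open>n\<close> of the iterate controlling the denominators
  chosen: it costs about \<open>exp (C N^2 / n)\<close>, with \<open>C\<close> independent of
  \<open>n\<close>, because bounds along preperiodic orbits do not depend on the number of
  iterations. The number \<open>N\<close> of parameters comes last and makes factorials and linear
  exponents negligible.\<close>

definition csubring :: "complex set \<Rightarrow> bool" where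
  "csubring R \<longleftrightarrow> 1 \<in> R \<and> (\<forall>x\<in>R. \<forall>y\<in>R. x - y \<in> R \<and> x * y \<in> R)"

definition csubfield :: "complex set \<Rightarrow> bool" where
  "csubfield K \<longleftrightarrow> csubring K \<and> (\<forall>x\<in>K. inverse x \<in> K)"

definition polys_over :: "complex set \<Rightarrow> complex poly set" where
  "polys_over R = {p. \<forall>i. coeff p i \<in> R}"

text \<open>A total function stands for a field embedding of \<open>K\<close>; its values outside
  \<open>K\<close> are arbitrary. No continuity is asked, so transcendental elements can be moved
  almost freely.\<close>

definition embedding :: "complex set \<Rightarrow> (complex \<Rightarrow> complex) \<Rightarrow> bool" where
  "embedding K s \<longleftrightarrow> s 1 = 1 \<and> (\<forall>x\<in>K. \<forall>y\<in>K. s (x + y) = s x + s y \<and> s (x * y) = s x * s y)"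

context
  fixes R :: "complex set"
  assumes R: "csubring R"
begin

lemma csubring_1: "1 \<in> R"
  using R by (simp add: csubring_def)

lemma csubring_diff: "x \<in> R \<Longrightarrow> y \<in> R \<Longrightarrow> x - y \<in> R"
  using R by (simp add: csubring_def)

lemma csubring_mult: "x \<in> R \<Longrightarrow> y \<in> R \<Longrightarrow> x * y \<in> R"
  using R by (simp add: csubring_def)

lemma csubring_0: "0 \<in> R"
  using csubring_diff[OF csubring_1 csubring_1] by simp

lemma csubring_uminus: "x \<in> R \<Longrightarrow> - x \<in> R"
  using csubring_diff[OF csubring_0, of x] by simp

lemma csubring_add: "x \<in> R \<Longrightarrow> y \<in> R \<Longrightarrow> x + y \<in> R"
  using csubring_diff[of x "- y"] csubring_uminus[of y] by simp

lemma csubring_power: "x \<in> R \<Longrightarrow> x ^ n \<in> R"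
  by (induction n) (auto intro: csubring_mult csubring_1)

lemma csubring_sum: "(\<And>i. i \<in> A \<Longrightarrow> g i \<in> R) \<Longrightarrow> sum g A \<in> R"
  by (induction A rule: infinite_finite_induct) (auto intro: csubring_0 csubring_add)

lemma csubring_prod_mset: "(\<And>i. i \<in># A \<Longrightarrow> g i \<in> R) \<Longrightarrow> prod_mset (image_mset g A) \<in> R"
  by (induction A) (auto intro: csubring_1 csubring_mult)

lemma csubring_of_nat: "of_nat n \<in> R"
  by (induction n) (auto intro: csubring_0 csubring_add csubring_1)

lemma csubring_of_int: "of_int n \<in> R"
  by (cases n) (auto intro: csubring_diff csubring_of_nat csubring_uminus csubring_1 csubring_add
      simp del: of_nat_Suc simp: csubring_uminus[OF csubring_of_nat])

lemma polys_over_0: "0 \<in> polys_over R"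
  by (simp add: polys_over_def csubring_0)

lemma polys_over_pCons: "c \<in> R \<Longrightarrow> p \<in> polys_over R \<Longrightarrow> pCons c p \<in> polys_over R"
  by (auto simp: polys_over_def coeff_pCons split: nat.split)

lemma polys_over_const: "c \<in> R \<Longrightarrow> [:c:] \<in> polys_over R"
  by (intro polys_over_pCons polys_over_0)

lemma polys_over_1: "1 \<in> polys_over R"
  using polys_over_const[OF csubring_1] by (simp add: one_pCons)

lemma polys_over_add: "p \<in> polys_over R \<Longrightarrow> q \<in> polys_over R \<Longrightarrow> p + q \<in> polys_over R"
  by (auto simp: polys_over_def intro: csubring_add)

lemma polys_over_diff: "p \<in> polys_over R \<Longrightarrow> q \<in> polys_over R \<Longrightarrow> p - q \<in> polys_over R"
  by (auto simp: polys_over_def intro: csubring_diff)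

lemma polys_over_uminus: "p \<in> polys_over R \<Longrightarrow> - p \<in> polys_over R"
  by (auto simp: polys_over_def intro: csubring_uminus)

lemma polys_over_mult: "p \<in> polys_over R \<Longrightarrow> q \<in> polys_over R \<Longrightarrow> p * q \<in> polys_over R"
  by (auto simp: polys_over_def coeff_mult intro!: csubring_sum csubring_mult)

lemma polys_over_smult: "c \<in> R \<Longrightarrow> p \<in> polys_over R \<Longrightarrow> smult c p \<in> polys_over R"
  by (auto simp: polys_over_def intro: csubring_mult)

lemma polys_over_monom: "c \<in> R \<Longrightarrow> monom c n \<in> polys_over R"
  by (auto simp: polys_over_def csubring_0)

lemma polys_over_power: "p \<in> polys_over R \<Longrightarrow> p ^ n \<in> polys_over R"
  by (induction n) (auto intro: polys_over_1 polys_over_mult)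

lemma polys_over_sum: "(\<And>i. i \<in> A \<Longrightarrow> g i \<in> polys_over R) \<Longrightarrow> sum g A \<in> polys_over R"
  by (induction A rule: infinite_finite_induct) (auto intro: polys_over_0 polys_over_add)

lemma polys_over_prod: "(\<And>i. i \<in> A \<Longrightarrow> g i \<in> polys_over R) \<Longrightarrow> prod g A \<in> polys_over R"
  by (induction A rule: infinite_finite_induct) (auto intro: polys_over_1 polys_over_mult)

lemma polys_over_prod_mset:
  "(\<And>i. i \<in># A \<Longrightarrow> g i \<in> polys_over R) \<Longrightarrow> prod_mset (image_mset g A) \<in> polys_over R"
  by (induction A) (auto intro: polys_over_1 polys_over_mult)

lemma polys_over_pderiv: "p \<in> polys_over R \<Longrightarrow> pderiv p \<in> polys_over R"
  by (auto simp: polys_over_def coeff_pderiv simp flip: of_nat_Suc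
      intro!: csubring_mult csubring_of_nat simp del: of_nat_Suc)

lemma polys_over_eval: "p \<in> polys_over R \<Longrightarrow> x \<in> R \<Longrightarrow> poly p x \<in> R"
  by (auto simp: polys_over_def poly_altdef intro!: csubring_sum csubring_mult csubring_power)

lemma polys_over_pcompose: "p \<in> polys_over R \<Longrightarrow> q \<in> polys_over R \<Longrightarrow> pcompose p q \<in> polys_over R"
proof (induction p)
  case 0
  then show ?case by (simp add: polys_over_0)
next
  case (pCons a p)
  have "a \<in> R" "p \<in> polys_over R"
    using pCons.prems(1) unfolding polys_over_def
    by (auto dest: spec[of _ 0] spec[of _ "Suc _"])
  then show ?case
    using pCons.IH pCons.prems(2) by (simp add: pcompose_pCons polys_over_add polys_over_const polys_over_mult)
qed

end

lemma csubfield_imp_csubring: "csubfield K \<Longrightarrow> csubring K"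
  by (simp add: csubfield_def)

lemma csubfield_inverse: "csubfield K \<Longrightarrow> x \<in> K \<Longrightarrow> inverse x \<in> K"
  by (simp add: csubfield_def)

lemma csubfield_divide: "csubfield K \<Longrightarrow> x \<in> K \<Longrightarrow> y \<in> K \<Longrightarrow> x / y \<in> K"
  by (simp add: divide_inverse csubfield_inverse csubring_mult csubfield_imp_csubring)

lemma polys_over_coeff: "p \<in> polys_over R \<Longrightarrow> coeff p i \<in> R"
  by (simp add: polys_over_def)

lemma polys_over_mono: "R \<subseteq> S \<Longrightarrow> polys_over R \<subseteq> polys_over S"
  by (auto simp: polys_over_def)

section \<open>Euclidean division over a subfield\<close>

lemma polys_over_division:
  assumes K: "csubfield K" and g: "g \<in> polys_over K" "g \<noteq> 0"
  shows "p \<in> polys_over K \<Longrightarrow>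
    \<exists>q r. q \<in> polys_over K \<and> r \<in> polys_over K \<and> p = q * g + r \<and> (r = 0 \<or> degree r < degree g)"
proof (induction "degree p" arbitrary: p rule: less_induct)
  case less
  note R = csubfield_imp_csubring[OF K]
  show ?case
  proof (cases "p = 0 \<or> degree p < degree g")
    case True
    then show ?thesis
      using less.prems polys_over_0[OF R] by (intro exI[of _ 0] exI[of _ p]) auto
  next
    case False
    define c where "c = lead_coeff p / lead_coeff g"
    define m where "m = monom c (degree p - degree g)"
    define p' where "p' = p - m * g"
    have c: "c \<noteq> 0" "c \<in> K"
      using False g less.prems by (auto simp: c_def intro!: csubfield_divide[OF K] polys_over_coeff)
    have m: "m \<in> polys_over K" unfolding m_def by (intro polys_over_monom R c)
    have p': "p' \<in> polys_over K"
      unfolding p'_def by (intro polys_over_diff[OF R] polys_over_mult[OF R] m g less.prems)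
    have deg: "degree (m * g) = degree p"
      using False g c by (simp add: m_def degree_mult_eq degree_monom_eq)
    have "coeff (m * g) (degree p) = lead_coeff p"
    proof -
      have "lead_coeff (m * g) = c * lead_coeff g"
        unfolding lead_coeff_mult using c by (simp add: m_def degree_monom_eq)
      then show ?thesis using deg g by (simp add: c_def)
    qed
    then have "p' = 0 \<or> degree p' < degree p"
    proof -
      have "degree p' \<le> degree p" unfolding p'_def using deg by (simp add: degree_diff_le)
      moreover have "coeff p' (degree p) = 0"
        using \<open>coeff (m * g) (degree p) = lead_coeff p\<close> by (simp add: p'_def)
      ultimately show ?thesis
        by (metis le_neq_implies_less leading_coeff_0_iff)
    qed
    then obtain q r where "q \<in> polys_over K" "r \<in> polys_over K" "p' = q * g + r"
      "r = 0 \<or> degree r < degree g"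
      using less.hyps[of p'] p' polys_over_0[OF R]
      by (metis add_0_left mult_zero_left)
    then show ?thesis
      using m polys_over_add[OF R]
      by (intro exI[of _ "q + m"] exI[of _ r]) (auto simp: p'_def algebra_simps)
  qed
qed

text \<open>\<open>div\<close> and \<open>mod\<close> are those of complex polynomials. Uniqueness
  of quotient and remainder identifies them with a division carried out over
  \<open>K\<close>.\<close>

lemma polys_over_div_mod:
  assumes K: "csubfield K" and p: "p \<in> polys_over K" and g: "g \<in> polys_over K"
  shows "p div g \<in> polys_over K" "p mod g \<in> polys_over K"
proof -
  have "p div g \<in> polys_over K \<and> p mod g \<in> polys_over K"
  proof (cases "g = 0")
    case True
    then show ?thesis using p polys_over_0[OF csubfield_imp_csubring[OF K]] by simp
  next
    case False
    then obtain q r where qr: "q \<in> polys_over K" "r \<in> polys_over K" "p = q * g + r"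
      "r = 0 \<or> degree r < degree g"
      using polys_over_division[OF K g False p] by blast
    have "r div g = 0" "r mod g = r"
      using qr(4) by (auto simp: div_poly_less mod_poly_less)
    then have "p div g = q" "p mod g = r" using False by (simp_all add: qr(3))
    then show ?thesis using qr by simp
  qed
  then show "p div g \<in> polys_over K" "p mod g \<in> polys_over K" by auto
qed

section \<open>Action of embeddings on polynomials\<close>

context
  fixes K :: "complex set" and s :: "complex \<Rightarrow> complex"
  assumes K: "csubfield K" and s: "embedding K s"
begin

private lemmas R = csubfield_imp_csubring[OF K]

lemma embedding_1: "s 1 = 1"
  using s by (simp add: embedding_def)

lemma embedding_add: "x \<in> K \<Longrightarrow> y \<in> K \<Longrightarrow> s (x + y) = s x + s y"
  using s by (simp add: embedding_def)

lemma embedding_mult: "x \<in> K \<Longrightarrow> y \<in> K \<Longrightarrow> s (x * y) = s x * s y"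
  using s by (simp add: embedding_def)

lemma embedding_0: "s 0 = 0"
  using embedding_add[OF csubring_0[OF R] csubring_0[OF R]] by simp

lemma embedding_uminus: "x \<in> K \<Longrightarrow> s (- x) = - s x"
  using embedding_add[of x "- x"] csubring_uminus[OF R, of x] embedding_0
  by (simp add: eq_neg_iff_add_eq_0 add.commute)

lemma embedding_diff: "x \<in> K \<Longrightarrow> y \<in> K \<Longrightarrow> s (x - y) = s x - s y"
  using embedding_add[of x "- y"] embedding_uminus[of y] csubring_uminus[OF R, of y] by simp

lemma embedding_inverse: "x \<in> K \<Longrightarrow> s (inverse x) = inverse (s x)"
  using embedding_mult[of x "inverse x"] csubfield_inverse[OF K, of x] embedding_1 embedding_0
  by (cases "x = 0") (auto intro!: inverse_unique[symmetric] simp del: inverse_eq_divide simp: right_inverse)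

lemma embedding_divide: "x \<in> K \<Longrightarrow> y \<in> K \<Longrightarrow> s (x / y) = s x / s y"
  by (simp add: divide_inverse embedding_mult csubfield_inverse[OF K] embedding_inverse)

lemma embedding_eq_0_iff: "x \<in> K \<Longrightarrow> s x = 0 \<longleftrightarrow> x = 0"
  using embedding_mult[of x "inverse x"] csubfield_inverse[OF K, of x] embedding_1 embedding_0
  by (cases "x = 0") auto

lemma embedding_power: "x \<in> K \<Longrightarrow> s (x ^ n) = s x ^ n"
  by (induction n) (auto simp: embedding_1 embedding_mult csubring_power[OF R])

lemma embedding_sum: "(\<And>i. i \<in> A \<Longrightarrow> g i \<in> K) \<Longrightarrow> s (sum g A) = (\<Sum>i\<in>A. s (g i))"
  by (induction A rule: infinite_finite_induct)
    (auto simp: embedding_0 embedding_add csubring_sum[OF R])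

lemma embedding_of_nat: "s (of_nat n) = of_nat n"
  by (induction n) (auto simp: embedding_0 embedding_1 embedding_add csubring_of_nat[OF R] csubring_1[OF R])

lemma coeff_map_embedding: "coeff (map_poly s p) i = s (coeff p i)"
  by (simp add: coeff_map_poly embedding_0)

lemma map_embedding_add:
  "p \<in> polys_over K \<Longrightarrow> q \<in> polys_over K \<Longrightarrow> map_poly s (p + q) = map_poly s p + map_poly s q"
  by (intro poly_eqI) (simp add: coeff_map_embedding embedding_add polys_over_coeff)

lemma map_embedding_diff:
  "p \<in> polys_over K \<Longrightarrow> q \<in> polys_over K \<Longrightarrow> map_poly s (p - q) = map_poly s p - map_poly s q"
  by (intro poly_eqI) (simp add: coeff_map_embedding embedding_diff polys_over_coeff)

lemma map_embedding_mult:
  "p \<in> polys_over K \<Longrightarrow> q \<in> polys_over K \<Longrightarrow> map_poly s (p * q) = map_poly s p * map_poly s q"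
  by (intro poly_eqI)
    (simp add: coeff_map_embedding coeff_mult embedding_sum embedding_mult polys_over_coeff
      csubring_mult[OF R])

lemma map_embedding_const: "map_poly s [:c:] = [:s c:]"
  by (simp add: map_poly_pCons embedding_0)

lemma map_embedding_1: "map_poly s 1 = 1"
  by (simp add: embedding_1)

lemma map_embedding_prod:
  "(\<And>i. i \<in> A \<Longrightarrow> g i \<in> polys_over K) \<Longrightarrow> map_poly s (prod g A) = (\<Prod>i\<in>A. map_poly s (g i))"
  by (induction A rule: infinite_finite_induct)
    (auto simp: map_embedding_1 map_embedding_mult polys_over_prod[OF R])

lemma map_embedding_pderiv: "p \<in> polys_over K \<Longrightarrow> map_poly s (pderiv p) = pderiv (map_poly s p)"
  by (intro poly_eqI)
    (simp add: coeff_map_embedding coeff_pderiv embedding_mult embedding_of_nat polys_over_coeff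
      csubring_of_nat[OF R] del: of_nat_Suc)

lemma map_embedding_pcompose:
  "p \<in> polys_over K \<Longrightarrow> q \<in> polys_over K \<Longrightarrow>
   map_poly s (pcompose p q) = pcompose (map_poly s p) (map_poly s q)"
proof (induction p)
  case (pCons a p)
  have "a \<in> K" "p \<in> polys_over K"
    using pCons.prems(1) unfolding polys_over_def
    by (auto dest: spec[of _ 0] spec[of _ "Suc _"])
  then show ?case
    using pCons.IH pCons.prems(2)
    by (simp add: pcompose_pCons map_embedding_add map_embedding_mult map_embedding_const embedding_0
        polys_over_const[OF R] polys_over_mult[OF R] polys_over_pcompose[OF R] map_poly_pCons)
qed simp

lemma degree_map_embedding: "p \<in> polys_over K \<Longrightarrow> degree (map_poly s p) = degree p"
  by (cases "p = 0") (auto intro!: map_poly_degree_eq simp: embedding_eq_0_iff polys_over_coeff)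

lemma lead_coeff_map_embedding:
  "p \<in> polys_over K \<Longrightarrow> lead_coeff (map_poly s p) = s (lead_coeff p)"
  by (simp add: degree_map_embedding coeff_map_embedding)

lemma map_embedding_eq_0_iff: "p \<in> polys_over K \<Longrightarrow> map_poly s p = 0 \<longleftrightarrow> p = 0"
  using lead_coeff_map_embedding[of p] embedding_eq_0_iff[of "lead_coeff p"]
  by (metis leading_coeff_0_iff polys_over_coeff)

lemma embedding_poly:
  "p \<in> polys_over K \<Longrightarrow> x \<in> K \<Longrightarrow> s (poly p x) = poly (map_poly s p) (s x)"
  by (simp add: poly_altdef degree_map_embedding coeff_map_embedding embedding_sum embedding_mult
      embedding_power polys_over_coeff csubring_mult[OF R] csubring_power[OF R])

lemma map_embedding_mod:
  assumes p: "p \<in> polys_over K" and g: "g \<in> polys_over K" "g \<noteq> 0"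
  shows "map_poly s (p mod g) = map_poly s p mod map_poly s g"
proof -
  let ?q = "p div g" and ?r = "p mod g"
  have qr: "?q \<in> polys_over K" "?r \<in> polys_over K"
    using polys_over_div_mod[OF K] p g by auto
  have "map_poly s p = map_poly s (?q * g + ?r)" by simp
  also have "\<dots> = map_poly s ?q * map_poly s g + map_poly s ?r"
    using qr g by (simp only: map_embedding_add map_embedding_mult polys_over_mult[OF R])
  finally have eq: "map_poly s p = map_poly s ?q * map_poly s g + map_poly s ?r" .
  have "map_poly s ?r = 0 \<or> degree (map_poly s ?r) < degree (map_poly s g)"
    using degree_mod_less[of g p] g qr by (auto simp: degree_map_embedding map_embedding_eq_0_iff)
  then have "map_poly s ?r mod map_poly s g = map_poly s ?r"
    by (auto simp: mod_poly_less)
  then show ?thesis using eq by simp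
qed

end

text \<open>For monic \<open>g\<close> this is the resultant. Its rationality is obtained from the Euclidean algorithm,
  which also shows that it commutes with embeddings.\<close>

definition root_prod :: "complex poly \<Rightarrow> complex poly \<Rightarrow> complex" where
  "root_prod g h = (\<Prod>x\<in>#proots g. poly h x)"

lemma poly_conv_proots:
  fixes g :: "complex poly"
  shows "poly g x = lead_coeff g * (\<Prod>y\<in>#proots g. (x - y))"
proof -
  have "poly g x = poly (smult (lead_coeff g) (\<Prod>y\<in>#proots g. [:-y, 1:])) x"
    by (simp add: complex_poly_decompose_multiset)
  also have "\<dots> = lead_coeff g * (\<Prod>y\<in>#proots g. (x - y))"
    by (simp add: poly_prod_mset image_mset.compositionality o_def)
  finally show ?thesis .
qed

text \<open>Up to powers of the leading coefficients, both sides are the product of the differences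
  over all pairs of roots, with the order of subtraction reversed; hence the sign.\<close>

lemma root_prod_swap:
  assumes "g \<noteq> 0" "h \<noteq> 0"
  shows "root_prod g h =
    lead_coeff h ^ degree g * (-1) ^ (degree g * degree h) / lead_coeff g ^ degree h * root_prod h g"
proof -
  have 1: "root_prod g h = lead_coeff h ^ degree g * (\<Prod>x\<in>#proots g. \<Prod>y\<in>#proots h. (x - y))"
    by (simp add: root_prod_def poly_conv_proots[of h] prod_mset.distrib size_proots_complex
        image_mset_const_eq)
  have 2: "root_prod h g = lead_coeff g ^ degree h * (\<Prod>y\<in>#proots h. \<Prod>x\<in>#proots g. (y - x))"
    by (simp add: root_prod_def poly_conv_proots[of g] prod_mset.distrib size_proots_complex
        image_mset_const_eq)
  have 3: "(\<Prod>y\<in>#B. \<Prod>x\<in>#A. (y - x)) = (-1) ^ (size A * size B) * (\<Prod>x\<in>#A. \<Prod>y\<in>#B. (x - y))"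
    for A B :: "complex multiset"
  proof -
    have "(\<Prod>y\<in>#B. \<Prod>x\<in>#A. (y - x)) = (\<Prod>y\<in>#B. \<Prod>x\<in>#A. (-1) * (x - y))"
      by simp
    also have "\<dots> = (-1) ^ (size A * size B) * (\<Prod>y\<in>#B. \<Prod>x\<in>#A. (x - y))"
      by (simp only: prod_mset.distrib image_mset_const_eq prod_mset_replicate_mset power_mult)
    also have "(\<Prod>y\<in>#B. \<Prod>x\<in>#A. (x - y)) = (\<Prod>x\<in>#A. \<Prod>y\<in>#B. (x - y))"
      by (rule prod_mset.swap)
    finally show ?thesis .
  qed
  have "lead_coeff g ^ degree h \<noteq> 0" using assms by simp
  then show ?thesis
    unfolding 1 2 3[where A = "proots g" and B = "proots h"] size_proots_complex
    by (simp flip: power_add mult.assoc power_mult_distrib)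
qed

lemma root_prod_embedding:
  assumes K: "csubfield K"
  shows "g \<in> polys_over K \<Longrightarrow> h \<in> polys_over K \<Longrightarrow> g \<noteq> 0 \<Longrightarrow>
    root_prod g h \<in> K \<and> (\<forall>s. embedding K s \<longrightarrow> s (root_prod g h) = root_prod (map_poly s g) (map_poly s h))"
proof (induction "degree g" arbitrary: g h rule: less_induct)
  case less
  note R = csubfield_imp_csubring[OF K]
  show ?case
  proof (cases "degree g = 0")
    case True
    have 1: "root_prod g h = 1" if "degree g = 0" for g h :: "complex poly"
      using that by (elim degree_eq_zeroE) (simp add: root_prod_def)
    show ?thesis
      using True less.prems by (auto simp: 1 degree_map_embedding[OF K] csubring_1[OF R] embedding_1[OF K])
  next
    case False
    \<comment> \<open>The roots of \<open>g\<close> need not lie in \<open>K\<close>, so the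
      embedding cannot be applied to them directly. At these roots \<open>h\<close> and its
      remainder agree, and exchanging \<open>g\<close> with \<open>r\<close> lowers the degree of
      the first argument.\<close>
    define r where "r = h mod g"
    have r: "r \<in> polys_over K" unfolding r_def using polys_over_div_mod[OF K] less.prems by auto
    have deg: "r = 0 \<or> degree r < degree g"
      using degree_mod_less[of g h] less.prems by (auto simp: r_def)
    have mod: "root_prod g h = root_prod g (h mod g)" if "g \<noteq> 0" for g h
      unfolding root_prod_def
    proof (intro arg_cong[of _ _ prod_mset] image_mset_cong)
      fix x assume "x \<in># proots g"
      then have "poly g x = 0" using that by simp
      then have "poly (h div g * g + h mod g) x = poly (h mod g) x" by (simp only: poly_add poly_mult) simp
      then show "poly h x = poly (h mod g) x" by simp
    qed
    have mod1: "root_prod g h = root_prod g r" using mod[OF less.prems(3), of h] by (simp only: r_def)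
    have mod2: "root_prod (map_poly s g) (map_poly s h) = root_prod (map_poly s g) (map_poly s r)"
      if "embedding K s" for s
      using mod[of "map_poly s g" "map_poly s h"] less.prems
      by (simp add: r_def map_embedding_mod[OF K that] map_embedding_eq_0_iff[OF K that])
    have zero: "root_prod p 0 = 0" if "degree p \<noteq> 0" for p
      using that size_proots_complex[of p] by (auto simp: root_prod_def image_mset_const_eq)
    show ?thesis
    proof (cases "r = 0")
      case True
      then show ?thesis
        using False less.prems unfolding mod1
        by (auto simp: mod2 zero csubring_0[OF R] embedding_0[OF K] degree_map_embedding[OF K])
    next
      case False
      then have lt: "degree r < degree g" using deg by simp
      note IH = less.hyps[OF lt r less.prems(1) False]
      let ?c = "lead_coeff r ^ degree g * (-1) ^ (degree g * degree r) / lead_coeff g ^ degree r"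
      have c: "?c \<in> K"
        by (intro csubfield_divide[OF K] csubring_mult[OF R] csubring_power[OF R] polys_over_coeff[OF r]
            csubring_uminus[OF R] csubring_1[OF R] polys_over_coeff[OF less.prems(1)])
      have eq: "root_prod g h = ?c * root_prod r g"
        using root_prod_swap[of g r] False less.prems by (simp add: mod1)
      have "s (root_prod g h) = root_prod (map_poly s g) (map_poly s h)" if s: "embedding K s" for s
      proof -
        note m = less.prems r
        have "s (root_prod g h) = s ?c * root_prod (map_poly s r) (map_poly s g)"
          unfolding eq using embedding_mult[OF K s c] IH s by auto
        also have "s ?c = s (lead_coeff r) ^ degree g * (-1) ^ (degree g * degree r) / s (lead_coeff g) ^ degree r"
          using polys_over_coeff[OF r] polys_over_coeff[OF less.prems(1)]
          by (simp add: embedding_divide[OF K s] embedding_mult[OF K s] embedding_power[OF K s]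
              csubring_mult[OF R] csubring_power[OF R] csubring_uminus[OF R] csubring_1[OF R]
              embedding_uminus[OF K s] embedding_1[OF K s])
        also have "\<dots> * root_prod (map_poly s r) (map_poly s g) = root_prod (map_poly s g) (map_poly s r)"
          using m False
          by (subst root_prod_swap[of "map_poly s g" "map_poly s r"])
            (simp_all add: map_embedding_eq_0_iff[OF K s] degree_map_embedding[OF K s]
               coeff_map_embedding[OF K s])
        finally show ?thesis using mod2[OF s] by simp
      qed
      moreover have "root_prod g h \<in> K"
        unfolding eq using c IH by (intro csubring_mult[OF R]) auto
      ultimately show ?thesis by blast
    qed
  qed
qed

section \<open>Minimal polynomials of finite sets\<close>

text \<open>The monic generator of the ideal of polynomials over \<open>K\<close> that vanish on
  \<open>F\<close>. For a set \<open>F\<close> its roots are the union of the conjugacy classes over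
  \<open>K\<close> of the elements of \<open>F\<close>.\<close>

definition minimal_poly_of :: "complex set \<Rightarrow> complex set \<Rightarrow> complex poly \<Rightarrow> bool" where
  "minimal_poly_of K F m \<longleftrightarrow> m \<in> polys_over K \<and> lead_coeff m = 1 \<and> (\<forall>x\<in>F. poly m x = 0) \<and>
    (\<forall>p\<in>polys_over K. (\<forall>x\<in>F. poly p x = 0) \<longrightarrow> m dvd p)"

lemma minimal_poly_ofD:
  assumes "minimal_poly_of K F m"
  shows "m \<in> polys_over K" "lead_coeff m = 1" "m \<noteq> 0" "x \<in> F \<Longrightarrow> poly m x = 0"
    "p \<in> polys_over K \<Longrightarrow> (\<And>x. x \<in> F \<Longrightarrow> poly p x = 0) \<Longrightarrow> m dvd p"
  using assms by (auto simp: minimal_poly_of_def)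

lemma minimal_poly_of_dvdE:
  assumes K: "csubfield K" and m: "minimal_poly_of K F m" and p: "p \<in> polys_over K" "\<And>x. x \<in> F \<Longrightarrow> poly p x = 0"
  obtains q where "q \<in> polys_over K" "p = m * q"
proof (rule that[of "p div m"])
  show "p div m \<in> polys_over K" using polys_over_div_mod(1)[OF K p(1)] minimal_poly_ofD(1)[OF m] by blast
  show "p = m * (p div m)" using minimal_poly_ofD(5)[OF m p] by simp
qed

lemma minimal_poly_exists:
  assumes K: "csubfield K" and p0: "p0 \<in> polys_over K" "p0 \<noteq> 0" "\<And>x. x \<in> F \<Longrightarrow> poly p0 x = 0"
  obtains m where "minimal_poly_of K F m"
proof -
  note R = csubfield_imp_csubring[OF K]
  define A where "A = (\<lambda>p. p \<in> polys_over K \<and> p \<noteq> 0 \<and> (\<forall>x\<in>F. poly p x = 0))"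
  have "A p0" using p0 by (simp add: A_def)
  then obtain m0 where m0: "A m0" "\<And>p. A p \<Longrightarrow> degree m0 \<le> degree p"
    using ex_has_least_nat[of A p0 degree] by blast
  define m where "m = smult (inverse (lead_coeff m0)) m0"
  have m0': "m0 \<noteq> 0" "m0 \<in> polys_over K" using m0 by (auto simp: A_def)
  have m: "m \<in> polys_over K" unfolding m_def
    by (intro polys_over_smult[OF R] csubfield_inverse[OF K] polys_over_coeff m0')
  have lc: "lead_coeff m = 1" using m0' by (simp add: m_def)
  have deg: "degree m = degree m0" using m0' by (simp add: m_def)
  have van: "\<forall>x\<in>F. poly m x = 0" using m0 by (simp add: m_def A_def)
  have min: "degree m \<le> degree p" if "p \<in> polys_over K" "\<forall>x\<in>F. poly p x = 0" "p \<noteq> 0" for p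
    using m0(2)[of p] that deg by (simp add: A_def)
  have dvd: "m dvd p" if p: "p \<in> polys_over K" "\<forall>x\<in>F. poly p x = 0" for p
  proof (rule ccontr)
    assume "\<not> m dvd p"
    then have nz: "p mod m \<noteq> 0" by (simp add: mod_eq_0_iff_dvd)
    have "m \<noteq> 0" using lc by auto
    then have "degree (p mod m) < degree m" using degree_mod_less nz by blast
    moreover have "poly (p mod m) x = 0" if "x \<in> F" for x
    proof -
      have "poly (p div m * m + p mod m) x = 0" using p that by simp
      then show ?thesis using van that by (simp only: poly_add poly_mult) simp
    qed
    ultimately show False
      using min[of "p mod m"] polys_over_div_mod[OF K p(1) m] nz by fastforce
  qed
  show thesis using that[of m] m lc van dvd by (auto simp: minimal_poly_of_def)
qed

lemma degree_minimal_poly_singleton: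
  assumes "minimal_poly_of K {y} h" shows "degree h > 0"
proof (rule ccontr)
  assume "\<not> degree h > 0"
  then obtain c where "h = [:c:]" by (auto elim: degree_eq_zeroE)
  then show False using minimal_poly_ofD(3,4)[OF assms] by auto
qed

text \<open>Write \<open>m = h * e\<close> with \<open>h\<close> the minimal polynomial of a double
  root \<open>y\<close>. In characteristic zero \<open>y\<close> is a simple root of
  \<open>h\<close>, so \<open>e\<close> vanishes at \<open>y\<close> and is again a multiple of
  \<open>h\<close>. Then \<open>e\<close> vanishes wherever \<open>m\<close> does, in particular on
  \<open>F\<close>, against the minimality of \<open>m\<close>.\<close>

lemma minimal_poly_rsquarefree:
  assumes K: "csubfield K" and m: "minimal_poly_of K F m"
  shows "rsquarefree m"
  unfolding rsquarefree_roots
proof (intro allI notI, elim conjE)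
  fix y assume y: "poly m y = 0" "poly (pderiv m) y = 0"
  note R = csubfield_imp_csubring[OF K] and mK = minimal_poly_ofD(1)[OF m]
  obtain h where h: "minimal_poly_of K {y} h"
    using minimal_poly_exists[OF K mK minimal_poly_ofD(3)[OF m], of "{y}"] y by auto
  note hK = minimal_poly_ofD(1)[OF h]
  have hy: "poly h y = 0" using minimal_poly_ofD(4)[OF h] by simp
  have degh: "degree h > 0" by (rule degree_minimal_poly_singleton[OF h])
  obtain e where e: "e \<in> polys_over K" "m = h * e"
    using minimal_poly_of_dvdE[OF K h mK] y by auto
  have "poly (pderiv h) y \<noteq> 0"
  proof
    assume "poly (pderiv h) y = 0"
    then have "h dvd pderiv h"
      using minimal_poly_ofD(5)[OF h polys_over_pderiv[OF R hK]] by auto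
    moreover have "pderiv h \<noteq> 0" using degh by (simp add: pderiv_eq_0_iff)
    ultimately have "degree h \<le> degree (pderiv h)" by (rule dvd_imp_degree_le)
    then show False using degh by (simp add: degree_pderiv)
  qed
  then have "poly e y = 0"
    using y(2) hy by (simp add: e(2) pderiv_mult)
  then obtain e' where e': "e' \<in> polys_over K" "e = h * e'"
    using minimal_poly_of_dvdE[OF K h e(1)] by auto
  have e0: "e \<noteq> 0" using e minimal_poly_ofD(3)[OF m] by auto
  have "poly e x = 0" if "x \<in> F" for x
    using minimal_poly_ofD(4)[OF m that] by (auto simp: e(2) e'(2))
  then have "m dvd e" by (rule minimal_poly_ofD(5)[OF m e(1)])
  then have "degree m \<le> degree e" using e0 by (intro dvd_imp_degree_le)
  moreover have "degree m = degree h + degree e"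
    using e e0 minimal_poly_ofD(3)[OF h] by (simp add: degree_mult_eq)
  ultimately show False using degh by simp
qed

section \<open>Integrality via valuation rings\<close>

text \<open>A valuation is represented by its ring alone, so that no value group appears; estimates
  become membership statements.\<close>

definition val_ring :: "complex set \<Rightarrow> bool" where
  "val_ring V \<longleftrightarrow> csubring V \<and> (\<forall>x. x \<in> V \<or> inverse x \<in> V)"

text \<open>The integral closure of the ring generated by \<open>X\<close>. The definition by valuation rings makes it obvious
  that it is a ring; monic equations are recovered from Zorn's lemma in
  \<open>integral_over_imp_monic_equation\<close>.\<close>

definition integral_over :: "complex set \<Rightarrow> complex set" where
  "integral_over X = {z. \<forall>V. val_ring V \<longrightarrow> X \<subseteq> V \<longrightarrow> z \<in> V}"

inductive_set ring_gen :: "complex set \<Rightarrow> complex set" for X where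
  gen: "x \<in> X \<Longrightarrow> x \<in> ring_gen X"
| one: "1 \<in> ring_gen X"
| diff: "x \<in> ring_gen X \<Longrightarrow> y \<in> ring_gen X \<Longrightarrow> x - y \<in> ring_gen X"
| mult: "x \<in> ring_gen X \<Longrightarrow> y \<in> ring_gen X \<Longrightarrow> x * y \<in> ring_gen X"

lemma csubring_ring_gen: "csubring (ring_gen X)"
  by (auto simp: csubring_def intro: ring_gen.intros)

lemma ring_gen_minimal: "csubring R \<Longrightarrow> X \<subseteq> R \<Longrightarrow> ring_gen X \<subseteq> R"
proof
  fix x assume R: "csubring R" "X \<subseteq> R" and "x \<in> ring_gen X"
  from this(3) show "x \<in> R"
    by induction (use R in \<open>auto intro: csubring_1 csubring_diff csubring_mult\<close>)
qed

lemma ring_gen_mono: "X \<subseteq> Y \<Longrightarrow> ring_gen X \<subseteq> ring_gen Y"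
  by (intro ring_gen_minimal csubring_ring_gen) (auto intro: ring_gen.gen)

lemma val_ring_imp_csubring: "val_ring V \<Longrightarrow> csubring V"
  by (simp add: val_ring_def)

lemma csubring_integral_over: "csubring (integral_over X)"
  unfolding csubring_def integral_over_def
  by (auto intro: csubring_1 csubring_diff csubring_mult dest: val_ring_imp_csubring)

lemma ring_gen_subset_integral_over: "ring_gen X \<subseteq> integral_over X"
  by (intro ring_gen_minimal csubring_integral_over) (auto simp: integral_over_def)

text \<open>If \<open>x\<close> were outside \<open>V\<close>, then \<open>inverse x\<close> would
  be inside, and the monic equation divided by \<open>x ^ (degree p - 1)\<close> would express
  \<open>x\<close> through powers of \<open>inverse x\<close>.\<close>

lemma val_ring_integrally_closed:
  assumes V: "val_ring V" and p: "p \<in> polys_over V" "lead_coeff p = 1" "poly p x = 0"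
  shows "x \<in> V"
proof (rule ccontr)
  assume x: "x \<notin> V"
  note R = val_ring_imp_csubring[OF V]
  have x0: "x \<noteq> 0" using x csubring_0[OF R] by auto
  define y where "y = inverse x"
  have y: "y \<in> V" using V x by (auto simp: val_ring_def y_def)
  have "degree p \<noteq> 0"
  proof
    assume "degree p = 0"
    then obtain c where "p = [:c:]" by (auto elim: degree_eq_zeroE)
    then show False using p by simp
  qed
  then obtain n where n: "degree p = Suc n" by (cases "degree p") auto
  have "0 = y ^ n * (\<Sum>i\<le>Suc n. coeff p i * x ^ i)"
    using p by (simp add: poly_altdef n)
  also have "\<dots> = y ^ n * x ^ Suc n + (\<Sum>i\<le>n. coeff p i * (y ^ n * x ^ i))"
    using p n by (simp add: sum_distrib_left ring_distribs mult_ac)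
  also have "y ^ n * x ^ Suc n = x"
    using x0 by (simp add: y_def power_inverse field_simps)
  also have "(\<Sum>i\<le>n. coeff p i * (y ^ n * x ^ i)) = (\<Sum>i\<le>n. coeff p i * y ^ (n - i))"
  proof (intro sum.cong refl)
    fix i assume "i \<in> {..n}"
    then have "y ^ n = y ^ (n - i) * y ^ i" by (simp flip: power_add)
    then show "coeff p i * (y ^ n * x ^ i) = coeff p i * y ^ (n - i)"
      using x0 by (simp add: y_def power_inverse field_simps)
  qed
  finally have "x = - (\<Sum>i\<le>n. coeff p i * y ^ (n - i))"
    by (simp add: eq_neg_iff_add_eq_0)
  also have "\<dots> \<in> V"
    by (intro csubring_uminus[OF R] csubring_sum[OF R] csubring_mult[OF R] csubring_power[OF R]
        y polys_over_coeff[OF p(1)])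
  finally show False using x by simp
qed

lemma integral_over_root:
  assumes "p \<in> polys_over (integral_over X)" "lead_coeff p = 1" "poly p x = 0"
  shows "x \<in> integral_over X"
proof -
  have "x \<in> V" if V: "val_ring V" "X \<subseteq> V" for V
  proof (rule val_ring_integrally_closed[OF V(1) _ assms(2,3)])
    have "integral_over X \<subseteq> V" using V by (auto simp: integral_over_def)
    then show "p \<in> polys_over V" using assms(1) polys_over_mono by blast
  qed
  then show ?thesis by (auto simp: integral_over_def)
qed

section \<open>Existence of valuation rings and monic equations\<close>

definition adjoin_ring :: "complex set \<Rightarrow> complex \<Rightarrow> complex set" where
  "adjoin_ring R x = (\<lambda>p. poly p x) ` polys_over R"

lemma csubring_adjoin_ring:
  assumes "csubring R" shows "csubring (adjoin_ring R x)"
  unfolding csubring_def adjoin_ring_def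
proof (intro conjI ballI)
  show "1 \<in> (\<lambda>p. poly p x) ` polys_over R"
    using polys_over_1[OF assms] by (intro image_eqI[of _ _ 1]) auto
  fix a b assume "a \<in> (\<lambda>p. poly p x) ` polys_over R" "b \<in> (\<lambda>p. poly p x) ` polys_over R"
  then obtain p q where pq: "p \<in> polys_over R" "q \<in> polys_over R" "a = poly p x" "b = poly q x" by blast
  show "a - b \<in> (\<lambda>p. poly p x) ` polys_over R"
    using polys_over_diff[OF assms] pq by (intro image_eqI[of _ _ "p - q"]) auto
  show "a * b \<in> (\<lambda>p. poly p x) ` polys_over R"
    using polys_over_mult[OF assms] pq by (intro image_eqI[of _ _ "p * q"]) auto
qed

lemma adjoin_ring_supset: "csubring R \<Longrightarrow> R \<subseteq> adjoin_ring R x"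
  unfolding adjoin_ring_def by (auto intro!: image_eqI[of _ _ "[:c:]" for c] polys_over_const)

lemma adjoin_ring_elem: "csubring R \<Longrightarrow> x \<in> adjoin_ring R x"
  unfolding adjoin_ring_def
  by (intro image_eqI[of _ _ "[:0, 1:]"] polys_over_pCons polys_over_const csubring_0 csubring_1) auto

text \<open>By maximality \<open>z\<close> is a polynomial value at every \<open>w\<close> outside
  \<open>V\<close>. If both \<open>w\<close> and \<open>inverse w\<close> were outside, the two
  expressions of least degree for \<open>z\<close> could be combined into one of smaller
  degree.\<close>

lemma maximal_subring_is_val_ring:
  assumes V: "csubring V" and z: "z \<notin> V" "inverse z \<in> V"
    and max: "\<And>S. csubring S \<Longrightarrow> V \<subseteq> S \<Longrightarrow> z \<notin> S \<Longrightarrow> S = V"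
  shows "val_ring V"
proof -
  define u where "u = inverse z"
  have z0: "z \<noteq> 0" using z csubring_0[OF V] by auto
  have uz: "u * z = 1" using z0 by (simp add: u_def)
  have uV: "u \<in> V" using z by (simp add: u_def)
  have adj: "\<exists>p. p \<in> polys_over V \<and> poly p w = z" if "w \<notin> V" for w
  proof (rule ccontr)
    assume "\<nexists>p. p \<in> polys_over V \<and> poly p w = z"
    then have "z \<notin> adjoin_ring V w" by (auto simp: adjoin_ring_def)
    then have "adjoin_ring V w = V"
      using max csubring_adjoin_ring[OF V] adjoin_ring_supset[OF V] by blast
    then show False using adjoin_ring_elem[OF V, of w] that by simp
  qed
  \<comment> \<open>In other words \<open>u\<close> lies in the Jacobson radical. With
    \<open>t = 1 - u * a\<close> one has \<open>t * z = z - a\<close>, so powers of \<open>t\<close>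
    do not change \<open>z\<close> modulo \<open>V\<close>. If \<open>inverse t\<close> were outside
    \<open>V\<close>, clearing denominators in \<open>poly p (inverse t) = z\<close> would put some
    \<open>t ^ k * z\<close>, hence \<open>z\<close>, into \<open>V\<close>.\<close>
  have unit: "1 - u * a \<noteq> 0 \<and> inverse (1 - u * a) \<in> V" if a: "a \<in> V" for a
  proof (rule ccontr)
    define t where "t = 1 - u * a"
    assume *: "\<not> (1 - u * a \<noteq> 0 \<and> inverse (1 - u * a) \<in> V)"
    have tV: "t \<in> V" unfolding t_def by (intro csubring_diff[OF V] csubring_1[OF V] csubring_mult[OF V] uV a)
    have t0: "t \<noteq> 0"
    proof
      assume "t = 0"
      then have "z * (u * a) = z" by (simp add: t_def)
      then have "a = z" using uz by (simp add: mult_ac flip: mult.assoc)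
      then show False using a z by simp
    qed
    with * obtain p where p: "p \<in> polys_over V" "poly p (inverse t) = z"
      using adj[of "inverse t"] by (auto simp: t_def)
    have 1: "t ^ k * z - z \<in> V" for k
    proof (induction k)
      case 0
      then show ?case using csubring_0[OF V] by simp
    next
      case (Suc k)
      have "t ^ Suc k * z - z = (t ^ k * z - z) - a * t ^ k * (u * z)"
        by (simp add: t_def algebra_simps)
      also have "\<dots> \<in> V" unfolding uz
        by (intro csubring_diff[OF V] Suc csubring_mult[OF V] csubring_power[OF V] a tV csubring_1[OF V])
      finally show ?case .
    qed
    have "t ^ degree p * z = (\<Sum>i\<le>degree p. coeff p i * t ^ (degree p - i))"
      unfolding p(2)[symmetric] poly_altdef sum_distrib_left
    proof (intro sum.cong refl)
      fix i assume "i \<in> {..degree p}"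
      then have "t ^ degree p = t ^ (degree p - i) * t ^ i" by (simp flip: power_add)
      then show "t ^ degree p * (coeff p i * inverse t ^ i) = coeff p i * t ^ (degree p - i)"
        using t0 by (simp add: power_inverse field_simps)
    qed
    also have "\<dots> \<in> V"
      by (intro csubring_sum[OF V] csubring_mult[OF V] csubring_power[OF V] tV polys_over_coeff[OF p(1)])
    finally have "t ^ degree p * z \<in> V" .
    from csubring_diff[OF V this 1[of "degree p"]] have "z \<in> V" by simp
    then show False using z by simp
  qed
  \<comment> \<open>Multiply \<open>poly q (inverse w) = z\<close> by \<open>u * w ^ n\<close> and
    divide by the unit \<open>1 - u * coeff q 0\<close>: this writes \<open>w ^ n\<close> as a
    polynomial in \<open>w\<close> of degree below \<open>n\<close>. Substituting it for the top
    power in \<open>p\<close> contradicts the minimal degree of \<open>p\<close>.\<close>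
  have no: False if w: "w \<noteq> 0" and p: "p \<in> polys_over V" "poly p w = z"
    and pmin: "\<And>p'. p' \<in> polys_over V \<Longrightarrow> poly p' w = z \<Longrightarrow> degree p \<le> degree p'"
    and q: "q \<in> polys_over V" "poly q (inverse w) = z" and le: "degree q \<le> degree p" for w p q
  proof -
    define n m where "n = degree p" and "m = degree q"
    have n0: "n \<noteq> 0"
    proof
      assume "n = 0"
      then obtain c where "p = [:c:]" by (auto simp: n_def elim: degree_eq_zeroE)
      then show False using p z polys_over_coeff[OF p(1), of 0] by simp
    qed
    define v where "v = inverse (1 - u * coeff q 0)"
    have v: "v \<in> V" "v * (1 - u * coeff q 0) = 1"
      using unit[OF polys_over_coeff[OF q(1), of 0]] by (auto simp: v_def)
    define r where "r = (\<Sum>j=1..m. monom (v * u * coeff q j) (n - j))"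
    have r: "r \<in> polys_over V" unfolding r_def
      by (intro polys_over_sum[OF V] polys_over_monom[OF V] csubring_mult[OF V] v uV polys_over_coeff[OF q(1)])
    have "w ^ n * z = w ^ n * coeff q 0 + (\<Sum>j=1..m. coeff q j * w ^ (n - j))"
    proof -
      have "w ^ n * z = (\<Sum>j\<le>m. w ^ n * (coeff q j * inverse w ^ j))"
        unfolding q(2)[symmetric] poly_altdef sum_distrib_left m_def ..
      also have "\<dots> = (\<Sum>j\<le>m. coeff q j * w ^ (n - j))"
      proof (intro sum.cong refl)
        fix i assume "i \<in> {..m}"
        then have "w ^ n = w ^ (n - i) * w ^ i" using le by (simp add: n_def m_def flip: power_add)
        then show "w ^ n * (coeff q i * inverse w ^ i) = coeff q i * w ^ (n - i)"
          using w by (simp add: power_inverse field_simps)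
      qed
      also have "{..m} = insert 0 {1..m}" by auto
      finally show ?thesis by simp
    qed
    then have "v * u * (w ^ n * z) = v * u * (w ^ n * coeff q 0 + (\<Sum>j=1..m. coeff q j * w ^ (n - j)))"
      by simp
    moreover have "v * u * (\<Sum>j=1..m. coeff q j * w ^ (n - j)) = poly r w"
      by (simp add: r_def poly_sum poly_monom sum_distrib_left mult_ac)
    moreover have "v * u * (w ^ n * z) = v * w ^ n * (u * z)" by (simp add: mult_ac)
    ultimately have "v * w ^ n = v * u * w ^ n * coeff q 0 + poly r w"
      by (simp add: uz ring_distribs mult_ac)
    then have "v * (1 - u * coeff q 0) * w ^ n = poly r w" by (simp add: algebra_simps)
    then have wn: "w ^ n = poly r w" by (simp add: v)
    define p' where "p' = p - smult (coeff p n) (monom 1 n - r)"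
    have "p' \<in> polys_over V" unfolding p'_def
      by (intro polys_over_diff[OF V] polys_over_smult[OF V] polys_over_monom[OF V] csubring_1[OF V]
          p r polys_over_coeff[OF p(1)])
    moreover have "poly p' w = z" using p wn by (simp add: p'_def poly_monom)
    ultimately have "n \<le> degree p'" using pmin by (simp add: n_def)
    moreover have "degree p' < n"
    proof -
      have dr: "degree r < n"
      proof -
        have "degree r \<le> n - 1" unfolding r_def
        proof (rule degree_sum_le)
          fix j assume "j \<in> {1..m}"
          then show "degree (monom (v * u * coeff q j) (n - j)) \<le> n - 1"
            by (intro order.trans[OF degree_monom_le]) auto
        qed simp
        then show ?thesis using n0 by simp
      qed
      then have cr: "coeff r i = 0" if "i \<ge> n" for i
        using that by (simp add: coeff_eq_0)
      have "coeff p' i = 0" if "i \<ge> n" for i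
        using that n0 cr[OF that] coeff_eq_0[of p i] by (cases "i = n") (auto simp: p'_def n_def)
      then show ?thesis using n0 by (metis degree_0 gr0I leading_coeff_0_iff not_le_imp_less)
    qed
    ultimately show False by simp
  qed
  have "w \<in> V \<or> inverse w \<in> V" for w
  proof (rule ccontr)
    assume *: "\<not> (w \<in> V \<or> inverse w \<in> V)"
    then have w0: "w \<noteq> 0" using csubring_0[OF V] by auto
    define P where "P = (\<lambda>w p. p \<in> polys_over V \<and> poly p w = z)"
    obtain p where p: "P w p" "\<And>p'. P w p' \<Longrightarrow> degree p \<le> degree p'"
      using adj[of w] * ex_has_least_nat[of "P w" _ degree] by (auto simp: P_def)
    obtain q where q: "P (inverse w) q" "\<And>p'. P (inverse w) p' \<Longrightarrow> degree q \<le> degree p'"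
      using adj[of "inverse w"] * ex_has_least_nat[of "P (inverse w)" _ degree] by (auto simp: P_def)
    show False
    proof (cases "degree q \<le> degree p")
      case True
      then show False using no[of w p q] p q w0 by (auto simp: P_def)
    next
      case False
      then show False using no[of "inverse w" q p] p q w0 by (auto simp: P_def)
    qed
  qed
  then show ?thesis using V by (auto simp: val_ring_def)
qed

text \<open>Without a monic equation \<open>z\<close> is not a polynomial in
  \<open>inverse z\<close> over \<open>ring_gen X\<close>, since clearing denominators would give
  one. A subring maximal among those that contain \<open>ring_gen X\<close> and
  \<open>inverse z\<close> but not \<open>z\<close> is then a valuation ring that refutes
  integrality.\<close>

lemma integral_over_imp_monic_equation:
  assumes "z \<in> integral_over X"
  obtains p where "p \<in> polys_over (ring_gen X)" "lead_coeff p = 1" "poly p z = 0"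
proof (rule ccontr)
  assume no: "\<not> thesis"
  let ?R = "ring_gen X"
  note R = csubring_ring_gen[of X]
  have z0: "z \<noteq> 0"
  proof
    assume "z = 0"
    then show False
      using no that[of "[:0, 1:]"] polys_over_pCons[OF R] polys_over_const[OF R] csubring_0[OF R] csubring_1[OF R]
      by simp
  qed
  define B where "B = adjoin_ring ?R (inverse z)"
  have B: "csubring B" "?R \<subseteq> B" "inverse z \<in> B"
    unfolding B_def using csubring_adjoin_ring adjoin_ring_supset adjoin_ring_elem R by auto
  have zB: "z \<notin> B"
  proof
    assume "z \<in> B"
    then obtain p where p: "p \<in> polys_over ?R" "z = poly p (inverse z)"
      by (auto simp: B_def adjoin_ring_def)
    define n where "n = degree p"
    define r where "r = (\<Sum>i\<le>n. monom (coeff p i) (n - i))"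
    have r: "r \<in> polys_over ?R" unfolding r_def
      by (intro polys_over_sum[OF R] polys_over_monom[OF R] polys_over_coeff[OF p(1)])
    have dr: "degree r \<le> n" unfolding r_def
      by (intro degree_sum_le) (auto intro: order.trans[OF degree_monom_le])
    have "z ^ Suc n = z ^ n * poly p (inverse z)" using p(2) by simp
    also have "\<dots> = poly r z"
      unfolding poly_altdef[of p] sum_distrib_left r_def poly_sum poly_monom n_def[symmetric]
    proof (intro sum.cong refl)
      fix i assume "i \<in> {..n}"
      then have "z ^ n = z ^ (n - i) * z ^ i" by (simp flip: power_add)
      then show "z ^ n * (coeff p i * inverse z ^ i) = coeff p i * z ^ (n - i)"
        using z0 by (simp add: power_inverse field_simps)
    qed
    finally have eq: "z ^ Suc n = poly r z" .
    let ?P = "monom 1 (Suc n) + (- r)"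
    have d: "degree ?P = Suc n"
      using dr by (subst degree_add_eq_left) (auto simp: degree_monom_eq)
    have "coeff ?P (Suc n) = 1" using dr by (simp add: coeff_eq_0)
    then have "lead_coeff ?P = 1" using d by (simp only:)
    moreover have "?P \<in> polys_over ?R"
      by (intro polys_over_add[OF R] polys_over_uminus[OF R] polys_over_monom[OF R] csubring_1[OF R] r)
    moreover have "poly ?P z = 0" using eq by (simp add: poly_monom)
    ultimately show False using no that by blast
  qed
  define A where "A = {S. csubring S \<and> B \<subseteq> S \<and> z \<notin> S}"
  have "\<exists>M\<in>A. \<forall>S\<in>A. M \<subseteq> S \<longrightarrow> S = M"
  proof (rule subset_Zorn_nonempty)
    show "A \<noteq> {}" using B zB by (auto simp: A_def)
    fix C assume C: "C \<noteq> {}" "subset.chain A C"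
    have CA: "C \<subseteq> A" using C by (auto simp: subset.chain_def)
    have two: "\<exists>S\<in>C. x \<in> S \<and> y \<in> S" if "x \<in> \<Union>C" "y \<in> \<Union>C" for x y
      using that C(2) unfolding subset.chain_def by blast
    have "csubring (\<Union>C)"
      unfolding csubring_def
    proof (intro conjI ballI)
      show "1 \<in> \<Union>C" using C(1) CA csubring_1 by (fastforce simp: A_def)
      fix x y assume "x \<in> \<Union>C" "y \<in> \<Union>C"
      then obtain S where S: "S \<in> C" "x \<in> S" "y \<in> S" using two by blast
      then have "csubring S" using CA by (auto simp: A_def)
      then show "x - y \<in> \<Union>C" "x * y \<in> \<Union>C" using S csubring_diff csubring_mult by blast+
    qed
    then show "\<Union>C \<in> A" using C(1) CA by (auto simp: A_def)
  qed
  then obtain V where V: "V \<in> A" "\<And>S. S \<in> A \<Longrightarrow> V \<subseteq> S \<Longrightarrow> S = V" by blast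
  have VA: "csubring V" "B \<subseteq> V" "z \<notin> V" using V(1) by (auto simp: A_def)
  have "S = V" if "csubring S" "V \<subseteq> S" "z \<notin> S" for S
    using V(2)[of S] that VA by (auto simp: A_def)
  then have "val_ring V"
    using VA B by (intro maximal_subring_is_val_ring[of V z]) auto
  moreover have "X \<subseteq> V" using V B ring_gen.gen[of _ X] by (auto simp: A_def)
  ultimately have "z \<in> V" using assms by (auto simp: integral_over_def)
  then show False using V by (auto simp: A_def)
qed

lemma integral_over_insert:
  assumes "t \<in> integral_over X"
  shows "integral_over (insert t X) = integral_over X"
  using assms by (auto simp: integral_over_def)

text \<open>The roots of \<open>g\<close> are roots of \<open>p\<close>, hence integral, and the
  coefficients of \<open>g\<close> are polynomials in these roots.\<close>

lemma integral_over_root_coeffs: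
  assumes p: "p \<in> polys_over (integral_over X)" "lead_coeff p = 1"
    and g: "g dvd p" "lead_coeff g = 1"
  shows "g \<in> polys_over (integral_over X)"
proof -
  note I = csubring_integral_over[of X]
  have g0: "g \<noteq> 0" using g by auto
  have "y \<in> integral_over X" if "y \<in># proots g" for y
  proof -
    have "poly p y = 0" using that g g0 by auto
    then show ?thesis using integral_over_root p by blast
  qed
  moreover have "g = (\<Prod>y\<in>#proots g. [:-y, 1:])"
    using complex_poly_decompose_multiset[of g] g by simp
  ultimately show ?thesis
    by (metis (no_types, lifting) I polys_over_prod_mset polys_over_pCons polys_over_const csubring_1
        csubring_uminus)
qed

text \<open>Without generators \<open>ring_gen\<close> contains only integers, so integrality means
  being an algebraic integer. This is the arithmetic input at the bottom of the tower of
  fields.\<close>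

lemma rational_integral:
  assumes "z \<in> \<rat>" "z \<in> integral_over {}"
  shows "z \<in> \<int>"
proof -
  obtain p where p: "p \<in> polys_over (ring_gen {})" "lead_coeff p = 1" "poly p z = 0"
    using integral_over_imp_monic_equation assms(2) by blast
  have "ring_gen {} \<subseteq> \<int>"
    by (intro ring_gen_minimal) (auto simp: csubring_def)
  then have "algebraic_int z" using p by (auto simp: algebraic_int.simps polys_over_def)
  then show ?thesis using assms(1) rational_algebraic_int_is_int by blast
qed

section \<open>Embeddings: growth, closeness to the identity, extension\<close>

text \<open>The scale on which all upper bounds are measured. The summand 1 makes its powers
  monotone in the exponent.\<close>

definition emb_size :: "(complex \<Rightarrow> complex) \<Rightarrow> complex set \<Rightarrow> real" where
  "emb_size s X = 1 + (\<Sum>x\<in>X. norm (s x))"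

lemma emb_size_ge_1: "emb_size s X \<ge> 1"
  by (simp add: emb_size_def sum_nonneg)

lemma norm_le_emb_size: "finite X \<Longrightarrow> x \<in> X \<Longrightarrow> norm (s x) \<le> emb_size s X"
  unfolding emb_size_def by (rule order.trans[OF member_le_sum[of x X "\<lambda>x. norm (s x)"]]) auto

lemma emb_size_insert_le:
  assumes "finite X" "\<And>x. x \<in> X \<Longrightarrow> s' x = s x"
  shows "emb_size s' (insert t X) \<le> emb_size s X + norm (s' t)"
proof -
  have "(\<Sum>x\<in>X. norm (s' x)) = (\<Sum>x\<in>X. norm (s x))" using assms by (intro sum.cong) auto
  then show ?thesis using assms(1) by (cases "t \<in> X") (auto simp: emb_size_def insert_absorb)
qed

section \<open>Bounds uniform over all embeddings\<close>

text \<open>One pair \<open>B\<close>, \<open>k\<close> serves all embeddings of \<open>K\<close>,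
  however large. Keeping \<open>B\<close> under the exponent matches the form of the bound in
  \<open>good_pair\<close>.\<close>

definition poly_bounded ::
    "complex set \<Rightarrow> complex set \<Rightarrow> ((complex \<Rightarrow> complex) \<Rightarrow> real) \<Rightarrow> bool" where
  "poly_bounded K X g \<longleftrightarrow>
    (\<exists>B\<ge>1. \<exists>k. \<forall>s. embedding K s \<longrightarrow> g s \<le> (B * emb_size s X) ^ k)"

lemma poly_bounded_mono:
  "poly_bounded K X g \<Longrightarrow> (\<And>s. embedding K s \<Longrightarrow> h s \<le> g s) \<Longrightarrow> poly_bounded K X h"
  unfolding poly_bounded_def by (meson order.trans)

lemma poly_bounded_const: "poly_bounded K X (\<lambda>_. c)"
  unfolding poly_bounded_def
proof (intro exI[of _ "max 1 c"] exI[of _ 1] conjI allI impI)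
  fix s
  have "max 1 c * 1 \<le> max 1 c * emb_size s X"
    by (intro mult_left_mono emb_size_ge_1) auto
  then show "c \<le> (max 1 c * emb_size s X) ^ 1" by simp
qed simp

lemma poly_bounded_emb_size: "poly_bounded K X (\<lambda>s. emb_size s X)"
  unfolding poly_bounded_def by (intro exI[of _ 1] conjI exI[of _ "1::nat"]) auto

lemma poly_bounded_elem: "finite X \<Longrightarrow> x \<in> X \<Longrightarrow> poly_bounded K X (\<lambda>s. norm (s x))"
  by (rule poly_bounded_mono[OF poly_bounded_emb_size]) (rule norm_le_emb_size)

lemma poly_bounded_uniform:
  assumes "poly_bounded K X g" "poly_bounded K X h"
  obtains B k where "B \<ge> 1" "\<And>s. embedding K s \<Longrightarrow> g s \<le> (B * emb_size s X) ^ k"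
    "\<And>s. embedding K s \<Longrightarrow> h s \<le> (B * emb_size s X) ^ k"
proof -
  obtain B1 k1 where 1: "B1 \<ge> 1" "\<And>s. embedding K s \<Longrightarrow> g s \<le> (B1 * emb_size s X) ^ k1"
    using assms(1) by (auto simp: poly_bounded_def)
  obtain B2 k2 where 2: "B2 \<ge> 1" "\<And>s. embedding K s \<Longrightarrow> h s \<le> (B2 * emb_size s X) ^ k2"
    using assms(2) by (auto simp: poly_bounded_def)
  have le: "(B * emb_size s X) ^ k \<le> (max B1 B2 * emb_size s X) ^ max k1 k2"
    if "1 \<le> B" "B \<le> max B1 B2" "k \<le> max k1 k2" for B s k
  proof -
    have "1 * 1 \<le> B * emb_size s X" using that emb_size_ge_1[of s X] by (intro mult_mono) auto
    moreover have "B * emb_size s X \<le> max B1 B2 * emb_size s X"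
      using that emb_size_ge_1[of s X] by (intro mult_right_mono) auto
    ultimately show ?thesis using that
      by (intro order.trans[OF power_mono power_increasing]) auto
  qed
  show thesis
  proof (rule that[of "max B1 B2" "max k1 k2"])
    show "1 \<le> max B1 B2" using 1 by simp
    fix s assume s: "embedding K s"
    show "g s \<le> (max B1 B2 * emb_size s X) ^ max k1 k2"
      using 1(2)[OF s] le[OF 1(1), of k1 s] by simp
    show "h s \<le> (max B1 B2 * emb_size s X) ^ max k1 k2"
      using 2(2)[OF s] le[OF 2(1), of k2 s] by simp
  qed
qed

lemma poly_bounded_add:
  assumes "poly_bounded K X g" "poly_bounded K X h"
  shows "poly_bounded K X (\<lambda>s. g s + h s)"
proof -
  obtain B k where B: "B \<ge> 1" "\<And>s. embedding K s \<Longrightarrow> g s \<le> (B * emb_size s X) ^ k"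
    "\<And>s. embedding K s \<Longrightarrow> h s \<le> (B * emb_size s X) ^ k"
    using poly_bounded_uniform[OF assms] by blast
  show ?thesis
    unfolding poly_bounded_def
  proof (intro exI[of _ "2 * B"] exI[of _ "Suc k"] conjI allI impI)
    fix s assume s: "embedding K s"
    have pos: "1 \<le> B * emb_size s X" using B(1) emb_size_ge_1[of s X] mult_mono[of 1 B 1 "emb_size s X"] by simp
    have "g s + h s \<le> 2 * (B * emb_size s X) ^ k" using B(2,3)[OF s] by simp
    also have "\<dots> \<le> (2 * 2 ^ k) * ((B * emb_size s X) * (B * emb_size s X) ^ k)"
    proof (rule mult_mono)
      show "(B * emb_size s X) ^ k \<le> (B * emb_size s X) * (B * emb_size s X) ^ k"
        using pos mult_right_mono[of 1 "B * emb_size s X" "(B * emb_size s X) ^ k"] by simp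
    qed (use pos in auto)
    also have "\<dots> = (2 * B * emb_size s X) ^ Suc k" by (simp add: power_mult_distrib)
    finally show "g s + h s \<le> (2 * B * emb_size s X) ^ Suc k" .
  qed (use B in auto)
qed

lemma poly_bounded_mult:
  assumes "poly_bounded K X g" "poly_bounded K X h" "\<And>s. g s \<ge> 0" "\<And>s. h s \<ge> 0"
  shows "poly_bounded K X (\<lambda>s. g s * h s)"
proof -
  obtain B k where B: "B \<ge> 1" "\<And>s. embedding K s \<Longrightarrow> g s \<le> (B * emb_size s X) ^ k"
    "\<And>s. embedding K s \<Longrightarrow> h s \<le> (B * emb_size s X) ^ k"
    using poly_bounded_uniform[OF assms(1,2)] by blast
  show ?thesis
    unfolding poly_bounded_def
  proof (intro exI[of _ B] exI[of _ "k + k"] conjI allI impI)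
    fix s assume s: "embedding K s"
    show "g s * h s \<le> (B * emb_size s X) ^ (k + k)"
      unfolding power_add
    proof (rule mult_mono)
      have "0 \<le> B * emb_size s X" using B(1) emb_size_ge_1[of s X] by simp
      then show "0 \<le> (B * emb_size s X) ^ k" by simp
    qed (use B(2,3)[OF s] assms(3,4) in auto)
  qed (use B in auto)
qed

lemma poly_bounded_sum:
  "(\<And>i. i \<in> A \<Longrightarrow> poly_bounded K X (g i)) \<Longrightarrow> poly_bounded K X (\<lambda>s. \<Sum>i\<in>A. g i s)"
  by (induction A rule: infinite_finite_induct) (simp_all add: poly_bounded_const poly_bounded_add)

lemma ring_gen_subset: "csubfield K \<Longrightarrow> X \<subseteq> K \<Longrightarrow> ring_gen X \<subseteq> K"
  by (intro ring_gen_minimal csubfield_imp_csubring)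

lemma poly_bounded_ring_gen:
  assumes K: "csubfield K" and X: "finite X" "X \<subseteq> K"
  shows "r \<in> ring_gen X \<Longrightarrow> poly_bounded K X (\<lambda>s. norm (s r))"
proof (induction rule: ring_gen.induct)
  case (gen x)
  then show ?case using X poly_bounded_elem by blast
next
  case one
  show ?case by (rule poly_bounded_mono[OF poly_bounded_const[of _ _ 1]]) (simp add: embedding_1[OF K])
next
  case (diff x y)
  then have "x \<in> K" "y \<in> K" using ring_gen_subset[OF K X(2)] by auto
  then show ?case
    by (intro poly_bounded_mono[OF poly_bounded_add[OF diff.IH]])
      (simp add: embedding_diff[OF K] norm_triangle_ineq4)
next
  case (mult x y)
  then have "x \<in> K" "y \<in> K" using ring_gen_subset[OF K X(2)] by auto
  then show ?case
    by (intro poly_bounded_mono[OF poly_bounded_mult[OF mult.IH]])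
      (auto simp: embedding_mult[OF K] norm_mult)
qed

section \<open>Embeddings close to the identity\<close>

text \<open>Neighbourhoods of the identity, with distances measured on \<open>X\<close> only. Being
  a filter, it gives access to the limit rules.\<close>

definition near_id :: "complex set \<Rightarrow> complex set \<Rightarrow> (complex \<Rightarrow> complex) filter" where
  "near_id K X = (INF e\<in>{0<..}. principal {s. embedding K s \<and> (\<forall>x\<in>X. dist (s x) x < e)})"

lemma eventually_near_id:
  "eventually P (near_id K X) \<longleftrightarrow>
    (\<exists>e>0. \<forall>s. embedding K s \<longrightarrow> (\<forall>x\<in>X. dist (s x) x < e) \<longrightarrow> P s)"
  unfolding near_id_def
proof (subst eventually_INF_base)
  fix a b :: real assume "a \<in> {0<..}" "b \<in> {0<..}"
  then show "\<exists>x\<in>{0<..}. principal {s. embedding K s \<and> (\<forall>y\<in>X. dist (s y) y < x)}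
      \<le> inf (principal {s. embedding K s \<and> (\<forall>x\<in>X. dist (s x) x < a)})
          (principal {s. embedding K s \<and> (\<forall>x\<in>X. dist (s x) x < b)})"
    by (intro bexI[of _ "min a b"]) auto
qed (auto simp: eventually_principal)

lemma eventually_near_id_embedding: "eventually (embedding K) (near_id K X)"
  unfolding eventually_near_id by (intro exI[of _ 1]) auto

lemma tendsto_near_id_ring_gen:
  assumes K: "csubfield K" and X: "X \<subseteq> K"
  shows "r \<in> ring_gen X \<Longrightarrow> ((\<lambda>s. s r) \<longlongrightarrow> r) (near_id K X)"
proof (induction rule: ring_gen.induct)
  case (gen x)
  then show ?case unfolding tendsto_iff eventually_near_id by blast
next
  case one
  have "eventually (\<lambda>s. 1 = s 1) (near_id K X)"
    using eventually_near_id_embedding by eventually_elim (simp add: embedding_1[OF K])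
  then show ?case by (rule tendsto_eventually[OF eventually_mono]) auto
next
  case (diff x y)
  then have xy: "x \<in> K" "y \<in> K" using ring_gen_subset[OF K X] by auto
  have "eventually (\<lambda>s. s (x - y) = s x - s y) (near_id K X)"
    using eventually_near_id_embedding by eventually_elim (use xy in \<open>simp add: embedding_diff[OF K]\<close>)
  then show ?case using tendsto_diff[OF diff.IH] by (simp add: tendsto_cong)
next
  case (mult x y)
  then have xy: "x \<in> K" "y \<in> K" using ring_gen_subset[OF K X] by auto
  have "eventually (\<lambda>s. s (x * y) = s x * s y) (near_id K X)"
    using eventually_near_id_embedding by eventually_elim (use xy in \<open>simp add: embedding_mult[OF K]\<close>)
  then show ?case using tendsto_mult[OF mult.IH] by (simp add: tendsto_cong)
qed

text \<open>For \<open>X\<close> contained in the field \<open>K\<close>, this makes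
  \<open>K\<close> the field of fractions of \<open>ring_gen X\<close>. Hence closeness to the
  identity on \<open>X\<close> implies closeness at each element of \<open>K\<close>.\<close>

definition fractions_of :: "complex set \<Rightarrow> complex set \<Rightarrow> bool" where
  "fractions_of K X \<longleftrightarrow> (\<forall>z\<in>K. \<exists>q\<in>ring_gen X. q \<noteq> 0 \<and> q * z \<in> ring_gen X)"

lemma tendsto_near_id:
  assumes K: "csubfield K" and X: "X \<subseteq> K" and fr: "fractions_of K X" and z: "z \<in> K"
  shows "((\<lambda>s. s z) \<longlongrightarrow> z) (near_id K X)"
proof -
  obtain q where q: "q \<in> ring_gen X" "q \<noteq> 0" "q * z \<in> ring_gen X"
    using fr z by (auto simp: fractions_of_def)
  then have qK: "q \<in> K" "q * z \<in> K" using ring_gen_subset[OF K X] by auto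
  have "eventually (\<lambda>s. s z = s (q * z) / s q) (near_id K X)"
    using eventually_near_id_embedding
    by eventually_elim
      (use qK q z in \<open>simp add: embedding_divide[OF K, symmetric]\<close>)
  moreover have "((\<lambda>s. s (q * z) / s q) \<longlongrightarrow> (q * z) / q) (near_id K X)"
    by (intro tendsto_divide tendsto_near_id_ring_gen K X q)
  ultimately show ?thesis using q by (simp add: tendsto_cong)
qed

lemma tendsto_near_id_poly:
  assumes K: "csubfield K" and X: "X \<subseteq> K" and fr: "fractions_of K X" and p: "p \<in> polys_over K"
  shows "((\<lambda>s. poly (map_poly s p) x) \<longlongrightarrow> poly p x) (near_id K X)"
proof -
  have "eventually (\<lambda>s. poly (map_poly s p) x = (\<Sum>i\<le>degree p. s (coeff p i) * x ^ i)) (near_id K X)"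
    using eventually_near_id_embedding
    by eventually_elim
      (use p in \<open>simp add: poly_altdef degree_map_embedding[OF K] coeff_map_embedding[OF K]\<close>)
  moreover have "((\<lambda>s. \<Sum>i\<le>degree p. s (coeff p i) * x ^ i) \<longlongrightarrow> poly p x) (near_id K X)"
    unfolding poly_altdef
    by (intro tendsto_intros tendsto_near_id[OF K X fr] polys_over_coeff[OF p])
  ultimately show ?thesis by (simp add: tendsto_cong)
qed

lemma poly_common_denominator:
  assumes K: "csubfield K" and fr: "fractions_of K X"
  shows "p \<in> polys_over K \<Longrightarrow> \<exists>q\<in>ring_gen X. q \<noteq> 0 \<and> smult q p \<in> polys_over (ring_gen X)"
proof (induction p)
  case 0
  then show ?case
    using csubring_1 polys_over_0 csubring_ring_gen by (intro bexI[of _ 1]) auto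
next
  case (pCons a p)
  have ap: "a \<in> K" "p \<in> polys_over K"
    using pCons.prems(1) unfolding polys_over_def
    by (auto dest: spec[of _ 0] spec[of _ "Suc _"])
  obtain q where q: "q \<in> ring_gen X" "q \<noteq> 0" "smult q p \<in> polys_over (ring_gen X)"
    using pCons.IH ap by blast
  obtain u where u: "u \<in> ring_gen X" "u \<noteq> 0" "u * a \<in> ring_gen X"
    using fr ap by (auto simp: fractions_of_def)
  note R = csubring_ring_gen[of X]
  have "smult (q * u) (pCons a p) = pCons (q * (u * a)) (smult u (smult q p))"
    by (simp add: mult_ac)
  also have "\<dots> \<in> polys_over (ring_gen X)"
    by (intro polys_over_pCons[OF R] polys_over_smult[OF R] csubring_mult[OF R] q u)
  finally show ?case using q u csubring_mult[OF R] by (intro bexI[of _ "q * u"]) auto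
qed

section \<open>Simple extensions of fields and of embeddings\<close>

text \<open>Quotients are taken for algebraic \<open>c\<close> as well, so that one construction
  serves both kinds of generators.\<close>

definition field_adjoin :: "complex set \<Rightarrow> complex \<Rightarrow> complex set" where
  "field_adjoin K c = {poly p c / poly w c | p w. p \<in> polys_over K \<and> w \<in> polys_over K \<and> poly w c \<noteq> 0}"

lemma field_adjoinI:
  "p \<in> polys_over K \<Longrightarrow> w \<in> polys_over K \<Longrightarrow> poly w c \<noteq> 0 \<Longrightarrow> z = poly p c / poly w c \<Longrightarrow> z \<in> field_adjoin K c"
  by (auto simp: field_adjoin_def)

lemma field_adjoinE:
  assumes "z \<in> field_adjoin K c"
  obtains p w where "p \<in> polys_over K" "w \<in> polys_over K" "poly w c \<noteq> 0" "z = poly p c / poly w c"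
  using assms by (auto simp: field_adjoin_def)

lemma field_adjoin_poly: "csubfield K \<Longrightarrow> p \<in> polys_over K \<Longrightarrow> poly p c \<in> field_adjoin K c"
  by (intro field_adjoinI[of p K 1]) (auto intro: polys_over_1 csubfield_imp_csubring)

lemma field_adjoin_supset: "csubfield K \<Longrightarrow> K \<subseteq> field_adjoin K c"
  using field_adjoin_poly[of K "[:x:]" c for x] polys_over_const csubfield_imp_csubring by fastforce

lemma field_adjoin_elem: "csubfield K \<Longrightarrow> c \<in> field_adjoin K c"
  using field_adjoin_poly[of K "[:0, 1:]" c]
  by (simp add: polys_over_pCons polys_over_const csubring_0 csubring_1 csubfield_imp_csubring)

lemma csubfield_field_adjoin:
  assumes K: "csubfield K" shows "csubfield (field_adjoin K c)"
  unfolding csubfield_def csubring_def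
proof (intro conjI ballI)
  note R = csubfield_imp_csubring[OF K]
  show "1 \<in> field_adjoin K c" using field_adjoin_supset[OF K] csubring_1[OF R] by blast
  fix x assume "x \<in> field_adjoin K c"
  then obtain p w where pw: "p \<in> polys_over K" "w \<in> polys_over K" "poly w c \<noteq> 0" "x = poly p c / poly w c"
    by (rule field_adjoinE)
  show "inverse x \<in> field_adjoin K c"
  proof (cases "poly p c = 0")
    case True
    then show ?thesis using pw field_adjoin_supset[OF K] csubring_0[OF R] by auto
  next
    case False
    then show ?thesis using pw by (intro field_adjoinI[of w K p]) auto
  qed
  fix y assume "y \<in> field_adjoin K c"
  then obtain p' w' where pw': "p' \<in> polys_over K" "w' \<in> polys_over K" "poly w' c \<noteq> 0" "y = poly p' c / poly w' c"
    by (rule field_adjoinE)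
  show "x - y \<in> field_adjoin K c"
    using pw pw'
    by (intro field_adjoinI[of "p * w' - p' * w" K "w * w'"] polys_over_diff[OF R] polys_over_mult[OF R])
      (auto simp: diff_frac_eq)
  show "x * y \<in> field_adjoin K c"
    using pw pw' by (intro field_adjoinI[of "p * p'" K "w * w'"] polys_over_mult[OF R]) auto
qed

lemma countable_polys_over:
  assumes "countable K" shows "countable (polys_over K)"
proof -
  have "polys_over K \<subseteq> Poly ` lists (insert 0 K)"
  proof
    fix p assume "p \<in> polys_over K"
    then have "coeffs p \<in> lists (insert 0 K)"
      by (auto simp: polys_over_def in_lists_conv_set coeffs_def)
    then show "p \<in> Poly ` lists (insert 0 K)" by (metis Poly_coeffs image_eqI)
  qed
  then show ?thesis using assms by (meson countable_image countable_insert countable_lists countable_subset)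
qed

lemma countable_field_adjoin:
  assumes "countable K" shows "countable (field_adjoin K c)"
proof -
  have "field_adjoin K c \<subseteq> (\<lambda>(p, w). poly p c / poly w c) ` (polys_over K \<times> polys_over K)"
    by (auto simp: field_adjoin_def)
  then show ?thesis
    using countable_polys_over[OF assms] by (meson countable_SIGMA countable_image countable_subset)
qed

lemma fractions_of_field_adjoin:
  assumes K: "csubfield K" and fr: "fractions_of K X"
  shows "fractions_of (field_adjoin K c) (insert c X)"
  unfolding fractions_of_def
proof
  fix z assume "z \<in> field_adjoin K c"
  then obtain p w where pw: "p \<in> polys_over K" "w \<in> polys_over K" "poly w c \<noteq> 0" "z = poly p c / poly w c"
    by (rule field_adjoinE)
  obtain q where q: "q \<in> ring_gen X" "q \<noteq> 0" "smult q p \<in> polys_over (ring_gen X)"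
    using poly_common_denominator[OF K fr pw(1)] by blast
  obtain u where u: "u \<in> ring_gen X" "u \<noteq> 0" "smult u w \<in> polys_over (ring_gen X)"
    using poly_common_denominator[OF K fr pw(2)] by blast
  let ?R = "ring_gen (insert c X)"
  note R = csubring_ring_gen[of "insert c X"]
  have sub: "ring_gen X \<subseteq> ?R" by (intro ring_gen_mono) auto
  have c: "c \<in> ?R" by (intro ring_gen.gen) auto
  have "poly (smult q p) c \<in> ?R" "poly (smult u w) c \<in> ?R"
    using q u polys_over_mono[OF sub] by (auto intro!: polys_over_eval[OF R] c simp del: poly_smult)
  then have "q * poly (smult u w) c \<in> ?R" "u * poly (smult q p) c \<in> ?R"
    using q u sub by (auto intro!: csubring_mult[OF R] simp del: poly_smult)
  moreover have "q * poly (smult u w) c * z = u * poly (smult q p) c"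
    using pw by simp
  moreover have "q * poly (smult u w) c \<noteq> 0" using q u pw by simp
  ultimately show "\<exists>q\<in>?R. q \<noteq> 0 \<and> q * z \<in> ?R" by metis
qed

text \<open>The hypothesis says that \<open>c\<close> and \<open>c'\<close> satisfy corresponding
  equations, which makes the image of a fraction independent of its representation. It holds when
  \<open>c'\<close> is a root of the transported minimal polynomial, and when \<open>c\<close> and
  \<open>c'\<close> are both transcendental.\<close>

lemma embedding_extension:
  assumes K: "csubfield K" and s: "embedding K s"
    and iff: "\<And>p. p \<in> polys_over K \<Longrightarrow> poly p c = 0 \<longleftrightarrow> poly (map_poly s p) c' = 0"
  obtains s' where "embedding (field_adjoin K c) s'" "\<And>x. x \<in> K \<Longrightarrow> s' x = s x"
    "\<And>p w. p \<in> polys_over K \<Longrightarrow> w \<in> polys_over K \<Longrightarrow> poly w c \<noteq> 0 \<Longrightarrow>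
      s' (poly p c / poly w c) = poly (map_poly s p) c' / poly (map_poly s w) c'"
    "s' c = c'"
proof -
  note R = csubfield_imp_csubring[OF K]
  define P where "P = (\<lambda>z (p, w). p \<in> polys_over K \<and> w \<in> polys_over K \<and> poly w c \<noteq> 0 \<and> z = poly p c / poly w c)"
  define s' where "s' = (\<lambda>z. let (p, w) = (SOME x. P z x) in poly (map_poly s p) c' / poly (map_poly s w) c')"
  have val: "s' (poly p c / poly w c) = poly (map_poly s p) c' / poly (map_poly s w) c'"
    if pw: "p \<in> polys_over K" "w \<in> polys_over K" "poly w c \<noteq> 0" for p w
  proof -
    obtain p' w' where pw': "(SOME x. P (poly p c / poly w c) x) = (p', w')" by fastforce
    have "P (poly p c / poly w c) (p, w)" using pw by (simp add: P_def)
    then have "P (poly p c / poly w c) (p', w')" unfolding pw'[symmetric] by (rule someI)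
    then have p'w': "p' \<in> polys_over K" "w' \<in> polys_over K" "poly w' c \<noteq> 0"
      "poly p c / poly w c = poly p' c / poly w' c" unfolding P_def prod.case by blast+
    have "poly p c * poly w' c = poly p' c * poly w c"
      using frac_eq_eq[OF pw(3) p'w'(3), of "poly p c" "poly p' c"] p'w'(4) by blast
    then have "poly (p * w' - p' * w) c = 0" by simp
    moreover have "p * w' - p' * w \<in> polys_over K"
      by (intro polys_over_diff[OF R] polys_over_mult[OF R] pw p'w')
    ultimately have "poly (map_poly s (p * w' - p' * w)) c' = 0"
      using iff[of "p * w' - p' * w"] by blast
    then have "poly (map_poly s p) c' * poly (map_poly s w') c' = poly (map_poly s p') c' * poly (map_poly s w) c'"
      using pw(1,2) p'w'(1,2)
      by (simp add: map_embedding_diff[OF K s] map_embedding_mult[OF K s] polys_over_mult[OF R])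
    moreover have "poly (map_poly s w) c' \<noteq> 0" "poly (map_poly s w') c' \<noteq> 0"
      using iff[OF pw(2)] iff[OF p'w'(2)] pw(3) p'w'(3) by auto
    ultimately show ?thesis by (simp add: s'_def pw' frac_eq_eq)
  qed
  have ext: "s' x = s x" if "x \<in> K" for x
    using val[of "[:x:]" 1] that polys_over_const[OF R] polys_over_1[OF R]
    by (simp add: map_embedding_const[OF K s] embedding_1[OF K s])
  have c: "s' c = c'"
    using val[of "[:0,1:]" 1] polys_over_pCons[OF R] polys_over_const[OF R] polys_over_1[OF R]
      csubring_0[OF R] csubring_1[OF R]
    by (simp add: map_poly_pCons embedding_0[OF K s] embedding_1[OF K s])
  have "embedding (field_adjoin K c) s'"
    unfolding embedding_def
  proof (intro conjI ballI)
    show "s' 1 = 1" using ext csubring_1[OF R] embedding_1[OF K s] by simp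
    fix x y assume x: "x \<in> field_adjoin K c" and y: "y \<in> field_adjoin K c"
    obtain p w where pw: "p \<in> polys_over K" "w \<in> polys_over K" "poly w c \<noteq> 0" "x = poly p c / poly w c"
      using x by (rule field_adjoinE)
    obtain p' w' where pw': "p' \<in> polys_over K" "w' \<in> polys_over K" "poly w' c \<noteq> 0" "y = poly p' c / poly w' c"
      using y by (rule field_adjoinE)
    have nz: "poly (map_poly s w) c' \<noteq> 0" "poly (map_poly s w') c' \<noteq> 0"
      using iff[OF pw(2)] iff[OF pw'(2)] pw(3) pw'(3) by auto
    note m = map_embedding_add[OF K s] map_embedding_mult[OF K s] polys_over_mult[OF R] polys_over_add[OF R]
    have "x + y = poly (p * w' + p' * w) c / poly (w * w') c" using pw pw' by (simp add: add_frac_eq)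
    then have "s' (x + y) = poly (map_poly s (p * w' + p' * w)) c' / poly (map_poly s (w * w')) c'"
      using val[of "p * w' + p' * w" "w * w'"] pw(1-3) pw'(1-3) m by simp
    also have "\<dots> = s' x + s' y"
      unfolding pw(4) pw'(4) val[OF pw(1-3)] val[OF pw'(1-3)]
      using pw(1-3) pw'(1-3) nz m by (simp add: add_frac_eq)
    finally show "s' (x + y) = s' x + s' y" .
    have "x * y = poly (p * p') c / poly (w * w') c" using pw pw' by simp
    then have "s' (x * y) = poly (map_poly s (p * p')) c' / poly (map_poly s (w * w')) c'"
      using val[of "p * p'" "w * w'"] pw(1-3) pw'(1-3) m by simp
    also have "\<dots> = s' x * s' y"
      unfolding pw(4) pw'(4) val[OF pw(1-3)] val[OF pw'(1-3)]
      using pw(1-3) pw'(1-3) m by simp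
    finally show "s' (x * y) = s' x * s' y" .
  qed
  then show thesis using that ext val c by blast
qed

section \<open>A Liouville inequality for finitely generated fields\<close>

text \<open>The essential point is that \<open>r\<close> does not depend on \<open>M\<close> or \<open>D\<close>. Since \<open>K\<close> may contain transcendental numbers,
  a single embedding cannot give a lower bound for \<open>D\<close>; some embedding close to the identity does.\<close>

definition good_pair :: "complex set \<Rightarrow> complex set \<Rightarrow> bool" where
  "good_pair K X \<longleftrightarrow> csubfield K \<and> countable K \<and> finite X \<and> X \<subseteq> K \<and> fractions_of K X \<and>
    (\<forall>e>0. \<forall>B\<ge>1. \<exists>r>0. \<forall>M>0. \<forall>D\<in>K \<inter> integral_over X. D \<noteq> 0 \<longrightarrow>
      (\<forall>s. embedding K s \<longrightarrow> norm (s D) \<le> (B * emb_size s X) ^ M) \<longrightarrow>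
      (\<exists>s. embedding K s \<and> (\<forall>x\<in>X. dist (s x) x < e) \<and> norm (s D) \<ge> r ^ M))"

lemma good_pairD:
  assumes "good_pair K X"
  shows "csubfield K" "countable K" "finite X" "X \<subseteq> K" "fractions_of K X"
  using assms by (auto simp: good_pair_def)

lemma good_pair_bound:
  assumes "good_pair K X" "e > 0" "B \<ge> 1"
  obtains r where "r > 0" "\<And>M D. M > 0 \<Longrightarrow> D \<in> K \<Longrightarrow> D \<in> integral_over X \<Longrightarrow> D \<noteq> 0 \<Longrightarrow>
    (\<And>s. embedding K s \<Longrightarrow> norm (s D) \<le> (B * emb_size s X) ^ M) \<Longrightarrow>
    (\<exists>s. embedding K s \<and> (\<forall>x\<in>X. dist (s x) x < e) \<and> norm (s D) \<ge> r ^ M)"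
proof -
  obtain r where r: "r > 0" "\<forall>M>0. \<forall>D\<in>K \<inter> integral_over X. D \<noteq> 0 \<longrightarrow>
      (\<forall>s. embedding K s \<longrightarrow> norm (s D) \<le> (B * emb_size s X) ^ M) \<longrightarrow>
      (\<exists>s. embedding K s \<and> (\<forall>x\<in>X. dist (s x) x < e) \<and> norm (s D) \<ge> r ^ M)"
    using assms unfolding good_pair_def by blast
  show thesis
    by (rule that[OF r(1)]) (use r(2) in blast)
qed

lemma embedding_id: "embedding K (\<lambda>x. x)"
  by (simp add: embedding_def)

text \<open>A nonzero integer has absolute value at least 1, so \<open>r = 1\<close> and the
  identity embedding suffice.\<close>

lemma good_pair_rationals: "good_pair \<rat> {}"
  unfolding good_pair_def
proof (intro conjI allI impI)
  show "csubfield \<rat>" by (auto simp: csubfield_def csubring_def)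
  show "countable (\<rat> :: complex set)" by (auto simp: Rats_def intro: countable_image)
  show "fractions_of \<rat> {}"
    unfolding fractions_of_def
  proof
    fix z :: complex assume "z \<in> \<rat>"
    then obtain a b :: int where ab: "b \<noteq> 0" "z = of_int a / of_int b"
      by (metis Rats_cases' of_int_0_less_iff less_numeral_extra(3))
    have "of_int b \<in> ring_gen {}" "of_int b * z \<in> ring_gen {}" "of_int b \<noteq> (0 :: complex)"
      using ab csubring_of_int[OF csubring_ring_gen] by auto
    then show "\<exists>q\<in>ring_gen {}. q \<noteq> 0 \<and> q * z \<in> ring_gen {}" by blast
  qed
  fix e B :: real assume "e > 0" "B \<ge> 1"
  show "\<exists>r>0. \<forall>M>0. \<forall>D\<in>\<rat> \<inter> integral_over {}. D \<noteq> 0 \<longrightarrow>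
      (\<forall>s. embedding \<rat> s \<longrightarrow> norm (s D) \<le> (B * emb_size s {}) ^ M) \<longrightarrow>
      (\<exists>s. embedding \<rat> s \<and> (\<forall>x\<in>{}. dist (s x) x < e) \<and> norm (s D) \<ge> r ^ M)"
  proof (intro exI[of _ 1] conjI allI impI ballI exI[of _ "\<lambda>x. x"] embedding_id)
    fix M :: nat and D :: complex
    assume D: "D \<in> \<rat> \<inter> integral_over {}" "D \<noteq> 0"
    then have "D \<in> \<int>" using rational_integral by blast
    then show "1 ^ M \<le> norm D" using D by (auto elim!: Ints_cases)
  qed auto
qed auto

section \<open>Adjoining a transcendental number\<close>

text \<open>After moving the circle to the unit circle, the reflected polynomial takes the value
  \<open>lead_coeff p * r ^ degree p\<close> at 0, and the maximum modulus principle applies to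
  it.\<close>

lemma poly_max_circle:
  fixes p :: "complex poly"
  assumes r: "r > 0"
  obtains z where "dist c z = r" "norm (poly p z) \<ge> norm (lead_coeff p) * r ^ degree p"
proof -
  define p1 where "p1 = pcompose p [:c, of_real r:]"
  define q where "q = reflect_poly p1"
  have lc: "lead_coeff p1 = lead_coeff p * of_real r ^ degree p"
    using r by (simp add: p1_def lead_coeff_comp)
  have "\<exists>w\<in>sphere 0 1. \<forall>v\<in>sphere 0 1. norm (poly q v) \<le> norm (poly q w)"
  proof (rule continuous_attains_sup)
    have "(1 :: complex) \<in> sphere 0 1" by simp
    then show "sphere (0 :: complex) 1 \<noteq> {}" by blast
  qed (auto intro!: continuous_intros)
  then obtain w where w: "w \<in> sphere 0 1" "\<forall>v\<in>sphere 0 1. norm (poly q v) \<le> norm (poly q w)"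
    by blast
  have "norm (poly q 0) \<le> norm (poly q w)"
  proof (rule maximum_modulus_frontier[of "poly q" "ball 0 1"])
    show "poly q holomorphic_on interior (ball 0 1)" by (intro holomorphic_intros)
    show "continuous_on (closure (ball 0 1)) (poly q)" by (intro continuous_intros)
    show "norm (poly q z) \<le> norm (poly q w)" if "z \<in> frontier (ball 0 1)" for z
      using w(2) that by simp
  qed auto
  moreover have q0: "norm (poly q 0) = norm (lead_coeff p) * r ^ degree p"
  proof -
    have "poly q 0 = lead_coeff p1" by (simp add: q_def poly_0_coeff_0)
    then show ?thesis using r by (simp add: lc norm_mult norm_power)
  qed
  ultimately have *: "norm (lead_coeff p) * r ^ degree p \<le> norm (poly q w)" by (simp only:)
  have nw: "norm w = 1" using w(1) by simp
  then have "w \<noteq> 0" by auto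
  then have "poly q w = w ^ degree p1 * poly p1 (inverse w)"
    unfolding q_def by (rule poly_reflect_poly_nz)
  then have "norm (poly q w) = norm (poly p1 (inverse w))"
    using nw by (simp add: norm_mult norm_power)
  also have "poly p1 (inverse w) = poly p (c + of_real r * inverse w)"
    unfolding p1_def poly_pcompose by (simp add: mult.commute)
  finally have "norm (lead_coeff p) * r ^ degree p \<le> norm (poly p (c + of_real r * inverse w))"
    using * by (simp only:)
  moreover have "dist c (c + of_real r * inverse w) = r"
    using nw r by (simp add: dist_norm norm_mult norm_inverse)
  ultimately show thesis by (rule that[rotated])
qed

lemma poly_growth_degree_le:
  fixes p :: "complex poly"
  assumes p: "p \<noteq> 0" and B: "B \<ge> 0" "S \<ge> 0" and bound: "\<And>z. norm (poly p z) \<le> (B * (S + norm z)) ^ M"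
  shows "degree p \<le> M"
proof (rule ccontr)
  assume "\<not> degree p \<le> M"
  then have lt: "M < degree p" by simp
  define c where "c = norm (lead_coeff p)"
  have c: "c > 0" using p by (simp add: c_def)
  \<comment> \<open>\<open>r \<ge> S\<close> gives \<open>S + r \<le> 2 * r\<close>, and the last
    entry makes \<open>c * r\<close> exceed \<open>(2 * B) ^ M\<close>.\<close>
  define r where "r = max (max 1 S) ((2 * B) ^ M / c + 1)"
  have r: "r \<ge> 1" "r \<ge> S" "r > (2 * B) ^ M / c" by (auto simp: r_def)
  obtain z where z: "dist 0 z = r" "norm (poly p z) \<ge> c * r ^ degree p"
    using poly_max_circle[of r 0 p] r by (auto simp: c_def)
  have "c * (r * r ^ M) \<le> c * r ^ degree p"
    using lt r c power_increasing[of "Suc M" "degree p" r] by simp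
  also have "\<dots> \<le> (B * (S + r)) ^ M" using bound[of z] z by simp
  also have "\<dots> \<le> (2 * B * r) ^ M"
  proof (rule power_mono)
    show "B * (S + r) \<le> 2 * B * r" using mult_left_mono[of "S + r" "2 * r" B] B r by simp
  qed (use B r in auto)
  also have "\<dots> = (2 * B) ^ M * r ^ M" by (simp add: power_mult_distrib)
  finally have "c * r \<le> (2 * B) ^ M" using r by (simp add: mult_ac)
  then show False using r c by (simp add: field_simps)
qed

lemma countable_complement_dense:
  fixes C :: "complex set"
  assumes "countable C" "e > 0"
  obtains z where "dist z c < e" "z \<notin> C"
proof -
  have "uncountable (ball c e)" using assms by (simp add: uncountable_ball)
  then have "\<not> ball c e \<subseteq> C" using assms countable_subset by blast
  then obtain z where "z \<in> ball c e" "z \<notin> C" by blast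
  then show thesis using that[of z] by (simp add: dist_commute)
qed

text \<open>Bounds obtained through embeddings hold only at possible images of a transcendental
  number; density of the complement of a countable set removes the exceptions.\<close>

lemma le_if_countable_complement:
  fixes g h :: "complex \<Rightarrow> real"
  assumes "countable C" and g: "continuous_on UNIV g" "continuous_on UNIV h"
    and le: "\<And>z. z \<notin> C \<Longrightarrow> g z \<le> h z"
  shows "g z \<le> h z"
proof (rule ccontr)
  assume "\<not> g z \<le> h z"
  then have z: "z \<in> {z. h z < g z}" by simp
  have "open {z. h z < g z}" by (rule open_Collect_less[OF g(2,1)])
  then obtain e where e: "e > 0" "ball z e \<subseteq> {z. h z < g z}"
    using z by (meson openE)
  obtain w where "dist w z < e" "w \<notin> C" using countable_complement_dense[OF assms(1) e(1)] by blast
  then show False using e(2) le[of w] by (auto simp: dist_commute subset_iff)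
qed

text \<open>The numbers algebraic over the image of \<open>K\<close>: exactly the values that an
  extension of \<open>s\<close> cannot give to a transcendental element.\<close>

definition alg_points :: "complex set \<Rightarrow> (complex \<Rightarrow> complex) \<Rightarrow> complex set" where
  "alg_points K s = (\<Union>p\<in>polys_over K - {0}. {x. poly (map_poly s p) x = 0})"

lemma countable_alg_points:
  assumes K: "csubfield K" "countable K" and s: "embedding K s"
  shows "countable (alg_points K s)"
  unfolding alg_points_def
proof (intro countable_UN countable_Diff countable_polys_over K)
  fix p assume "p \<in> polys_over K - {0}"
  then have "map_poly s p \<noteq> 0" using map_embedding_eq_0_iff[OF K(1) s] by auto
  then show "countable {x. poly (map_poly s p) x = 0}"
    using poly_roots_finite countable_finite by blast
qed

lemma embedding_extension_transcendental:
  assumes K: "csubfield K" and s: "embedding K s"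
    and t: "\<And>p. p \<in> polys_over K \<Longrightarrow> poly p t = 0 \<Longrightarrow> p = 0" and t': "t' \<notin> alg_points K s"
  obtains s' where "embedding (field_adjoin K t) s'" "\<And>x. x \<in> K \<Longrightarrow> s' x = s x" "s' t = t'"
    "\<And>p. p \<in> polys_over K \<Longrightarrow> s' (poly p t) = poly (map_poly s p) t'"
proof -
  have "poly p t = 0 \<longleftrightarrow> poly (map_poly s p) t' = 0" if "p \<in> polys_over K" for p
    using t[OF that] t' that by (auto simp: alg_points_def)
  then obtain s' where s': "embedding (field_adjoin K t) s'" "\<And>x. x \<in> K \<Longrightarrow> s' x = s x"
    "\<And>p w. p \<in> polys_over K \<Longrightarrow> w \<in> polys_over K \<Longrightarrow> poly w t \<noteq> 0 \<Longrightarrow>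
      s' (poly p t / poly w t) = poly (map_poly s p) t' / poly (map_poly s w) t'" "s' t = t'"
    using embedding_extension[OF K s, of t t'] by blast
  have "s' (poly p t) = poly (map_poly s p) t'" if "p \<in> polys_over K" for p
    using s'(3)[OF that polys_over_1[OF csubfield_imp_csubring[OF K]]] embedding_1[OF K s] by simp
  then show thesis using that s' by blast
qed

lemma ring_gen_insert: "ring_gen (insert c X) \<subseteq> adjoin_ring (ring_gen X) c"
  using adjoin_ring_supset[OF csubring_ring_gen[of X], of c] adjoin_ring_elem[OF csubring_ring_gen[of X], of c]
  by (intro ring_gen_minimal csubring_adjoin_ring csubring_ring_gen) (auto intro: ring_gen.gen)

text \<open>To see that the leading coefficient of \<open>P\<close> is integral, a large power \<open>t\<^sup>k\<close> is added: \<open>P + t\<^sup>k\<close> is monic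
  and divides a monic polynomial with coefficients generated by \<open>X\<close>.\<close>

lemma field_adjoin_transcendental_integral:
  assumes K: "csubfield K" and X: "X \<subseteq> K"
    and t: "\<And>p. p \<in> polys_over K \<Longrightarrow> poly p t = 0 \<Longrightarrow> p = 0"
    and D: "D \<in> field_adjoin K t" "D \<in> integral_over (insert t X)"
  obtains P where "P \<in> polys_over K" "D = poly P t" "lead_coeff P \<in> integral_over X"
proof -
  note R = csubfield_imp_csubring[OF K]
  obtain g where g: "g \<in> polys_over (ring_gen (insert t X))" "lead_coeff g = 1" "poly g D = 0"
    using integral_over_imp_monic_equation[OF D(2)] by blast
  define n where "n = degree g"
  have "\<forall>i. \<exists>r. r \<in> polys_over (ring_gen X) \<and> coeff g i = poly r t"
    using polys_over_coeff[OF g(1)] ring_gen_insert[of t X] by (auto simp: adjoin_ring_def)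
  then obtain r where r: "\<And>i. r i \<in> polys_over (ring_gen X)" "\<And>i. coeff g i = poly (r i) t" by metis
  have rK: "r i \<in> polys_over K" for i
    using r(1) polys_over_mono[OF ring_gen_subset[OF K X]] by blast
  have "{..n} = insert n {..<n}" by auto
  then have gD: "D ^ n + (\<Sum>i<n. poly (r i) t * D ^ i) = 0"
    using g(2,3) by (simp add: poly_altdef n_def r(2))
  have n0: "n \<noteq> 0"
    using gD by (cases n) auto
  \<comment> \<open>Fractions representing \<open>D\<close>. For a denominator of least degree, a
    root of it would lead to a common factor over \<open>K\<close> and so to a smaller
    denominator.\<close>
  define A where "A = (\<lambda>(U, W). U \<in> polys_over K \<and> W \<in> polys_over K \<and> poly W t \<noteq> 0 \<and> D = poly U t / poly W t)"
  have "\<exists>x. A x" using D(1) by (elim field_adjoinE) (auto simp: A_def)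
  then obtain UW where UW: "A UW" "\<And>y. A y \<Longrightarrow> degree (snd UW) \<le> degree (snd y)"
    using ex_has_least_nat[of A _ "\<lambda>x. degree (snd x)"] by blast
  obtain U W where UW': "UW = (U, W)" by fastforce
  have U: "U \<in> polys_over K" and W: "W \<in> polys_over K" "poly W t \<noteq> 0" and DUW: "D = poly U t / poly W t"
    using UW(1) unfolding UW' A_def prod.case by blast+
  have min: "degree W \<le> degree W'" if "A (U', W')" for U' W'
    using UW(2)[OF that] by (simp add: UW')
  have W0: "W \<noteq> 0" using W by auto
  have "degree W = 0"
  proof (rule ccontr)
    assume "degree W \<noteq> 0"
    then obtain y where y: "poly W y = 0"
      using fundamental_theorem_of_algebra[of W] by (auto simp: constant_degree)
    \<comment> \<open>The monic equation of \<open>D\<close> multiplied by \<open>W ^ n\<close>. It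
      vanishes at the transcendental \<open>t\<close>, hence identically, and at a root of
      \<open>W\<close> only \<open>U ^ n\<close> survives.\<close>
    let ?E = "U ^ n + (\<Sum>i<n. r i * U ^ i * W ^ (n - i))"
    have "poly ?E t = poly W t ^ n * (D ^ n + (\<Sum>i<n. poly (r i) t * D ^ i))"
    proof -
      have eq: "poly W t ^ n * (poly (r i) t * D ^ i) = poly (r i) t * poly U t ^ i * poly W t ^ (n - i)"
        if "i < n" for i
      proof -
        have "poly W t ^ n = poly W t ^ (n - i) * poly W t ^ i" using that by (simp flip: power_add)
        then show ?thesis using W by (simp add: DUW power_divide)
      qed
      have "poly W t ^ n * D ^ n = poly U t ^ n" using W by (simp add: DUW power_divide)
      moreover have "(\<Sum>i<n. poly W t ^ n * (poly (r i) t * D ^ i)) =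
          (\<Sum>i<n. poly (r i) t * poly U t ^ i * poly W t ^ (n - i))"
        by (intro sum.cong refl eq) simp
      ultimately show ?thesis
        by (simp add: poly_sum distrib_left sum_distrib_left del: mult_eq_0_iff)
    qed
    then have "poly ?E t = 0" using gD by simp
    moreover have "?E \<in> polys_over K"
      by (intro polys_over_add[OF R] polys_over_sum[OF R] polys_over_mult[OF R] polys_over_power[OF R] U W rK)
    ultimately have "?E = 0" using t by blast
    then have "poly ?E y = 0" by simp
    moreover have "poly (\<Sum>i<n. r i * U ^ i * W ^ (n - i)) y = 0"
      using y by (auto simp: poly_sum intro!: sum.neutral)
    ultimately have Uy: "poly U y = 0" using n0 by simp
    obtain h where h: "minimal_poly_of K {y} h"
      using minimal_poly_exists[OF K W(1) W0, of "{y}"] y by auto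
    obtain U' where U': "U' \<in> polys_over K" "U = h * U'"
      using minimal_poly_of_dvdE[OF K h U] Uy by auto
    obtain W' where W': "W' \<in> polys_over K" "W = h * W'"
      using minimal_poly_of_dvdE[OF K h W(1)] y by auto
    have "poly h t \<noteq> 0" "poly W' t \<noteq> 0" using W(2) unfolding W'(2) by auto
    then have "A (U', W')"
      unfolding A_def prod.case DUW U'(2) W'(2) using U'(1) W'(1) by simp
    then have "degree W \<le> degree W'" by (rule min)
    moreover have "degree W = degree h + degree W'"
      using W0 W' by (metis degree_mult_eq mult_eq_0_iff)
    moreover have "degree h > 0" by (rule degree_minimal_poly_singleton[OF h])
    ultimately show False by simp
  qed
  then obtain w where w: "W = [:w:]" by (auto elim: degree_eq_zeroE)
  define P where "P = smult (inverse w) U"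
  have wK: "w \<in> K" using polys_over_coeff[OF W(1), of 0] by (simp add: w)
  have P: "P \<in> polys_over K" unfolding P_def
    by (intro polys_over_smult[OF R] U csubfield_inverse[OF K] wK)
  have DP: "D = poly P t" by (simp add: P_def DUW w field_simps)
  have "P ^ n + (\<Sum>i<n. r i * P ^ i) \<in> polys_over K"
    by (intro polys_over_add[OF R] polys_over_sum[OF R] polys_over_mult[OF R] polys_over_power[OF R] P rK)
  moreover have "poly (P ^ n + (\<Sum>i<n. r i * P ^ i)) t = 0" using gD by (simp add: poly_sum DP)
  ultimately have E0: "P ^ n + (\<Sum>i<n. r i * P ^ i) = 0" using t by blast
  \<comment> \<open>\<open>k\<close> exceeds the degrees of \<open>P\<close> and of all
    \<open>r i\<close>. As \<open>T\<close> is minus the large power, \<open>P - T\<close> is the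
    monic polynomial to be studied; it divides the value \<open>Z\<close> at \<open>T\<close> of the
    equation that \<open>P\<close> satisfies, and by the size of \<open>k\<close> the term
    \<open>T ^ n\<close> dominates in \<open>Z\<close>.\<close>
  define k where "k = Suc (degree P + (\<Sum>i<n. degree (r i)))"
  define T where "T = (- monom 1 k :: complex poly)"
  define w where "w = P - T"
  define Z where "Z = T ^ n + (\<Sum>i<n. r i * T ^ i)"
  have dvdp: "w dvd P ^ i - T ^ i" for i
    unfolding w_def by (simp add: power_diff_sumr2)
  have "Z = - ((P ^ n - T ^ n) + (\<Sum>i<n. r i * (P ^ i - T ^ i)))"
    using E0 by (simp add: Z_def algebra_simps sum_subtractf)
  also have "w dvd \<dots>"
    unfolding dvd_minus_iff by (intro dvd_add dvdp dvd_sum dvd_mult)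
  finally have wZ: "w dvd Z" .
  have Tn: "T ^ i = monom ((-1) ^ i) (k * i)" for i
    by (simp add: T_def power_minus[of "monom 1 k"] monom_power mult.commute minus_monom smult_monom flip: monom_0)
  have low: "coeff (\<Sum>i<n. r i * T ^ i) j = 0" if "j \<ge> k * n" for j
  proof -
    have "degree (r i * T ^ i) < j" if i: "i < n" for i
    proof -
      have "degree (r i) \<le> (\<Sum>i<n. degree (r i))" using i by (intro member_le_sum) auto
      then have "degree (r i) < k" by (simp add: k_def)
      moreover have "degree (r i * T ^ i) \<le> degree (r i) + k * i"
        using degree_mult_le[of "r i" "T ^ i"] degree_monom_le[of "(-1) ^ i :: complex" "k * i"]
        by (simp add: Tn)
      moreover have "k * i + k \<le> k * n" using i by (metis mult_le_mono2 mult_Suc_right Suc_leI add.commute)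
      ultimately show ?thesis using that[OF] \<open>j \<ge> k * n\<close> by linarith
    qed
    then show ?thesis by (auto simp: coeff_sum coeff_eq_0 intro!: sum.neutral)
  qed
  define Z' where "Z' = smult ((-1) ^ n) Z"
  have cZ: "coeff Z' j = (if j = k * n then 1 else 0)" if "j \<ge> k * n" for j
    using low[OF that] by (auto simp: Z'_def Z_def Tn simp flip: power_mult_distrib)
  have "degree Z' = k * n"
    using cZ by (intro antisym degree_le le_degree) auto
  then have lcZ: "lead_coeff Z' = 1" using cZ[of "k * n"] by simp
  note G = csubring_ring_gen[of X]
  have TR: "T \<in> polys_over (ring_gen X)" unfolding T_def
    by (intro polys_over_uminus[OF G] polys_over_monom[OF G] csubring_1[OF G])
  have "Z' \<in> polys_over (ring_gen X)"
    unfolding Z'_def Z_def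
    by (intro polys_over_smult[OF G] csubring_power[OF G] csubring_uminus[OF G] csubring_1[OF G]
        polys_over_add[OF G] polys_over_sum[OF G] polys_over_mult[OF G] polys_over_power[OF G] r TR)
  then have ZI: "Z' \<in> polys_over (integral_over X)"
    using polys_over_mono[OF ring_gen_subset_integral_over] by blast
  have wk: "w = monom 1 k + P" by (simp add: w_def T_def)
  have kP: "degree P < k" by (simp add: k_def)
  have "degree w = k" unfolding wk using kP by (subst degree_add_eq_left) (auto simp: degree_monom_eq)
  then have lcw: "lead_coeff w = 1" using kP by (simp add: wk coeff_eq_0)
  have "w dvd Z'" using wZ by (simp add: Z'_def dvd_smult)
  then have "w \<in> polys_over (integral_over X)"
    by (intro integral_over_root_coeffs[OF ZI lcZ] lcw)
  then have "coeff w (degree P) \<in> integral_over X" by (rule polys_over_coeff)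
  moreover have "coeff w (degree P) = lead_coeff P" using kP by (simp add: wk)
  ultimately show thesis using that P DP by simp
qed

text \<open>An integral \<open>D\<close> is a polynomial in \<open>t\<close>. The hypothesis is applied to its leading coefficient, and the
  maximum of a polynomial on a circle around \<open>t\<close> is bounded below by the leading coefficient. The image of \<open>t\<close>
  under an embedding can be any number outside a countable set.\<close>

lemma good_pair_transcendental:
  assumes good: "good_pair K X" and t: "\<And>p. p \<in> polys_over K \<Longrightarrow> poly p t = 0 \<Longrightarrow> p = 0"
  shows "good_pair (field_adjoin K t) (insert t X)"
  unfolding good_pair_def
proof (intro conjI allI impI)
  note K = good_pairD(1)[OF good] and cK = good_pairD(2)[OF good] and fX = good_pairD(3)[OF good]
    and XK = good_pairD(4)[OF good] and fr = good_pairD(5)[OF good]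
  show "csubfield (field_adjoin K t)" by (rule csubfield_field_adjoin[OF K])
  show "countable (field_adjoin K t)" by (rule countable_field_adjoin[OF cK])
  show "finite (insert t X)" using fX by simp
  show "insert t X \<subseteq> field_adjoin K t"
    using XK field_adjoin_supset[OF K] field_adjoin_elem[OF K] by blast
  show "fractions_of (field_adjoin K t) (insert t X)" by (rule fractions_of_field_adjoin[OF K fr])
  fix e B :: real assume e: "e > 0" and B: "B \<ge> 1"
  have "2 * B \<ge> 1" using B by simp
  from good_pair_bound[OF good e this] obtain r where r: "r > 0"
    and IH: "\<And>M D. M > 0 \<Longrightarrow> D \<in> K \<Longrightarrow> D \<in> integral_over X \<Longrightarrow> D \<noteq> 0 \<Longrightarrow>
      (\<And>s. embedding K s \<Longrightarrow> norm (s D) \<le> (2 * B * emb_size s X) ^ M) \<Longrightarrow>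
      (\<exists>s. embedding K s \<and> (\<forall>x\<in>X. dist (s x) x < e) \<and> norm (s D) \<ge> r ^ M)" by blast
  \<comment> \<open>A degree at most \<open>M\<close> contributes \<open>(e / 2) ^ degree P\<close>
    on the circle of radius \<open>e / 2\<close>; this is at least \<open>m ^ M\<close> whether or
    not \<open>e / 2\<close> is below 1.\<close>
  define m where "m = min 1 (e / 2)"
  have m: "m > 0" "m \<le> 1" "m \<le> e / 2" using e by (auto simp: m_def)
  show "\<exists>r>0. \<forall>M>0. \<forall>D\<in>field_adjoin K t \<inter> integral_over (insert t X). D \<noteq> 0 \<longrightarrow>
      (\<forall>s. embedding (field_adjoin K t) s \<longrightarrow> norm (s D) \<le> (B * emb_size s (insert t X)) ^ M) \<longrightarrow>
      (\<exists>s. embedding (field_adjoin K t) s \<and> (\<forall>x\<in>insert t X. dist (s x) x < e) \<and> norm (s D) \<ge> r ^ M)"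
  \<comment> \<open>The factor 1/2 makes the inequality strict at one point of the circle, hence
    true in a neighbourhood, where an admissible image of \<open>t\<close> exists.\<close>
  proof (intro exI[of _ "r * m / 2"] conjI allI impI ballI)
    show "r * m / 2 > 0" using r m by simp
    fix M :: nat and D
    assume M: "M > 0" and D: "D \<in> field_adjoin K t \<inter> integral_over (insert t X)" "D \<noteq> 0"
      and bound: "\<forall>s. embedding (field_adjoin K t) s \<longrightarrow> norm (s D) \<le> (B * emb_size s (insert t X)) ^ M"
    obtain P where P: "P \<in> polys_over K" "D = poly P t" "lead_coeff P \<in> integral_over X"
      using field_adjoin_transcendental_integral[OF K XK t] D(1) by blast
    have P0: "P \<noteq> 0" using D P by auto
    \<comment> \<open>Almost every \<open>z\<close> is the image of \<open>t\<close> under an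
      extension of \<open>s\<close>, so the bound assumed for all images of \<open>D\<close> becomes
      a growth bound for the polynomial.\<close>
    have Pb: "norm (poly (map_poly s P) z) \<le> (B * (emb_size s X + norm z)) ^ M" if s: "embedding K s" for s z
    proof (rule le_if_countable_complement[OF countable_alg_points[OF K cK s]])
      fix z assume z: "z \<notin> alg_points K s"
      from embedding_extension_transcendental[OF K s t z] obtain s' where
        s': "embedding (field_adjoin K t) s'" "\<And>x. x \<in> K \<Longrightarrow> s' x = s x" "s' t = z"
          "\<And>p. p \<in> polys_over K \<Longrightarrow> s' (poly p t) = poly (map_poly s p) z" by blast
      have "norm (poly (map_poly s P) z) \<le> (B * emb_size s' (insert t X)) ^ M"
        using bound s'(1) s'(4)[OF P(1)] by (auto simp: P(2))
      also have "\<dots> \<le> (B * (emb_size s X + norm z)) ^ M"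
      proof (intro power_mono mult_left_mono)
        show "emb_size s' (insert t X) \<le> emb_size s X + norm z"
          using emb_size_insert_le[OF fX, of s' s t] s' XK by auto
      qed (use B emb_size_ge_1[of s' "insert t X"] in auto)
      finally show "norm (poly (map_poly s P) z) \<le> (B * (emb_size s X + norm z)) ^ M" .
    qed (intro continuous_intros)+
    have deg: "degree P \<le> M"
    proof (rule poly_growth_degree_le[OF P0])
      show "norm (poly P z) \<le> (B * (emb_size (\<lambda>x. x) X + norm z)) ^ M" for z
        using Pb[OF embedding_id, of z] by simp
      show "0 \<le> emb_size (\<lambda>x. x) X" using emb_size_ge_1[of "\<lambda>x. x" X] by simp
    qed (use B in auto)
    let ?l = "lead_coeff P"
    \<comment> \<open>The unit circle bounds the leading coefficient; the constant
      \<open>2 * B\<close> comes from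
      \<open>emb_size s X + 1 \<le> 2 * emb_size s X\<close>.\<close>
    have "norm (s ?l) \<le> (2 * B * emb_size s X) ^ M" if s: "embedding K s" for s
    proof -
      obtain z where z: "dist 0 z = 1"
        "norm (poly (map_poly s P) z) \<ge> norm (lead_coeff (map_poly s P)) * 1 ^ degree (map_poly s P)"
        using poly_max_circle[of 1 0 "map_poly s P"] by auto
      then have "norm (s ?l) \<le> norm (poly (map_poly s P) z)"
        by (simp add: lead_coeff_map_embedding[OF K s P(1)])
      also have "\<dots> \<le> (B * (emb_size s X + 1)) ^ M" using Pb[OF s, of z] z by simp
      also have "\<dots> \<le> (2 * B * emb_size s X) ^ M"
      proof (rule power_mono)
        show "B * (emb_size s X + 1) \<le> 2 * B * emb_size s X"
          using mult_left_mono[of "emb_size s X + 1" "2 * emb_size s X" B] B emb_size_ge_1[of s X] by simp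
      qed (use B emb_size_ge_1[of s X] in auto)
      finally show ?thesis .
    qed
    moreover have "?l \<noteq> 0" "?l \<in> K" using P0 P(1) by (auto intro: polys_over_coeff)
    ultimately obtain s where s: "embedding K s" "\<forall>x\<in>X. dist (s x) x < e" "norm (s ?l) \<ge> r ^ M"
      using IH[OF M _ P(3)] by blast
    have e2: "e / 2 > 0" using e by simp
    obtain z where z: "dist t z = e / 2"
      "norm (poly (map_poly s P) z) \<ge> norm (lead_coeff (map_poly s P)) * (e / 2) ^ degree (map_poly s P)"
      using poly_max_circle[OF e2] by blast
    have "(r * m / 2) ^ M < (r * m) ^ M"
      using r m M by (intro power_strict_mono) auto
    also have "(r * m) ^ M = r ^ M * m ^ M" by (simp add: power_mult_distrib)
    also have "\<dots> \<le> norm (s ?l) * (e / 2) ^ degree P"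
    proof (intro mult_mono s)
      have "m ^ M \<le> m ^ degree P" using m deg by (intro power_decreasing) auto
      also have "\<dots> \<le> (e / 2) ^ degree P" using m by (intro power_mono) auto
      finally show "m ^ M \<le> (e / 2) ^ degree P" .
    qed (use m in auto)
    also have "\<dots> \<le> norm (poly (map_poly s P) z)"
      using z(2) by (simp add: lead_coeff_map_embedding[OF K s(1) P(1)] degree_map_embedding[OF K s(1) P(1)]
          coeff_map_embedding[OF K s(1)])
    finally have zP: "(r * m / 2) ^ M < norm (poly (map_poly s P) z)" .
    define Og where "Og = {w. (r * m / 2) ^ M < norm (poly (map_poly s P) w)} \<inter> ball t e"
    have "open Og" unfolding Og_def
      by (intro open_Int open_ball open_Collect_less continuous_intros)
    moreover have "z \<in> Og" using zP z(1) e by (simp add: Og_def)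
    ultimately obtain d where d: "d > 0" "ball z d \<subseteq> Og" by (meson openE)
    obtain w where w: "dist w z < d" "w \<notin> alg_points K s"
      using countable_complement_dense[OF countable_alg_points[OF K cK s(1)] d(1)] by blast
    have wO: "w \<in> Og" using w d by (auto simp: dist_commute)
    from embedding_extension_transcendental[OF K s(1) t w(2)] obtain s' where
      s': "embedding (field_adjoin K t) s'" "\<And>x. x \<in> K \<Longrightarrow> s' x = s x" "s' t = w"
        "\<And>p. p \<in> polys_over K \<Longrightarrow> s' (poly p t) = poly (map_poly s p) w" by blast
    have "norm (s' D) \<ge> (r * m / 2) ^ M"
      using wO s'(4)[OF P(1)] by (simp add: Og_def P(2))
    moreover have "\<forall>x\<in>insert t X. dist (s' x) x < e"
      using s(2) s'(2,3) XK wO by (auto simp: Og_def dist_commute)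
    ultimately show "\<exists>s. embedding (field_adjoin K t) s \<and> (\<forall>x\<in>insert t X. dist (s x) x < e) \<and>
        norm (s D) \<ge> (r * m / 2) ^ M"
      using s'(1) by blast
  qed
qed

section \<open>Adjoining an integral element\<close>

text \<open>The converse replaces Galois theory by a resultant. If \<open>p\<close> does not vanish
  at \<open>c\<close>, it shares no root with \<open>m\<close>: for the minimal polynomial
  \<open>h\<close> of a shared root, the cofactor of \<open>h\<close> in \<open>m\<close> would
  vanish at \<open>c\<close> and be a multiple of \<open>m\<close>. So the resultant is nonzero, and
  it stays nonzero under \<open>s\<close>.\<close>

lemma minimal_poly_root_iff:
  assumes K: "csubfield K" and m: "minimal_poly_of K {c} m" and s: "embedding K s"
    and p: "p \<in> polys_over K" and y: "poly (map_poly s m) y = 0"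
  shows "poly p c = 0 \<longleftrightarrow> poly (map_poly s p) y = 0"
proof
  note mK = minimal_poly_ofD(1)[OF m] and m0 = minimal_poly_ofD(3)[OF m]
  assume "poly p c = 0"
  then obtain q where "q \<in> polys_over K" "p = m * q"
    using minimal_poly_of_dvdE[OF K m p] by auto
  then show "poly (map_poly s p) y = 0" using y mK by (simp add: map_embedding_mult[OF K s])
next
  note mK = minimal_poly_ofD(1)[OF m] and m0 = minimal_poly_ofD(3)[OF m]
  assume py: "poly (map_poly s p) y = 0"
  show "poly p c = 0"
  proof (rule ccontr)
    assume pc: "poly p c \<noteq> 0"
    have ne: "poly p x \<noteq> 0" if x: "poly m x = 0" for x
    proof
      assume px: "poly p x = 0"
      obtain h where h: "minimal_poly_of K {x} h"
        using minimal_poly_exists[OF K mK m0, of "{x}"] x by auto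
      obtain e where e: "e \<in> polys_over K" "m = h * e"
        using minimal_poly_of_dvdE[OF K h mK] x by auto
      obtain q where q: "q \<in> polys_over K" "p = h * q"
        using minimal_poly_of_dvdE[OF K h p] px by auto
      have "poly h c \<noteq> 0" using q pc by auto
      then have "poly e c = 0" using minimal_poly_ofD(4)[OF m, of c] e by simp
      then have "m dvd e" using minimal_poly_ofD(5)[OF m e(1)] by auto
      moreover have e0: "e \<noteq> 0" using e m0 by auto
      ultimately have "degree m \<le> degree e" by (rule dvd_imp_degree_le)
      moreover have "degree m = degree h + degree e"
        using e e0 minimal_poly_ofD(3)[OF h] by (simp add: degree_mult_eq)
      ultimately show False using degree_minimal_poly_singleton[OF h] by simp
    qed
    then have "root_prod m p \<noteq> 0" using m0 by (auto simp: root_prod_def)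
    then have "s (root_prod m p) \<noteq> 0"
      using root_prod_embedding[OF K mK p m0] by (simp add: embedding_eq_0_iff[OF K s])
    then have "root_prod (map_poly s m) (map_poly s p) \<noteq> 0"
      using root_prod_embedding[OF K mK p m0] s by auto
    moreover have "map_poly s m \<noteq> 0" using m0 mK by (simp add: map_embedding_eq_0_iff[OF K s])
    ultimately show False using y py by (auto simp: root_prod_def)
  qed
qed

text \<open>Cauchy's bound: for larger \<open>y\<close> the leading term outweighs all the
  others.\<close>

lemma monic_root_bound:
  fixes p :: "complex poly"
  assumes p: "lead_coeff p = 1" "poly p y = 0"
  shows "norm y \<le> 1 + (\<Sum>i<degree p. norm (coeff p i))"
proof (rule ccontr)
  assume "\<not> norm y \<le> 1 + (\<Sum>i<degree p. norm (coeff p i))"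
  then have y: "norm y > 1 + (\<Sum>i<degree p. norm (coeff p i))" by simp
  have S: "(\<Sum>i<degree p. norm (coeff p i)) \<ge> 0" by (intro sum_nonneg) auto
  have "degree p \<noteq> 0"
  proof
    assume "degree p = 0"
    then obtain c where "p = [:c:]" by (auto elim: degree_eq_zeroE)
    then show False using p by simp
  qed
  then obtain n where n: "degree p = Suc n" by (cases "degree p") auto
  have "y ^ Suc n = - (\<Sum>i<Suc n. coeff p i * y ^ i)"
  proof -
    have "{..Suc n} = insert (Suc n) {..<Suc n}" by auto
    then have "poly p y = y ^ Suc n + (\<Sum>i<Suc n. coeff p i * y ^ i)"
      using p(1) by (simp add: poly_altdef n)
    then show ?thesis using p(2) by (simp add: eq_neg_iff_add_eq_0 del: sum.lessThan_Suc power_Suc)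
  qed
  then have "norm y ^ Suc n = norm (\<Sum>i<Suc n. coeff p i * y ^ i)"
    by (metis norm_minus_cancel norm_power)
  also have "\<dots> \<le> (\<Sum>i<Suc n. norm (coeff p i) * norm y ^ n)"
  proof (rule sum_norm_le)
    fix i assume "i \<in> {..<Suc n}"
    then have "norm y ^ i \<le> norm y ^ n" using y S by (intro power_increasing) auto
    then show "norm (coeff p i * y ^ i) \<le> norm (coeff p i) * norm y ^ n"
      by (simp add: norm_mult norm_power mult_left_mono)
  qed
  also have "\<dots> = (\<Sum>i<degree p. norm (coeff p i)) * norm y ^ n"
    by (simp add: n sum_distrib_right del: sum.lessThan_Suc)
  also have "\<dots> < norm y * norm y ^ n"
    using y S by (intro mult_strict_right_mono zero_less_power) auto
  finally show False by simp
qed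

lemma prod_mset_le_power:
  fixes g :: "'a \<Rightarrow> real"
  assumes "\<And>y. y \<in># A \<Longrightarrow> 0 \<le> g y \<and> g y \<le> c"
  shows "(\<Prod>y\<in>#A. g y) \<le> c ^ size A" "0 \<le> (\<Prod>y\<in>#A. g y)"
proof -
  have "0 \<le> (\<Prod>y\<in>#A. g y) \<and> (\<Prod>y\<in>#A. g y) \<le> c ^ size A"
    using assms
  proof (induction A)
    case (add x A)
    then have "0 \<le> g x" "g x \<le> c" "0 \<le> (\<Prod>y\<in>#A. g y)" "(\<Prod>y\<in>#A. g y) \<le> c ^ size A" by auto
    then show ?case by (auto intro!: mult_mono)
  qed simp
  then show "(\<Prod>y\<in>#A. g y) \<le> c ^ size A" "0 \<le> (\<Prod>y\<in>#A. g y)" by auto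
qed

lemma prod_mset_less_imp_ex:
  fixes g :: "'a \<Rightarrow> real"
  assumes "(\<Prod>y\<in>#A. g y) < c ^ size A" "c \<ge> 0"
  shows "\<exists>y\<in>#A. g y < c"
proof (rule ccontr)
  assume *: "\<not> ?thesis"
  have "c ^ size A \<le> (\<Prod>y\<in>#A. g y)"
    using * \<open>c \<ge> 0\<close>
  proof (induction A)
    case (add x A)
    then have "c \<le> g x" "c ^ size A \<le> (\<Prod>y\<in>#A. g y)" by auto
    then show ?case using add.prems by (auto intro!: mult_mono)
  qed simp
  then show False using assms by simp
qed

lemma norm_prod_mset: "norm (\<Prod>y\<in>#A. g y :: complex) = (\<Prod>y\<in>#A. norm (g y))"
  by (induction A) (auto simp: norm_mult)

lemma prod_mset_divide: "(\<Prod>y\<in>#A. g y / h y :: complex) = (\<Prod>y\<in>#A. g y) / (\<Prod>y\<in>#A. h y)"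
  by (induction A) auto

text \<open>The embedding fixes the coefficients of a monic equation of \<open>D\<close>, so
  \<open>s D\<close> is another root of it.\<close>

lemma integral_over_embedding:
  assumes L: "csubfield L" and X: "X \<subseteq> L" and s: "embedding L s" "\<And>x. x \<in> X \<Longrightarrow> s x = x"
    and D: "D \<in> L" "D \<in> integral_over X"
  shows "s D \<in> integral_over X"
proof -
  obtain g where g: "g \<in> polys_over (ring_gen X)" "lead_coeff g = 1" "poly g D = 0"
    using integral_over_imp_monic_equation[OF D(2)] by blast
  have RL: "ring_gen X \<subseteq> L" by (rule ring_gen_subset[OF L X])
  have fixes_R: "s x = x" if "x \<in> ring_gen X" for x
    using that
  proof induction
    case (diff x y)
    then show ?case using RL by (simp add: embedding_diff[OF L s(1)] subset_iff)
  next
    case (mult x y)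
    then show ?case using RL by (simp add: embedding_mult[OF L s(1)] subset_iff)
  qed (auto simp: s embedding_1[OF L s(1)])
  have gL: "g \<in> polys_over L" using g polys_over_mono[OF RL] by blast
  have "map_poly s g = g"
    by (intro poly_eqI) (simp add: coeff_map_embedding[OF L s(1)] fixes_R polys_over_coeff[OF g(1)])
  then have "poly g (s D) = 0"
    using embedding_poly[OF L s(1) gL D(1)] g(3) embedding_0[OF L s(1)] by simp
  then show ?thesis
    using integral_over_root[of g X "s D"] g polys_over_mono[OF ring_gen_subset_integral_over] by blast
qed

lemma emb_size_near_le:
  assumes "finite X" "\<And>x. x \<in> X \<Longrightarrow> dist (s x) x < 1"
  shows "emb_size s X \<le> 1 + (\<Sum>x\<in>X. norm x + 1)"
proof -
  have "norm (s x) \<le> norm x + 1" if "x \<in> X" for x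
    using assms(2)[OF that] norm_triangle_sub[of "s x" x] by (simp add: dist_norm)
  then show ?thesis unfolding emb_size_def by (intro add_mono sum_mono) auto
qed

text \<open>The hypothesis is applied to the norm of \<open>D\<close>, all conjugates of which are bounded above.\<close>

lemma good_pair_integral:
  assumes good: "good_pair K X" and c: "c \<in> integral_over X"
    and p0: "p0 \<in> polys_over K" "p0 \<noteq> 0" "poly p0 c = 0"
  shows "good_pair (field_adjoin K c) (insert c X)"
  unfolding good_pair_def
proof (intro conjI allI impI)
  note K = good_pairD(1)[OF good] and cK = good_pairD(2)[OF good] and fX = good_pairD(3)[OF good]
    and XK = good_pairD(4)[OF good] and fr = good_pairD(5)[OF good]
  let ?L = "field_adjoin K c"
  have L: "csubfield ?L" by (rule csubfield_field_adjoin[OF K])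
  then show "csubfield ?L" .
  show "countable ?L" by (rule countable_field_adjoin[OF cK])
  show "finite (insert c X)" using fX by simp
  show XL: "insert c X \<subseteq> ?L"
    using XK field_adjoin_supset[OF K] field_adjoin_elem[OF K] by blast
  show "fractions_of ?L (insert c X)" by (rule fractions_of_field_adjoin[OF K fr])
  obtain m where m: "minimal_poly_of K {c} m"
    using minimal_poly_exists[OF K p0(1,2), of "{c}"] p0(3) by auto
  note mK = minimal_poly_ofD(1)[OF m] and m0 = minimal_poly_ofD(3)[OF m]
  have mc: "poly m c = 0" using minimal_poly_ofD(4)[OF m] by simp
  define n where "n = degree m"
  have n: "n > 0" unfolding n_def by (rule degree_minimal_poly_singleton[OF m])
  have sizem: "size (proots (map_poly s m)) = n" if "embedding K s" for s
    by (simp add: size_proots_complex degree_map_embedding[OF K that mK] n_def)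
  have rootm: "poly (map_poly s m) y = 0" if "embedding K s" "y \<in># proots (map_poly s m)" for s y
    using that m0 mK by (simp add: map_embedding_eq_0_iff[OF K that(1)])
  obtain g where g: "g \<in> polys_over (ring_gen X)" "lead_coeff g = 1" "poly g c = 0"
    using integral_over_imp_monic_equation[OF c] by blast
  have gK: "g \<in> polys_over K" using g polys_over_mono[OF ring_gen_subset[OF K XK]] by blast
  \<comment> \<open>Dominates \<open>emb_size\<close> on \<open>insert c X\<close> for every
    extension of \<open>s\<close>: the image of \<open>c\<close> is a root of the image of the monic
    \<open>g\<close> and obeys Cauchy's bound.\<close>
  define h where "h = (\<lambda>s. emb_size s X + (1 + (\<Sum>i<degree g. norm (s (coeff g i)))))"
  have "poly_bounded K X h"
    unfolding h_def
    by (intro poly_bounded_add poly_bounded_emb_size poly_bounded_const poly_bounded_sum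
        poly_bounded_ring_gen[OF K fX XK] polys_over_coeff[OF g(1)])
  then obtain B1 k where B1: "B1 \<ge> 1" "\<And>s. embedding K s \<Longrightarrow> h s \<le> (B1 * emb_size s X) ^ k"
    by (auto simp: poly_bounded_def)
  have yh: "emb_size s X + norm y \<le> h s" if s: "embedding K s" and y: "poly (map_poly s m) y = 0" for s y
  proof -
    have "poly (map_poly s g) y = 0" using minimal_poly_root_iff[OF K m s gK y] g(3) by simp
    moreover have "lead_coeff (map_poly s g) = 1"
      using g(2) embedding_1[OF K s] by (simp add: lead_coeff_map_embedding[OF K s gK])
    ultimately show ?thesis
      using monic_root_bound[of "map_poly s g" y]
      by (simp add: h_def degree_map_embedding[OF K s gK] coeff_map_embedding[OF K s])
  qed
  fix e B :: real assume e: "e > 0" and B: "B \<ge> 1"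
  define B2 where "B2 = B * B1"
  have B2: "B2 \<ge> 1" using B B1(1) mult_mono[of 1 B 1 B1] by (simp add: B2_def)
  have Bh: "B * h s \<le> (B2 * emb_size s X) ^ Suc k" if s: "embedding K s" for s
  proof -
    have "B * 1 \<le> B * (B1 * emb_size s X)"
      using B B1(1) emb_size_ge_1[of s X] mult_mono[of 1 B1 1 "emb_size s X"] by (intro mult_left_mono) auto
    then have 1: "B \<le> B2 * emb_size s X" by (simp add: B2_def mult_ac)
    have "(B1 * emb_size s X) ^ k \<le> (B2 * emb_size s X) ^ k"
      using B B1(1) emb_size_ge_1[of s X] mult_right_mono[of 1 B B1]
      by (intro power_mono mult_right_mono) (auto simp: B2_def)
    then have 2: "h s \<le> (B2 * emb_size s X) ^ k" using B1(2)[OF s] by simp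
    have "0 \<le> h s" using emb_size_ge_1[of s X] by (auto simp: h_def intro!: add_nonneg_nonneg sum_nonneg)
    then have "B * h s \<le> (B2 * emb_size s X) * (B2 * emb_size s X) ^ k"
      using 1 2 B B2 emb_size_ge_1[of s X] by (intro mult_mono) auto
    then show ?thesis by simp
  qed
  have "((\<lambda>s. poly (map_poly s m) c) \<longlongrightarrow> 0) (near_id K X)"
    using tendsto_near_id_poly[OF K XK fr mK, of c] mc by simp
  \<comment> \<open>The value at \<open>c\<close> of the transported minimal polynomial is the
    product of \<open>c - y\<close> over its \<open>n\<close> roots. If it is below
    \<open>e ^ n\<close>, one root is within \<open>e\<close> of \<open>c\<close>.\<close>
  moreover have "e ^ n > 0" using e by simp
  ultimately have "eventually (\<lambda>s. dist (poly (map_poly s m) c) 0 < e ^ n) (near_id K X)"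
    by (rule tendstoD)
  then obtain e0 where e0: "e0 > 0" "\<And>s. embedding K s \<Longrightarrow> (\<forall>x\<in>X. dist (s x) x < e0) \<Longrightarrow>
      norm (poly (map_poly s m) c) < e ^ n"
    unfolding eventually_near_id by auto
  \<comment> \<open>\<open>e1 \<le> 1\<close> bounds the size of the embedding by the constant
    inside \<open>C\<close>, and \<open>e1 \<le> e0\<close> provides a root near \<open>c\<close> to
    extend by.\<close>
  define e1 where "e1 = min e (min 1 e0)"
  have e1: "e1 > 0" "e1 \<le> e" "e1 \<le> 1" "e1 \<le> e0" using e e0 by (auto simp: e1_def)
  from good_pair_bound[OF good e1(1) B2] obtain r where r: "r > 0"
    and IH: "\<And>M D. M > 0 \<Longrightarrow> D \<in> K \<Longrightarrow> D \<in> integral_over X \<Longrightarrow> D \<noteq> 0 \<Longrightarrow>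
      (\<And>s. embedding K s \<Longrightarrow> norm (s D) \<le> (B2 * emb_size s X) ^ M) \<Longrightarrow>
      (\<exists>s. embedding K s \<and> (\<forall>x\<in>X. dist (s x) x < e1) \<and> norm (s D) \<ge> r ^ M)" by blast
  define C where "C = (B2 * (1 + (\<Sum>x\<in>X. norm x + 1))) ^ Suc k"
  have C: "C \<ge> 1"
  proof -
    have "1 \<le> 1 + (\<Sum>x\<in>X. norm x + 1)" by (simp add: sum_nonneg)
    then have "1 * 1 \<le> B2 * (1 + (\<Sum>x\<in>X. norm x + 1))" using B2 by (intro mult_mono) auto
    then show ?thesis unfolding C_def by (intro one_le_power) simp
  qed
  show "\<exists>r>0. \<forall>M>0. \<forall>D\<in>?L \<inter> integral_over (insert c X). D \<noteq> 0 \<longrightarrow>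
      (\<forall>s. embedding ?L s \<longrightarrow> norm (s D) \<le> (B * emb_size s (insert c X)) ^ M) \<longrightarrow>
      (\<exists>s. embedding ?L s \<and> (\<forall>x\<in>insert c X. dist (s x) x < e) \<and> norm (s D) \<ge> r ^ M)"
  \<comment> \<open>For a suitable embedding the norm of \<open>D\<close> is at least
    \<open>r ^ (Suc k * M * n)\<close>, while the other conjugates, at most \<open>n\<close> in
    number, are each at most \<open>C ^ M\<close>.\<close>
  proof (intro exI[of _ "r ^ (Suc k * n) / C ^ n"] conjI allI impI ballI)
    show "r ^ (Suc k * n) / C ^ n > 0" using r C by simp
    fix M :: nat and D
    assume M: "M > 0" and D: "D \<in> ?L \<inter> integral_over (insert c X)" "D \<noteq> 0"
      and bound: "\<forall>s. embedding ?L s \<longrightarrow> norm (s D) \<le> (B * emb_size s (insert c X)) ^ M"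
    obtain U W where U: "U \<in> polys_over K" and W: "W \<in> polys_over K" "poly W c \<noteq> 0"
      and DUW: "D = poly U c / poly W c"
      using D(1) by (auto elim: field_adjoinE)
    have Uc: "poly U c \<noteq> 0" using D(2) DUW by auto
    \<comment> \<open>The image of \<open>D\<close> under the extension of \<open>s\<close> that
      sends \<open>c\<close> to the root \<open>y\<close>.\<close>
    define v :: "(complex \<Rightarrow> complex) \<Rightarrow> complex \<Rightarrow> complex"
      where "v = (\<lambda>s y. poly (map_poly s U) y / poly (map_poly s W) y)"
    have ext: "\<exists>s'. embedding ?L s' \<and> (\<forall>x\<in>K. s' x = s x) \<and> s' c = y \<and> s' D = v s y"
      if s: "embedding K s" and y: "poly (map_poly s m) y = 0" for s y
    proof -
      have "poly p c = 0 \<longleftrightarrow> poly (map_poly s p) y = 0" if "p \<in> polys_over K" for p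
        by (rule minimal_poly_root_iff[OF K m s that y])
      then obtain s' where s': "embedding ?L s'" "\<And>x. x \<in> K \<Longrightarrow> s' x = s x"
        "\<And>p w. p \<in> polys_over K \<Longrightarrow> w \<in> polys_over K \<Longrightarrow> poly w c \<noteq> 0 \<Longrightarrow>
          s' (poly p c / poly w c) = poly (map_poly s p) y / poly (map_poly s w) y" "s' c = y"
        using embedding_extension[OF K s, of c y] by blast
      then have "s' D = v s y" unfolding DUW v_def using U W by blast
      then show ?thesis using s' by blast
    qed
    have vb: "norm (v s y) \<le> ((B2 * emb_size s X) ^ Suc k) ^ M"
      if s: "embedding K s" and y: "poly (map_poly s m) y = 0" for s y
    proof -
      obtain s' where s': "embedding ?L s'" "\<forall>x\<in>K. s' x = s x" "s' c = y" "s' D = v s y"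
        using ext[OF s y] by blast
      have "norm (v s y) \<le> (B * emb_size s' (insert c X)) ^ M" using bound s'(1) unfolding s'(4)[symmetric] by blast
      also have "\<dots> \<le> (B * h s) ^ M"
      proof (intro power_mono mult_left_mono)
        have "emb_size s' (insert c X) \<le> emb_size s X + norm y"
          using emb_size_insert_le[OF fX, of s' s c] s' XK by auto
        then show "emb_size s' (insert c X) \<le> h s" using yh[OF s y] by simp
      qed (use B emb_size_ge_1[of s' "insert c X"] in auto)
      also have "\<dots> \<le> ((B2 * emb_size s X) ^ Suc k) ^ M"
        using Bh[OF s] B emb_size_ge_1[of s X]
        by (intro power_mono) (auto simp: h_def intro!: mult_nonneg_nonneg add_nonneg_nonneg sum_nonneg)
      finally show ?thesis .
    qed
    \<comment> \<open>The norm of \<open>D\<close>, written with resultants so that it lies in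
      \<open>K\<close> and commutes with embeddings.\<close>
    define N where "N = root_prod m U / root_prod m W"
    note resU = root_prod_embedding[OF K mK U m0] and resW = root_prod_embedding[OF K mK W(1) m0]
    have NK: "N \<in> K" unfolding N_def using resU resW by (intro csubfield_divide[OF K]) auto
    have sN: "s N = (\<Prod>y\<in>#proots (map_poly s m). v s y)" if s: "embedding K s" for s
    proof -
      have "s N = root_prod (map_poly s m) (map_poly s U) / root_prod (map_poly s m) (map_poly s W)"
        unfolding N_def using resU resW s by (simp add: embedding_divide[OF K s])
      also have "\<dots> = (\<Prod>y\<in>#proots (map_poly s m). v s y)"
        unfolding root_prod_def v_def by (rule prod_mset_divide[symmetric])
      finally show ?thesis .
    qed
    have N0: "N \<noteq> 0"
    proof -
      have "v (\<lambda>x. x) y \<noteq> 0" if "y \<in># proots (map_poly (\<lambda>x. x) m)" for y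
        using rootm[OF embedding_id that] minimal_poly_root_iff[OF K m embedding_id U, of y] Uc
          minimal_poly_root_iff[OF K m embedding_id W(1), of y] W(2) by (auto simp: v_def)
      then show ?thesis using sN[OF embedding_id] by auto
    qed
    have NI: "N \<in> integral_over X"
    proof -
      have DI: "D \<in> integral_over X" using D integral_over_insert[OF c] by simp
      have "v (\<lambda>x. x) y \<in> integral_over X" if y: "y \<in># proots (map_poly (\<lambda>x. x) m)" for y
      proof -
        obtain s' where s': "embedding ?L s'" "\<forall>x\<in>K. s' x = x" "s' D = v (\<lambda>x. x) y"
          using ext[OF embedding_id rootm[OF embedding_id y]] by blast
        have "s' D \<in> integral_over X"
          by (rule integral_over_embedding[OF L _ s'(1)]) (use XL s'(2) XK D(1) DI in auto)
        then show ?thesis using s'(3) by simp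
      qed
      then have "(\<Prod>y\<in>#proots (map_poly (\<lambda>x. x) m). v (\<lambda>x. x) y) \<in> integral_over X"
        by (rule csubring_prod_mset[OF csubring_integral_over])
      then show ?thesis using sN[OF embedding_id] by simp
    qed
    have Nb: "norm (s N) \<le> (B2 * emb_size s X) ^ (Suc k * M * n)" if s: "embedding K s" for s
    proof -
      have "norm (s N) \<le> (((B2 * emb_size s X) ^ Suc k) ^ M) ^ size (proots (map_poly s m))"
        unfolding sN[OF s] norm_prod_mset
        by (rule prod_mset_le_power(1)) (use vb[OF s] rootm[OF s] in auto)
      then show ?thesis by (simp only: sizem[OF s] power_mult)
    qed
    have M': "Suc k * M * n > 0" using M n by simp
    obtain s where s: "embedding K s" "\<forall>x\<in>X. dist (s x) x < e1" "norm (s N) \<ge> r ^ (Suc k * M * n)"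
      using IH[OF M' NK NI N0 Nb] by blast
    have "norm (poly (map_poly s m) c) < e ^ n" using s e1 by (intro e0) auto
    moreover have "lead_coeff (map_poly s m) = 1"
      using minimal_poly_ofD(2)[OF m] embedding_1[OF K s(1)] by (simp add: lead_coeff_map_embedding[OF K s(1) mK])
    ultimately have "(\<Prod>y\<in>#proots (map_poly s m). norm (c - y)) < e ^ size (proots (map_poly s m))"
      by (simp only: poly_conv_proots[of "map_poly s m" c] norm_prod_mset sizem[OF s(1)] mult_1)
    then obtain y where y: "y \<in># proots (map_poly s m)" "norm (c - y) < e"
      using prod_mset_less_imp_ex[of _ _ e] e by auto
    obtain s' where s': "embedding ?L s'" "\<forall>x\<in>K. s' x = s x" "s' c = y" "s' D = v s y"
      using ext[OF s(1) rootm[OF s(1) y(1)]] by blast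
    have "emb_size s X \<le> 1 + (\<Sum>x\<in>X. norm x + 1)"
      using s(2) e1(3) by (intro emb_size_near_le[OF fX]) force
    then have EC: "(B2 * emb_size s X) ^ Suc k \<le> C"
      unfolding C_def using B2 emb_size_ge_1[of s X] by (intro power_mono mult_left_mono) auto
    have vC: "0 \<le> norm (v s y) \<and> norm (v s y) \<le> C ^ M" if "y \<in># proots (map_poly s m)" for y
    proof -
      have "((B2 * emb_size s X) ^ Suc k) ^ M \<le> C ^ M"
        using EC B2 emb_size_ge_1[of s X] by (intro power_mono) auto
      then show ?thesis using vb[OF s(1) rootm[OF s(1) that]] by simp
    qed
    obtain A where A: "proots (map_poly s m) = add_mset y A" using y(1) by (meson multi_member_split)
    have sA: "size A \<le> n" using sizem[OF s(1)] A by simp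
    have "r ^ (Suc k * M * n) \<le> norm (v s y) * (\<Prod>y\<in>#A. norm (v s y))"
      using s(3) unfolding sN[OF s(1)] norm_prod_mset A by simp
    also have "\<dots> \<le> norm (v s y) * C ^ (M * n)"
    proof (intro mult_left_mono)
      have "(\<Prod>y\<in>#A. norm (v s y)) \<le> (C ^ M) ^ size A"
        by (rule prod_mset_le_power(1)) (use vC A in auto)
      also have "\<dots> \<le> C ^ (M * n)" unfolding power_mult[symmetric] using C sA by (intro power_increasing) auto
      finally show "(\<Prod>y\<in>#A. norm (v s y)) \<le> C ^ (M * n)" .
    qed simp
    finally have "r ^ (Suc k * M * n) / C ^ (M * n) \<le> norm (v s y)"
      using C by (simp add: divide_le_eq)
    moreover have "(r ^ (Suc k * n) / C ^ n) ^ M = r ^ (Suc k * M * n) / C ^ (M * n)"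
      by (simp only: power_divide power_mult[symmetric] mult_ac)
    ultimately have "(r ^ (Suc k * n) / C ^ n) ^ M \<le> norm (s' D)" by (simp only: s'(4))
    moreover have "\<forall>x\<in>insert c X. dist (s' x) x < e"
    proof
      fix x assume "x \<in> insert c X"
      then consider "x = c" | "x \<in> X" by blast
      then show "dist (s' x) x < e"
      proof cases
        case 1
        then show ?thesis using y(2) s'(3) by (simp add: dist_norm norm_minus_commute)
      next
        case 2
        then have "s' x = s x" "dist (s x) x < e1" using s'(2) s(2) XK by auto
        then show ?thesis using e1(2) by simp
      qed
    qed
    ultimately show "\<exists>s. embedding ?L s \<and> (\<forall>x\<in>insert c X. dist (s x) x < e) \<and>
        norm (s D) \<ge> (r ^ (Suc k * n) / C ^ n) ^ M"
      using s'(1) by blast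
  qed
qed

text \<open>Generators are adjoined one at a time. An algebraic one is first multiplied by the
  leading coefficient \<open>l\<close> of an equation over \<open>ring_gen X\<close>: it becomes
  integral, and since \<open>l\<close> lies in \<open>K\<close> the extension does not
  change.\<close>

theorem good_pair_exists:
  assumes "finite C"
  shows "\<exists>K X. good_pair K X \<and> C \<subseteq> K"
  using assms
proof (induction C rule: finite_induct)
  case empty
  then show ?case using good_pair_rationals by blast
next
  case (insert c C)
  then obtain K X where good: "good_pair K X" "C \<subseteq> K" by blast
  note K = good_pairD(1)[OF good(1)] and fr = good_pairD(5)[OF good(1)] and XK = good_pairD(4)[OF good(1)]
  show ?case
  proof (cases "\<forall>p\<in>polys_over K. poly p c = 0 \<longrightarrow> p = 0")
    case True
    then have "good_pair (field_adjoin K c) (insert c X)"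
      by (intro good_pair_transcendental[OF good(1)]) auto
    then show ?thesis
      using good(2) field_adjoin_supset[OF K] field_adjoin_elem[OF K]
      by (intro exI[of _ "field_adjoin K c"] exI[of _ "insert c X"]) auto
  next
    case False
    then obtain p where p: "p \<in> polys_over K" "p \<noteq> 0" "poly p c = 0" by blast
    obtain q where q: "q \<in> ring_gen X" "q \<noteq> 0" "smult q p \<in> polys_over (ring_gen X)"
      using poly_common_denominator[OF K fr p(1)] by blast
    define g where "g = smult q p"
    define n where "n = degree g"
    define l where "l = lead_coeff g"
    have g: "g \<in> polys_over (ring_gen X)" "g \<noteq> 0" "poly g c = 0" using p q by (auto simp: g_def)
    have l: "l \<noteq> 0" "l \<in> ring_gen X" using g by (auto simp: l_def intro: polys_over_coeff)
    have lK: "l \<in> K" using l ring_gen_subset[OF K XK] by blast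
    have n: "n \<noteq> 0"
    proof
      assume "n = 0"
      then obtain a where "g = [:a:]" by (auto simp: n_def elim: degree_eq_zeroE)
      then show False using g by simp
    qed
    note G = csubring_ring_gen[of X]
    \<comment> \<open>The lower terms of \<open>l ^ (n - 1) * g(x / l)\<close>, which is monic and
      has no denominators.\<close>
    define u where "u = (\<Sum>i<n. monom (coeff g i * l ^ (n - 1 - i)) i)"
    define f where "f = monom 1 n + u"
    have u: "u \<in> polys_over (ring_gen X)" unfolding u_def
      by (intro polys_over_sum[OF G] polys_over_monom[OF G] csubring_mult[OF G] csubring_power[OF G] l
          polys_over_coeff[OF g(1)])
    have du: "degree u < n"
    proof -
      have "degree u \<le> n - 1" unfolding u_def
        by (intro degree_sum_le) (auto intro!: order.trans[OF degree_monom_le])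
      then show ?thesis using n by simp
    qed
    have "degree f = n" unfolding f_def using du by (subst degree_add_eq_left) (auto simp: degree_monom_eq)
    then have "lead_coeff f = 1" using du by (simp add: f_def coeff_eq_0)
    moreover have "poly f (l * c) = l ^ (n - 1) * poly g c"
    proof -
      have "{..n} = insert n {..<n}" by auto
      then have "l ^ (n - 1) * poly g c = l ^ (n - 1) * (l * c ^ n) + (\<Sum>i<n. l ^ (n - 1) * (coeff g i * c ^ i))"
        by (simp add: poly_altdef n_def[symmetric] l_def sum_distrib_left ring_distribs)
      also have "l ^ (n - 1) * (l * c ^ n) = (l * c) ^ n"
        using n by (cases n) (auto simp: power_mult_distrib)
      also have "(\<Sum>i<n. l ^ (n - 1) * (coeff g i * c ^ i)) = poly u (l * c)"
        unfolding u_def poly_sum poly_monom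
      proof (intro sum.cong refl)
        fix i assume "i \<in> {..<n}"
        then have "l ^ (n - 1) = l ^ (n - 1 - i) * l ^ i" by (simp flip: power_add)
        then show "l ^ (n - 1) * (coeff g i * c ^ i) = coeff g i * l ^ (n - 1 - i) * (l * c) ^ i"
          by (simp add: power_mult_distrib)
      qed
      finally show ?thesis by (simp add: f_def poly_monom)
    qed
    moreover have "f \<in> polys_over (integral_over X)"
      using polys_over_add[OF G polys_over_monom[OF G csubring_1[OF G]] u]
        polys_over_mono[OF ring_gen_subset_integral_over] unfolding f_def by blast
    ultimately have I: "l * c \<in> integral_over X"
      using integral_over_root[of f X "l * c"] g(3) by simp
    define p' where "p' = pcompose p [:0, inverse l:]"
    note R = csubfield_imp_csubring[OF K]
    have "p' \<in> polys_over K" unfolding p'_def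
      by (intro polys_over_pcompose[OF R] p polys_over_pCons[OF R] polys_over_const[OF R]
          csubring_0[OF R] csubfield_inverse[OF K] lK) (use polys_over_0[OF R] in auto)
    moreover have "p' \<noteq> 0" unfolding p'_def using p(2) l(1) by (simp add: pcompose_eq_0_iff)
    moreover have "poly p' (l * c) = 0"
    proof -
      have "poly [:0, inverse l:] (l * c) = c" using l by (simp add: field_simps)
      then show ?thesis using p(3) unfolding p'_def poly_pcompose by (simp only:)
    qed
    ultimately have good': "good_pair (field_adjoin K (l * c)) (insert (l * c) X)"
      by (intro good_pair_integral[OF good(1) I])
    have "c \<in> field_adjoin K (l * c)"
    proof -
      have "l * c / l \<in> field_adjoin K (l * c)"
        using csubfield_field_adjoin[OF K] field_adjoin_elem[OF K] field_adjoin_supset[OF K] lK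
        by (intro csubfield_divide) auto
      then show ?thesis using l by simp
    qed
    then show ?thesis using good' good(2) field_adjoin_supset[OF K, of "l * c"] by blast
  qed
qed

section \<open>Fekete estimates and iteration\<close>

lemma coeff_prod_linear:
  fixes A :: "complex set"
  assumes "finite A"
  shows "degree (\<Prod>y\<in>A. [:-y, 1:]) = card A" "lead_coeff (\<Prod>y\<in>A. [:-y, 1:]) = 1"
proof -
  show "degree (\<Prod>y\<in>A. [:-y, 1:]) = card A"
    by (subst degree_prod_sum_eq) auto
  show "lead_coeff (\<Prod>y\<in>A. [:-y, 1:]) = 1"
    by (simp add: lead_coeff_prod)
qed

text \<open>Lagrange interpolation at \<open>n + 1\<close> points reproduces \<open>p\<close>;
  compare the coefficients of degree \<open>n\<close>.\<close>

lemma lagrange_lead_coeff: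
  fixes L :: "complex set"
  assumes L: "finite L" "card L = Suc n" and p: "degree p = n" "lead_coeff p = 1"
  shows "(\<Sum>x\<in>L. poly p x / (\<Prod>y\<in>L-{x}. (x - y))) = 1"
proof -
  define c where "c = (\<lambda>x. poly p x / (\<Prod>y\<in>L-{x}. (x - y)))"
  define b where "b = (\<lambda>x. \<Prod>y\<in>L-{x}. [:-y, 1:])"
  define q where "q = p - (\<Sum>x\<in>L. smult (c x) (b x))"
  have b: "degree (b x) = n" "lead_coeff (b x) = 1" if "x \<in> L" for x
    using coeff_prod_linear[of "L - {x}"] L that by (auto simp: b_def)
  have pb: "poly (b x) z = (if z = x then (\<Prod>y\<in>L-{x}. (x - y)) else 0)" if "x \<in> L" "z \<in> L" for x z
    using that L by (auto simp: b_def poly_prod intro!: prod_zero)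
  have "poly q z = 0" if z: "z \<in> L" for z
  proof -
    have "(\<Sum>x\<in>L. c x * poly (b x) z) = (\<Sum>x\<in>L. if x = z then c z * poly (b z) z else 0)"
      using z by (intro sum.cong refl) (auto simp: pb)
    also have "\<dots> = c z * poly (b z) z" using L z by simp
    also have "\<dots> = poly p z" using L z by (auto simp: pb c_def)
    finally show ?thesis by (simp add: q_def poly_sum)
  qed
  moreover have "degree q \<le> n"
    unfolding q_def using p b
    by (intro degree_diff_le degree_sum_le L) (auto intro: order.trans[OF degree_smult_le])
  ultimately have "q = 0"
    using L card_poly_roots_bound[of q] card_mono[of "{x. poly q x = 0}" L] poly_roots_finite[of q] by force
  then have "coeff q n = 0" by simp
  then have "1 = (\<Sum>x\<in>L. c x * coeff (b x) n)" using p by (simp add: q_def coeff_sum)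
  also have "\<dots> = (\<Sum>x\<in>L. c x)" using b by (intro sum.cong) auto
  finally show ?thesis by (simp add: c_def)
qed

text \<open>Every pair occurs in both orders, so for finite \<open>L\<close> this is, up to sign,
  the square of the Vandermonde product, hence the discriminant of the monic polynomial with simple
  roots \<open>L\<close>.\<close>

definition diff_prod :: "complex set \<Rightarrow> complex" where
  "diff_prod L = (\<Prod>x\<in>L. \<Prod>y\<in>L-{x}. (x - y))"

lemma diff_prod_remove:
  assumes "finite L" "x \<in> L"
  shows "diff_prod L = (-1) ^ card (L - {x}) * (\<Prod>y\<in>L-{x}. (x - y))\<^sup>2 * diff_prod (L - {x})"
proof -
  have "diff_prod L = (\<Prod>y\<in>L-{x}. (x - y)) * (\<Prod>z\<in>L-{x}. \<Prod>y\<in>L-{z}. (z - y))"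
    unfolding diff_prod_def using assms by (subst prod.remove[of _ x]) auto
  also have "(\<Prod>z\<in>L-{x}. \<Prod>y\<in>L-{z}. (z - y)) = (\<Prod>z\<in>L-{x}. (-1) * (x - z) * (\<Prod>y\<in>L-{x}-{z}. (z - y)))"
  proof (intro prod.cong refl)
    fix z assume z: "z \<in> L - {x}"
    then have "(\<Prod>y\<in>L-{z}. (z - y)) = (z - x) * (\<Prod>y\<in>L-{z}-{x}. (z - y))"
      using assms by (subst prod.remove[of _ x]) auto
    also have "L - {z} - {x} = L - {x} - {z}" by auto
    finally show "(\<Prod>y\<in>L-{z}. (z - y)) = (-1) * (x - z) * (\<Prod>y\<in>L-{x}-{z}. (z - y))" by simp
  qed
  also have "\<dots> = (-1) ^ card (L - {x}) * (\<Prod>z\<in>L-{x}. (x - z)) * diff_prod (L - {x})"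
    unfolding diff_prod_def prod.distrib by simp
  finally show ?thesis by (simp add: power2_eq_square mult_ac)
qed

text \<open>Fekete's estimate, removing at each step a point that Lagrange interpolation shows to be
  close to the others. This avoids Vandermonde determinants and works verbatim for valuations.\<close>

lemma norm_diff_prod_le:
  fixes P :: "nat \<Rightarrow> complex poly" and b :: "nat \<Rightarrow> real"
  assumes P: "\<And>j. degree (P j) = j" "\<And>j. lead_coeff (P j) = 1"
  shows "finite L \<Longrightarrow> card L = n \<Longrightarrow> (\<And>j x. j < n \<Longrightarrow> x \<in> L \<Longrightarrow> norm (poly (P j) x) \<le> b j) \<Longrightarrow>
    norm (diff_prod L) \<le> (\<Prod>j<n. real (Suc j) * b j)\<^sup>2"
proof (induction n arbitrary: L)
  case 0
  then show ?case by (simp add: diff_prod_def)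
next
  case (Suc n)
  define Q where "Q = (\<lambda>x. \<Prod>y\<in>L-{x}. (x - y))"
  \<comment> \<open>Otherwise each of the \<open>n + 1\<close> Lagrange terms, whose sum is 1, would
    be below \<open>1 / (n + 1)\<close>.\<close>
  have "\<exists>x\<in>L. norm (Q x) \<le> Suc n * b n"
  proof (rule ccontr)
    assume "\<not> ?thesis"
    then have gt: "norm (Q x) > Suc n * b n" if "x \<in> L" for x using that by auto
    have lt: "norm (poly (P n) x / Q x) < 1 / Suc n" if "x \<in> L" for x
    proof -
      have "b n \<ge> 0" using Suc.prems(3)[of n x] that norm_ge_zero[of "poly (P n) x"] by linarith
      then have "norm (Q x) > 0" using gt[OF that] by (smt (verit) mult_nonneg_nonneg of_nat_0_le_iff)
      moreover have "Suc n * norm (poly (P n) x) < norm (Q x)"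
        using gt[OF that] Suc.prems(3)[of n x] that
        by (smt (verit) lessI mult_left_mono of_nat_0_le_iff)
      ultimately show ?thesis by (simp add: norm_divide field_simps)
    qed
    have ne: "L \<noteq> {}" using Suc.prems by auto
    have "1 = norm (\<Sum>x\<in>L. poly (P n) x / Q x)"
      using lagrange_lead_coeff[OF Suc.prems(1,2) P] by (simp add: Q_def)
    also have "\<dots> \<le> (\<Sum>x\<in>L. norm (poly (P n) x / Q x))" by (rule norm_sum)
    also have "\<dots> < (\<Sum>x\<in>L. 1 / Suc n)" by (intro sum_strict_mono Suc.prems ne lt)
    also have "\<dots> = 1" using Suc.prems by simp
    finally show False by simp
  qed
  then obtain x where x: "x \<in> L" "norm (Q x) \<le> Suc n * b n" by blast
  have "norm (diff_prod (L - {x})) \<le> (\<Prod>j<n. real (Suc j) * b j)\<^sup>2"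
    using Suc.prems x by (intro Suc.IH) auto
  then have "norm (Q x) ^ 2 * norm (diff_prod (L - {x})) \<le> (Suc n * b n)\<^sup>2 * (\<Prod>j<n. real (Suc j) * b j)\<^sup>2"
    using x by (intro mult_mono power_mono) auto
  moreover have "norm (diff_prod L) = norm (Q x) ^ 2 * norm (diff_prod (L - {x}))"
    using diff_prod_remove[OF Suc.prems(1) x(1)] by (simp add: Q_def norm_mult norm_power)
  ultimately show ?case by (simp add: power_mult_distrib mult_ac)
qed

section \<open>Fekete's estimate in a valuation ring\<close>

text \<open>The maximal ideal of a valuation ring. Zero is listed separately because
  \<open>inverse 0 = 0\<close> lies in \<open>V\<close>.\<close>

definition nonunits :: "complex set \<Rightarrow> complex set" where
  "nonunits V = {x \<in> V. x = 0 \<or> inverse x \<notin> V}"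

lemma nonunits_mult:
  assumes V: "val_ring V" and "a \<in> V" "b \<in> nonunits V"
  shows "a * b \<in> nonunits V"
proof -
  note R = val_ring_imp_csubring[OF V]
  have "inverse (a * b) \<notin> V" if "a * b \<noteq> 0"
  proof
    assume "inverse (a * b) \<in> V"
    then have "a * inverse (a * b) \<in> V" by (rule csubring_mult[OF R assms(2)])
    then have "inverse b \<in> V" using that by (simp add: field_simps)
    then show False using assms(3) that by (auto simp: nonunits_def)
  qed
  then show ?thesis using assms csubring_mult[OF R] by (auto simp: nonunits_def)
qed

lemma nonunits_add:
  assumes V: "val_ring V" and a: "a \<in> nonunits V" and b: "b \<in> nonunits V"
  shows "a + b \<in> nonunits V"
proof (cases "a = 0 \<or> b = 0")
  case True
  then show ?thesis using a b by auto
next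
  case False
  note R = val_ring_imp_csubring[OF V]
  have *: "a + b \<in> nonunits V" if "a / b \<in> V" "b \<in> nonunits V" "b \<noteq> 0" for a b
  proof -
    have "(a / b + 1) * b \<in> nonunits V"
      by (intro nonunits_mult[OF V] csubring_add[OF R] csubring_1[OF R] that)
    moreover have "(a / b + 1) * b = a + b" using that by (simp add: distrib_right)
    ultimately show ?thesis by simp
  qed
  have "a / b \<in> V \<or> inverse (a / b) \<in> V" using V by (auto simp: val_ring_def)
  then show ?thesis using *[of a b] *[of b a] a b False by (auto simp: add.commute)
qed

lemma nonunits_sum:
  assumes V: "val_ring V"
  shows "(\<And>i. i \<in> A \<Longrightarrow> g i \<in> nonunits V) \<Longrightarrow> sum g A \<in> nonunits V"
proof (induction A rule: infinite_finite_induct)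
  case (insert x F)
  then show ?case using nonunits_add[OF V] by simp
qed (auto simp: nonunits_def csubring_0[OF val_ring_imp_csubring[OF V]])

text \<open>Here \<open>u j\<close> is a denominator for the values of \<open>P j\<close>. As sums
  of nonunits are nonunits, Lagrange terms with sum 1 cannot all be nonunits; this replaces the
  comparison with \<open>1 / (n + 1)\<close> and costs no factor.\<close>

lemma val_ring_diff_prod:
  fixes P :: "nat \<Rightarrow> complex poly" and u :: "nat \<Rightarrow> complex"
  assumes V: "val_ring V" and P: "\<And>j. degree (P j) = j" "\<And>j. lead_coeff (P j) = 1"
  shows "finite L \<Longrightarrow> card L = n \<Longrightarrow> (\<And>j x. j < n \<Longrightarrow> x \<in> L \<Longrightarrow> u j * poly (P j) x \<in> V) \<Longrightarrow>
    (\<Prod>j<n. u j)\<^sup>2 * diff_prod L \<in> V"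
proof (induction n arbitrary: L)
  case 0
  then show ?case using csubring_1[OF val_ring_imp_csubring[OF V]] by (simp add: diff_prod_def)
next
  case (Suc n)
  note R = val_ring_imp_csubring[OF V]
  define Q where "Q = (\<lambda>x. \<Prod>y\<in>L-{x}. (x - y))"
  define t where "t = (\<lambda>x. poly (P n) x / Q x)"
  have "(\<Sum>x\<in>L. t x) = 1"
    using lagrange_lead_coeff[OF Suc.prems(1,2) P] by (simp add: Q_def t_def)
  moreover have "1 \<notin> nonunits V" using csubring_1[OF R] by (simp add: nonunits_def)
  ultimately obtain x where x: "x \<in> L" "t x \<notin> nonunits V" using nonunits_sum[OF V, of L t] by force
  then have t: "t x \<noteq> 0" "inverse (t x) \<in> V"
    using V csubring_0[OF R] by (auto simp: nonunits_def val_ring_def)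
  have "u n * poly (P n) x * inverse (t x) \<in> V"
    by (intro csubring_mult[OF R] Suc.prems t x) auto
  moreover have "poly (P n) x * inverse (t x) = Q x" using t(1) by (simp add: t_def)
  ultimately have Qx: "u n * Q x \<in> V" by (simp only: mult.assoc)
  have IH: "(\<Prod>j<n. u j)\<^sup>2 * diff_prod (L - {x}) \<in> V"
    using Suc.prems x by (intro Suc.IH) auto
  have "(-1) ^ card (L - {x}) * ((u n * Q x) ^ 2 * ((\<Prod>j<n. u j)\<^sup>2 * diff_prod (L - {x}))) \<in> V"
    by (intro csubring_mult[OF R] csubring_power[OF R] Qx IH csubring_uminus[OF R] csubring_1[OF R])
  then show ?case
    using diff_prod_remove[OF Suc.prems(1) x(1)] by (simp add: Q_def power_mult_distrib mult_ac)
qed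

section \<open>Size of preperiodic points\<close>

lemma preperiodic_finite_orbit:
  assumes "preperiodic f x"
  shows "finite (range (\<lambda>k. (poly f ^^ k) x))"
proof -
  obtain i j where ij: "i < j" "(poly f ^^ i) x = (poly f ^^ j) x"
    using assms unfolding preperiodic_def by (metis linorder_neqE_nat)
  have "(poly f ^^ k) x \<in> (\<lambda>l. (poly f ^^ l) x) ` {..<j}" for k
  proof (induction k rule: less_induct)
    case (less k)
    show ?case
    proof (cases "k < j")
      case False
      then have "(poly f ^^ k) x = (poly f ^^ (k - j + j)) x" by simp
      also have "\<dots> = (poly f ^^ (k - j)) ((poly f ^^ i) x)"
        by (simp only: funpow_add comp_apply ij(2))
      also have "\<dots> = (poly f ^^ (k - j + i)) x" by (simp only: funpow_add comp_apply)
      finally have eq: "(poly f ^^ k) x = (poly f ^^ (k - j + i)) x" .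
      have "k - j + i < k" using False ij(1) by simp
      from less[OF this] show ?thesis by (simp only: eq)
    qed (blast intro: lessThan_iff[THEN iffD2])
  qed
  then have "range (\<lambda>k. (poly f ^^ k) x) \<subseteq> (\<lambda>l. (poly f ^^ l) x) ` {..<j}" by blast
  then show ?thesis by (rule finite_subset) simp
qed

text \<open>A finite forward-invariant set allows arguing at an extremal point, for absolute values
  and valuations alike.\<close>

lemma preperiodic_orbit:
  assumes "preperiodic f x"
  shows "\<exists>A. finite A \<and> x \<in> A \<and> (\<forall>z\<in>A. poly f z \<in> A)"
proof (intro exI conjI ballI)
  let ?A = "range (\<lambda>k. (poly f ^^ k) x)"
  show "finite ?A" by (rule preperiodic_finite_orbit[OF assms])
  have "(poly f ^^ 0) x \<in> ?A" by (rule rangeI)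
  then show "x \<in> ?A" by simp
  fix z assume "z \<in> ?A"
  then obtain k where "z = (poly f ^^ k) x" by blast
  then have "poly f z = (poly f ^^ Suc k) x" by simp
  also have "\<dots> \<in> ?A" by (rule rangeI)
  finally show "poly f z \<in> ?A" .
qed

lemma preperiodic_iterate:
  assumes "preperiodic f x" shows "preperiodic f ((poly f ^^ k) x)"
proof -
  obtain i j where ij: "i \<noteq> j" "(poly f ^^ i) x = (poly f ^^ j) x"
    using assms unfolding preperiodic_def by blast
  have "(poly f ^^ l) ((poly f ^^ k) x) = (poly f ^^ k) ((poly f ^^ l) x)" for l
  proof -
    have "(poly f ^^ (l + k)) x = (poly f ^^ (k + l)) x" by (simp only: add.commute)
    then show ?thesis by (simp only: funpow_add comp_apply)
  qed
  then have "(poly f ^^ i) ((poly f ^^ k) x) = (poly f ^^ j) ((poly f ^^ k) x)"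
    using ij(2) by simp
  then show ?thesis unfolding preperiodic_def using ij(1) by blast
qed

lemma monic_poly_expand:
  fixes p :: "complex poly"
  assumes "lead_coeff p = 1"
  shows "poly p z = z ^ degree p + (\<Sum>i<degree p. coeff p i * z ^ i)"
proof -
  have "{..degree p} = insert (degree p) {..<degree p}" by auto
  then show ?thesis using assms by (simp add: poly_altdef)
qed

text \<open>At a point of largest modulus in the orbit, a modulus above the bound would let the
  leading term of \<open>f\<close> dominate and make the image larger still. The bound depends on
  \<open>f\<close> only, so it also holds for all iterates of \<open>x\<close>.\<close>

lemma preperiodic_norm_le:
  assumes f: "lead_coeff f = 1" "degree f \<ge> 2" and x: "preperiodic f x"
  shows "norm x \<le> 1 + (\<Sum>i<degree f. norm (coeff f i))"
proof -
  define S where "S = (\<Sum>i<degree f. norm (coeff f i))"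
  have S: "S \<ge> 0" by (simp add: S_def sum_nonneg)
  obtain A where A: "finite A" "x \<in> A" and closed: "\<And>z. z \<in> A \<Longrightarrow> poly f z \<in> A"
    using preperiodic_orbit[OF x] by blast
  define M where "M = Max (norm ` A)"
  have M: "norm z \<le> M" if "z \<in> A" for z using A that by (simp add: M_def)
  have "M \<in> norm ` A" unfolding M_def using A by (intro Max_in) auto
  then obtain z where z: "z \<in> A" "norm z = M" by auto
  obtain d where d: "degree f = Suc (Suc d)" using f(2) by (metis add_2_eq_Suc le_Suc_ex)
  have "M \<le> 1 + S"
  proof (rule ccontr)
    assume "\<not> M \<le> 1 + S"
    then have gt: "M > 1 + S" by simp
    then have M1: "M > 1" using S by simp
    have "z ^ degree f = poly f z - (\<Sum>i<degree f. coeff f i * z ^ i)"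
      using monic_poly_expand[OF f(1), of z] by simp
    then have "M ^ degree f = norm (poly f z - (\<Sum>i<degree f. coeff f i * z ^ i))"
      using z by (metis norm_power)
    also have "\<dots> \<le> norm (poly f z) + norm (\<Sum>i<degree f. coeff f i * z ^ i)" by (rule norm_triangle_ineq4)
    also have "\<dots> \<le> M ^ Suc d + (\<Sum>i<degree f. norm (coeff f i) * M ^ Suc d)"
    proof (intro add_mono sum_norm_le)
      have "norm (poly f z) \<le> M ^ 1" using M closed z by simp
      also have "\<dots> \<le> M ^ Suc d" using M1 by (intro power_increasing) auto
      finally show "norm (poly f z) \<le> M ^ Suc d" .
      fix i assume "i \<in> {..<degree f}"
      then have "M ^ i \<le> M ^ Suc d" using M1 by (intro power_increasing) (auto simp: d)
      then show "norm (coeff f i * z ^ i) \<le> norm (coeff f i) * M ^ Suc d"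
        by (simp only: norm_mult norm_power z(2) mult_left_mono norm_ge_zero)
    qed
    also have "\<dots> = (1 + S) * M ^ Suc d" by (simp only: S_def sum_distrib_right distrib_right mult_1)
    also have "\<dots> < M * M ^ Suc d" using gt M1 by (intro mult_strict_right_mono) auto
    finally show False by (simp add: d)
  qed
  then show ?thesis using M[OF A(2)] by (simp add: S_def)
qed

text \<open>The substitute for a point of largest absolute value: all other elements are multiples
  of \<open>z\<close> by elements of \<open>V\<close>.\<close>

lemma val_ring_dominant:
  assumes V: "val_ring V"
  shows "finite A \<Longrightarrow> A \<noteq> {} \<Longrightarrow> \<exists>z\<in>A. \<forall>w\<in>A. \<exists>v\<in>V. w = v * z"
proof (induction A rule: finite_ne_induct)
  case (singleton x)
  then show ?case using csubring_1[OF val_ring_imp_csubring[OF V]] by auto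
next
  case (insert x F)
  note R = val_ring_imp_csubring[OF V]
  obtain z where z: "z \<in> F" "\<And>w. w \<in> F \<Longrightarrow> \<exists>v\<in>V. w = v * z" using insert.IH by blast
  show ?case
  proof (cases "\<exists>v\<in>V. x = v * z")
    case True
    then have "\<forall>w\<in>insert x F. \<exists>v\<in>V. w = v * z" using z(2) by blast
    then show ?thesis by (rule bexI) (rule insertI2[OF z(1)])
  next
    case False
    then have x0: "x \<noteq> 0" using csubring_0[OF R] by auto
    have "x / z \<notin> V \<or> z = 0"
    proof (cases "z = 0")
      case z0: False
      have "x / z \<notin> V"
      proof
        assume "x / z \<in> V"
        moreover have "x = x / z * z" using z0 by simp
        ultimately have "\<exists>v\<in>V. x = v * z" by (rule bexI[rotated])
        then show False using False by (rule notE[rotated])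
      qed
      then show ?thesis ..
    qed simp
    moreover have "x / z \<in> V \<or> inverse (x / z) \<in> V" using V unfolding val_ring_def by blast
    ultimately have "inverse (x / z) \<in> V \<or> z = 0" by blast
    then have zx: "z / x \<in> V" using csubring_0[OF R] by auto
    have "\<exists>v\<in>V. w = v * x" if "w \<in> insert x F" for w
    proof (cases "w = x")
      case True
      then show ?thesis using csubring_1[OF R] by auto
    next
      case False
      then have "w \<in> F" using that by simp
      from z(2)[OF this] obtain v where v: "v \<in> V" "w = v * z" by (elim bexE)
      show ?thesis
      proof (rule bexI)
        show "w = v * (z / x) * x" using x0 v(2) by simp
        show "v * (z / x) \<in> V" by (rule csubring_mult[OF R v(1) zx])
      qed
    qed
    then have "\<forall>w\<in>insert x F. \<exists>v\<in>V. w = v * x" by (rule ballI)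
    then show ?thesis by (rule bexI) (rule insertI1)
  qed
qed

text \<open>If \<open>q * z\<close> is outside \<open>V\<close>, then \<open>inverse z\<close> is
  inside, and \<open>poly p z\<close> divided by \<open>z ^ n\<close> expresses \<open>q * z\<close>
  through elements of \<open>V\<close>. This is applied to \<open>f\<close> at a dominant point of
  an orbit and to \<open>a\<close> at a parameter.\<close>

lemma val_ring_monic_bound:
  assumes V: "val_ring V" and p: "lead_coeff p = 1" "degree p = Suc n" "\<And>i. q * coeff p i \<in> V"
    and z: "inverse z \<in> V \<Longrightarrow> q * poly p z * inverse z ^ n \<in> V"
  shows "q * z \<in> V"
proof (rule ccontr)
  assume no: "q * z \<notin> V"
  note R = val_ring_imp_csubring[OF V]
  have qV: "q \<in> V" using p(3)[of "Suc n"] p(1,2) by simp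
  have nz: "q * z \<noteq> 0" using no csubring_0[OF R] by auto
  have "q * inverse (q * z) \<in> V"
    using no V by (intro csubring_mult[OF R] qV) (auto simp: val_ring_def)
  then have iz: "inverse z \<in> V" using nz by (simp add: field_simps)
  have "q * poly p z * inverse z ^ n = q * z + (\<Sum>i<Suc n. q * coeff p i * inverse z ^ (n - i))"
  proof -
    have "poly p z * inverse z ^ n = z ^ Suc n * inverse z ^ n + (\<Sum>i<Suc n. coeff p i * (z ^ i * inverse z ^ n))"
      unfolding monic_poly_expand[OF p(1)] p(2) by (simp only: distrib_right sum_distrib_right mult.assoc)
    then have "q * poly p z * inverse z ^ n =
        q * (z ^ Suc n * inverse z ^ n) + (\<Sum>i<Suc n. q * (coeff p i * (z ^ i * inverse z ^ n)))"
      by (simp only: mult.assoc distrib_left sum_distrib_left)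
    also have "z ^ Suc n * inverse z ^ n = z" using nz by (simp add: field_simps)
    also have "(\<Sum>i<Suc n. q * (coeff p i * (z ^ i * inverse z ^ n))) =
        (\<Sum>i<Suc n. q * coeff p i * inverse z ^ (n - i))"
    proof (intro sum.cong refl)
      fix i assume "i \<in> {..<Suc n}"
      then have "inverse z ^ n = inverse z ^ (n - i) * inverse z ^ i" by (simp flip: power_add)
      then show "q * (coeff p i * (z ^ i * inverse z ^ n)) = q * coeff p i * inverse z ^ (n - i)"
        using nz by (simp add: power_inverse field_simps)
    qed
    finally show ?thesis .
  qed
  then have "q * z = q * poly p z * inverse z ^ n - (\<Sum>i<Suc n. q * coeff p i * inverse z ^ (n - i))"
    by simp
  also have "\<dots> \<in> V"
    by (intro csubring_diff[OF R] z iz csubring_sum[OF R] csubring_mult[OF R] p csubring_power[OF R])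
  finally show False using no by simp
qed

text \<open>The counterpart of \<open>preperiodic_norm_le\<close>: for a dominant point
  \<open>z\<close> of the orbit, \<open>poly f z\<close> is a multiple of \<open>z\<close> by an
  element of \<open>V\<close>.\<close>

lemma preperiodic_val_ring:
  assumes V: "val_ring V" and f: "lead_coeff f = 1" "degree f \<ge> 2" "\<And>i. q * coeff f i \<in> V"
    and x: "preperiodic f x"
  shows "q * x \<in> V"
proof -
  note R = val_ring_imp_csubring[OF V]
  obtain A where A: "finite A" "x \<in> A" and closed: "\<And>z. z \<in> A \<Longrightarrow> poly f z \<in> A"
    using preperiodic_orbit[OF x] by blast
  obtain z where z: "z \<in> A" "\<And>w. w \<in> A \<Longrightarrow> \<exists>v\<in>V. w = v * z"
    using val_ring_dominant[OF V A(1)] A(2) by blast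
  obtain d where d: "degree f = Suc (Suc d)" using f(2) by (metis add_2_eq_Suc le_Suc_ex)
  have qV: "q \<in> V" using f(3)[of "degree f"] f(1) by simp
  have "q * z \<in> V"
  proof (rule val_ring_monic_bound[OF V f(1) d f(3)])
    assume iz: "inverse z \<in> V"
    obtain v where v: "v \<in> V" "poly f z = v * z" using z(2)[OF closed[OF z(1)]] by blast
    have "q * poly f z * inverse z ^ Suc d = (if z = 0 then 0 else q * v * inverse z ^ d)"
      by (simp add: v)
    also have "\<dots> \<in> V"
      using csubring_0[OF R] csubring_mult[OF R] csubring_power[OF R] qV v iz by auto
    finally show "q * poly f z * inverse z ^ Suc d \<in> V" .
  qed
  moreover obtain v where v: "v \<in> V" "x = v * z" using z(2) A(2) by blast
  ultimately have "v * (q * z) \<in> V" using csubring_mult[OF R] by blast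
  then show ?thesis by (simp add: v mult_ac)
qed

section \<open>Differences of iterates\<close>

text \<open>\<open>u - v\<close> factors out of every difference of powers. The cofactor of the top
  power is a sum of \<open>n\<close> monic products of equal degree, so its leading coefficient
  \<open>n\<close> cannot vanish. Applied to iterates, this makes the leading coefficient grow while
  the values stay bounded.\<close>

lemma pcompose_diff_degree:
  fixes p u v :: "complex poly"
  assumes p: "lead_coeff p = 1" "degree p = n" "n > 0"
    and u: "lead_coeff u = 1" "degree u = D" and v: "lead_coeff v = 1" "degree v = D"
    and D: "D > 0" and ne: "u \<noteq> v"
  shows "degree (pcompose p u - pcompose p v) = D * (n - 1) + degree (u - v)"
    and "lead_coeff (pcompose p u - pcompose p v) = of_nat n * lead_coeff (u - v)"
proof -
  define w where "w = (\<lambda>i. \<Sum>l<i. v ^ (i - Suc l) * u ^ l)"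
  define W where "W = (\<Sum>i\<le>n. smult (coeff p i) (w i))"
  have comp: "pcompose p g = (\<Sum>i\<le>n. smult (coeff p i) (g ^ i))" for g
    using p(2) by (simp add: pcompose_altdef poly_altdef degree_map_poly coeff_map_poly)
  have "pcompose p u - pcompose p v = (\<Sum>i\<le>n. smult (coeff p i) (u ^ i - v ^ i))"
    unfolding comp by (simp add: sum_subtractf smult_diff_right)
  also have "\<dots> = (\<Sum>i\<le>n. (u - v) * smult (coeff p i) (w i))"
    by (intro sum.cong refl) (simp add: power_diff_sumr2 w_def)
  also have "\<dots> = (u - v) * W" by (simp add: W_def sum_distrib_left)
  finally have eq: "pcompose p u - pcompose p v = (u - v) * W" .
  have mon: "degree (v ^ (i - Suc l) * u ^ l) = D * (i - 1)" "lead_coeff (v ^ (i - Suc l) * u ^ l) = 1"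
    if "l < i" for i l
  proof -
    have "u \<noteq> 0" "v \<noteq> 0" using u v by auto
    then have "degree (v ^ (i - Suc l) * u ^ l) = (i - Suc l) * D + l * D"
      using u v by (simp add: degree_mult_eq degree_power_eq)
    also have "\<dots> = ((i - Suc l) + l) * D" by (simp add: distrib_right)
    also have "(i - Suc l) + l = i - 1" using that by simp
    finally show "degree (v ^ (i - Suc l) * u ^ l) = D * (i - 1)" by (simp add: mult.commute)
    show "lead_coeff (v ^ (i - Suc l) * u ^ l) = 1"
      using u v by (simp only: lead_coeff_mult lead_coeff_power) simp
  qed
  have dw: "degree (w i) \<le> D * (i - 1)" for i
    unfolding w_def by (intro degree_sum_le) (auto simp: mon)
  have degW: "degree W \<le> D * (n - 1)"
    unfolding W_def
  proof (intro degree_sum_le)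
    fix i assume "i \<in> {..n}"
    then have "D * (i - 1) \<le> D * (n - 1)" by auto
    then show "degree (smult (coeff p i) (w i)) \<le> D * (n - 1)"
      using dw[of i] degree_smult_le[of "coeff p i" "w i"] by linarith
  qed simp
  have "coeff W (D * (n - 1)) = (\<Sum>i\<le>n. if i = n then of_nat n else 0)"
    unfolding W_def coeff_sum coeff_smult
  proof (intro sum.cong refl)
    fix i assume i: "i \<in> {..n}"
    show "coeff p i * coeff (w i) (D * (n - 1)) = (if i = n then of_nat n else 0)"
    proof (cases "i = n")
      case True
      have "coeff (w n) (D * (n - 1)) = (\<Sum>l<n. 1)"
        unfolding w_def coeff_sum by (intro sum.cong refl) (metis lessThan_iff mon)
      then show ?thesis using True p by simp
    next
      case False
      show ?thesis
      proof (cases "i = 0")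
        case True
        then show ?thesis using False by (simp add: w_def)
      next
        case i0: False
        have "D * (i - 1) < D * (n - 1)" using i i0 False D by auto
        then have "coeff (w i) (D * (n - 1)) = 0" using dw[of i] by (intro coeff_eq_0) linarith
        then show ?thesis using False by simp
      qed
    qed
  qed
  then have cW: "coeff W (D * (n - 1)) = of_nat n" by simp
  then have "degree W = D * (n - 1)"
    using degW p(3) by (intro antisym le_degree) auto
  moreover from this have lW: "lead_coeff W = of_nat n" using cW by simp
  moreover have "W \<noteq> 0" using lW p(3) by auto
  ultimately show "degree (pcompose p u - pcompose p v) = D * (n - 1) + degree (u - v)"
    "lead_coeff (pcompose p u - pcompose p v) = of_nat n * lead_coeff (u - v)"
    unfolding eq lead_coeff_mult using ne by (auto simp: degree_mult_eq)
qed

definition iterate_poly :: "complex poly \<Rightarrow> nat \<Rightarrow> complex poly" where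
  "iterate_poly f k = ((\<lambda>p. pcompose f p) ^^ k) [:0, 1:]"

lemma poly_iterate_poly: "poly (iterate_poly f k) x = (poly f ^^ k) x"
  by (induction k) (auto simp: iterate_poly_def poly_pcompose)

lemma degree_iterate_poly: "degree (iterate_poly f k) = degree f ^ k"
  by (induction k) (auto simp: iterate_poly_def degree_pcompose)

lemma lead_coeff_iterate_poly:
  assumes "lead_coeff f = 1" "degree f > 0" shows "lead_coeff (iterate_poly f k) = 1"
proof (induction k)
  case (Suc k)
  have "degree (iterate_poly f k) > 0" using assms by (simp add: degree_iterate_poly)
  then show ?case using Suc assms lead_coeff_comp[of "iterate_poly f k" f] by (simp add: iterate_poly_def)
qed (simp add: iterate_poly_def)

lemma iterate_poly_over:
  assumes R: "csubring R" and f: "f \<in> polys_over R" shows "iterate_poly f k \<in> polys_over R"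
  by (induction k)
    (auto simp: iterate_poly_def intro: polys_over_pcompose[OF R f] polys_over_pCons[OF R]
      polys_over_const[OF R] csubring_0[OF R] csubring_1[OF R] polys_over_0[OF R])

lemma map_embedding_iterate_poly:
  assumes K: "csubfield K" and s: "embedding K s" and f: "f \<in> polys_over K"
  shows "map_poly s (iterate_poly f k) = iterate_poly (map_poly s f) k"
proof (induction k)
  case 0
  then show ?case by (simp add: iterate_poly_def map_poly_pCons embedding_0[OF K s] embedding_1[OF K s])
next
  case (Suc k)
  then show ?case
    using map_embedding_pcompose[OF K s f iterate_poly_over[OF csubfield_imp_csubring[OF K] f, of k]]
    by (simp add: iterate_poly_def)
qed

section \<open>The arithmetic and analytic estimates\<close>

lemma sum_div_lower:
  fixes n N :: nat
  assumes "n > 0"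
  shows "real (\<Sum>j<N. j div n) \<ge> real N * (real N - 1) / (2 * real n) - real N"
proof (induction N)
  case (Suc N)
  have "real N < real n * (real (N div n) + 1)"
  proof -
    have "N < n * Suc (N div n)" using dividend_less_times_div[OF assms, of N] by simp
    then have "real N < real (n * Suc (N div n))" by (simp only: of_nat_less_iff)
    then show ?thesis by (simp add: algebra_simps)
  qed
  then have "real N / real n - 1 \<le> real (N div n)" using assms by (simp add: field_simps)
  moreover have "real (Suc N) * (real (Suc N) - 1) / (2 * real n) - real (Suc N) =
      (real N * (real N - 1) / (2 * real n) - real N) + (real N / real n - 1)"
    using assms by (simp add: field_simps)
  ultimately show ?case using Suc by simp
qed simp

text \<open>The point is the quadratic coefficient \<open>1 / n\<close>; the remainders contribute
  only linearly in \<open>N\<close>.\<close>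

lemma sum_div_mod_upper:
  fixes n N :: nat
  assumes "n > 0"
  shows "real (\<Sum>j<N. j div n + j mod n) \<le> (real N)\<^sup>2 / real n + real N * real n"
proof -
  have "real (j div n + j mod n) \<le> real N / real n + real n" if "j < N" for j
  proof -
    have "real (j div n) \<le> real j / real n" by (rule of_nat_div_le_of_nat)
    also have "\<dots> \<le> real N / real n" using that assms by (intro divide_right_mono) auto
    finally have "real (j div n) \<le> real N / real n" .
    moreover have "real (j mod n) \<le> real n" using assms by (simp add: less_imp_le)
    ultimately show ?thesis by simp
  qed
  then have "(\<Sum>j<N. real (j div n + j mod n)) \<le> (\<Sum>j<N. real N / real n + real n)"
    by (intro sum_mono) auto
  also have "\<dots> = (real N)\<^sup>2 / real n + real N * real n" by (simp add: power2_eq_square algebra_simps)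
  finally show ?thesis by simp
qed

lemma ln_fact_le: "ln (fact N :: real) \<le> real N * ln (real N + 1)"
proof -
  have "(fact N :: real) \<le> real N ^ N" using fact_le_power[of N, where 'a = real] by simp
  also have "\<dots> \<le> (real N + 1) ^ N" by (intro power_mono) auto
  finally have "ln (fact N :: real) \<le> ln ((real N + 1) ^ N)" by (subst ln_le_cancel_iff) auto
  then show ?thesis by (simp add: ln_realpow)
qed

text \<open>The logarithm of the factorial is of order \<open>N ln N\<close>, which is negligible
  against a quadratic exponent.\<close>

lemma eventually_fact_le:
  fixes n :: nat
  assumes n: "n > 0"
  shows "eventually (\<lambda>N. (fact N :: real)\<^sup>2 \<le> 2 ^ (2 * (\<Sum>j<N. j div n + j mod n))) sequentially"
proof -
  have "eventually (\<lambda>N::nat. real N * ln (real N + 1) \<le>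
      (real N * (real N - 1) / (2 * real n) - real N) * ln 2) sequentially"
    using n by real_asymp
  then show ?thesis
  proof eventually_elim
    case (elim N)
    let ?h = "\<Sum>j<N. j div n + j mod n"
    have "ln ((fact N :: real)\<^sup>2) = 2 * ln (fact N)" by (simp add: ln_realpow)
    also have "\<dots> \<le> 2 * ((real N * (real N - 1) / (2 * real n) - real N) * ln 2)"
      using ln_fact_le[of N] elim by simp
    also have "\<dots> \<le> 2 * (real ?h * ln 2)"
    proof (intro mult_left_mono mult_right_mono)
      have "(\<Sum>j<N. j div n) \<le> ?h" by (intro sum_mono) auto
      then have "real (\<Sum>j<N. j div n) \<le> real ?h" by (simp only: of_nat_le_iff)
      then show "real N * (real N - 1) / (2 * real n) - real N \<le> real ?h"
        using sum_div_lower[OF n, of N] by linarith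
    qed auto
    also have "\<dots> = ln (2 ^ (2 * ?h))" by (simp add: ln_realpow del: of_nat_sum)
    finally show ?case by (subst (asm) ln_le_cancel_iff) auto
  qed
qed

text \<open>The hypothesis \<open>le\<close> makes the quadratic coefficient on the left at most
  \<open>C1 / 8\<close>, a quarter of the \<open>C1 / 2\<close> on the right; all other terms are of
  lower order in \<open>N\<close>.\<close>

lemma eventually_estimate:
  fixes n m :: nat and c R :: real
  assumes n: "n > 0" and m: "m > 0" and c: "c \<ge> 1" and R: "R \<ge> 1" and le: "16 * real m * ln c \<le> real n * ln 4"
  shows "eventually (\<lambda>N. c ^ (2 * (\<Sum>j<N. j div n + j mod n)) * (fact N)\<^sup>2 * R ^ (2 * N * m) <
    4 ^ (\<Sum>j<N. j div m)) sequentially"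
proof -
  define C1 C2 where "C1 = ln 4 / real m" and "C2 = 2 * real n * ln c + 2 * real m * ln R"
  have "C1 > 0" using m by (simp add: C1_def)
  then have "eventually (\<lambda>N::nat. C1 / 8 * (real N)\<^sup>2 + C2 * real N + 2 * (real N * ln (real N + 1)) <
      C1 / 2 * (real N * (real N - 1)) - real N * ln 4) sequentially"
    by real_asymp
  then show ?thesis
  proof eventually_elim
    case (elim N)
    let ?h = "\<Sum>j<N. j div n + j mod n"
    let ?L = "c ^ (2 * ?h) * (fact N)\<^sup>2 * R ^ (2 * N * m)"
    have pos: "?L > 0" using c R by simp
    have "ln ?L = ln (c ^ (2 * ?h)) + ln ((fact N)\<^sup>2) + ln (R ^ (2 * N * m))"
      using c R by (simp add: ln_mult del: of_nat_sum)
    also have "\<dots> = 2 * (real ?h * ln c) + 2 * ln (fact N) + 2 * real N * real m * ln R"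
      using c R by (simp add: ln_realpow del: of_nat_sum)
    also have "\<dots> \<le> 2 * (((real N)\<^sup>2 / real n + real N * real n) * ln c) +
        2 * (real N * ln (real N + 1)) + 2 * real N * real m * ln R"
      using sum_div_mod_upper[OF n, of N] ln_fact_le[of N] c
      by (intro add_mono mult_left_mono mult_right_mono) auto
    also have "\<dots> = (real N)\<^sup>2 * (2 * ln c / real n) + C2 * real N + 2 * (real N * ln (real N + 1))"
      by (simp add: C2_def algebra_simps)
    also have "\<dots> \<le> (real N)\<^sup>2 * (C1 / 8) + C2 * real N + 2 * (real N * ln (real N + 1))"
    proof -
      have "2 * ln c / real n \<le> C1 / 8" using le n m by (simp add: C1_def field_simps)
      then have "(real N)\<^sup>2 * (2 * ln c / real n) \<le> (real N)\<^sup>2 * (C1 / 8)" by (intro mult_left_mono) auto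
      then show ?thesis by linarith
    qed
    also have "\<dots> < C1 / 2 * (real N * (real N - 1)) - real N * ln 4" using elim by (simp add: mult.commute)
    also have "\<dots> = (real N * (real N - 1) / (2 * real m) - real N) * ln 4"
      by (simp add: C1_def algebra_simps)
    also have "\<dots> \<le> real (\<Sum>j<N. j div m) * ln 4"
      using sum_div_lower[OF m, of N] by (intro mult_right_mono) auto
    also have "\<dots> = ln (4 ^ (\<Sum>j<N. j div m))" by (simp add: ln_realpow del: of_nat_sum)
    finally show ?case using pos by (subst (asm) ln_less_cancel_iff) auto
  qed
qed

section \<open>Parameter sets stable under conjugation\<close>

text \<open>At a root \<open>x\<close> the derivative is the product of \<open>x - y\<close> over
  the other roots. Thus the product bounded by Fekete's estimate is a resultant, on which embeddings
  act.\<close>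

lemma rsquarefree_diff_prod:
  fixes g :: "complex poly"
  assumes g: "rsquarefree g" "lead_coeff g = 1"
  defines "L \<equiv> {x. poly g x = 0}"
  shows "finite L" "card L = degree g" "root_prod g (pderiv g) = diff_prod L"
proof -
  have g0: "g \<noteq> 0" using g by auto
  show fin: "finite L" unfolding L_def by (rule poly_roots_finite[OF g0])
  have gp: "g = (\<Prod>z\<in>L. [:-z, 1:])"
    using complex_poly_decompose_rsquarefree[OF g(1)] g(2) by (simp add: L_def)
  show "card L = degree g" by (subst gp) (simp add: coeff_prod_linear(1)[OF fin])
  have "proots g = mset_set L"
  proof (rule multiset_eqI)
    fix x
    show "count (proots g) x = count (mset_set L) x"
    proof (cases "poly g x = 0")
      case True
      then show ?thesis using g0 fin rsquarefree_root_order[OF g(1) True g0] by (simp add: L_def)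
    next
      case False
      then show ?thesis using g0 fin order_0I[OF False] by (simp add: L_def)
    qed
  qed
  then have "root_prod g (pderiv g) = (\<Prod>x\<in>L. poly (pderiv g) x)"
    by (simp add: root_prod_def prod_unfold_prod_mset)
  also have "\<dots> = diff_prod L"
    unfolding diff_prod_def
  proof (intro prod.cong refl)
    fix x assume x: "x \<in> L"
    have "poly (pderiv g) x = (\<Sum>b\<in>L. \<Prod>y\<in>L-{b}. (x - y))"
      by (subst gp) (simp add: pderiv_prod poly_sum poly_prod pderiv_pCons)
    also have "\<dots> = (\<Sum>b\<in>L. if b = x then \<Prod>y\<in>L-{x}. (x - y) else 0)"
      using x fin by (intro sum.cong refl) (auto intro!: prod_zero)
    finally show "poly (pderiv g) x = (\<Prod>y\<in>L-{x}. (x - y))" using x fin by simp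
  qed
  finally show "root_prod g (pderiv g) = diff_prod L" .
qed

text \<open>The equation between the iterates \<open>i\<close> and \<open>j\<close> at
  \<open>a\<close> has coefficients in \<open>K\<close>, so it transfers to all conjugate
  parameters. It is nontrivial because the two iterates have different degrees.\<close>

lemma preperiodic_poly_exists:
  assumes K: "csubfield K" and f: "f \<in> polys_over K" "degree f \<ge> 2"
    and a: "a \<in> polys_over K" "degree a > 0" and l: "preperiodic f (poly a l)"
  obtains p where "p \<in> polys_over K" "p \<noteq> 0" "poly p l = 0"
    "\<And>s y. embedding K s \<Longrightarrow> poly (map_poly s p) y = 0 \<Longrightarrow>
      preperiodic (map_poly s f) (poly (map_poly s a) y)"
proof -
  note R = csubfield_imp_csubring[OF K]
  obtain i j where ij: "i < j" "(poly f ^^ i) (poly a l) = (poly f ^^ j) (poly a l)"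
    using l unfolding preperiodic_def by (metis linorder_neqE_nat)
  define h where "h = (\<lambda>k. pcompose (iterate_poly f k) a)"
  define p where "p = h j - h i"
  have h: "h k \<in> polys_over K" for k
    unfolding h_def by (intro polys_over_pcompose[OF R] iterate_poly_over[OF R] f a)
  have "degree (h k) = degree f ^ k * degree a" for k
    by (simp add: h_def degree_pcompose degree_iterate_poly)
  moreover have "degree f ^ i < degree f ^ j" using f ij by (intro power_strict_increasing) auto
  ultimately have "degree (h i) < degree (h j)" using a by simp
  then have "p \<noteq> 0" unfolding p_def by auto
  moreover have "p \<in> polys_over K" unfolding p_def by (intro polys_over_diff[OF R] h)
  moreover have "poly p l = 0" using ij(2) by (simp add: p_def h_def poly_pcompose poly_iterate_poly)
  moreover have "preperiodic (map_poly s f) (poly (map_poly s a) y)"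
    if s: "embedding K s" and y: "poly (map_poly s p) y = 0" for s y
  proof -
    have "map_poly s (h k) = pcompose (iterate_poly (map_poly s f) k) (map_poly s a)" for k
      unfolding h_def
      by (simp add: map_embedding_pcompose[OF K s iterate_poly_over[OF R f(1)] a(1)]
          map_embedding_iterate_poly[OF K s f(1)])
    then have "(poly (map_poly s f) ^^ j) (poly (map_poly s a) y) = (poly (map_poly s f) ^^ i) (poly (map_poly s a) y)"
      using y by (simp add: p_def map_embedding_diff[OF K s h h] poly_pcompose poly_iterate_poly)
    then show ?thesis unfolding preperiodic_def using ij(1) by (intro exI[of _ j] exI[of _ i]) auto
  qed
  ultimately show thesis using that by blast
qed

lemma common_preperiodic_poly:
  assumes K: "csubfield K" and f: "f \<in> polys_over K" "degree f \<ge> 2"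
    and a: "a \<in> polys_over K" "degree a > 0"
    and F: "finite F" "\<And>l. l \<in> F \<Longrightarrow> preperiodic f (poly a l)"
  obtains p where "p \<in> polys_over K" "p \<noteq> 0" "\<And>l. l \<in> F \<Longrightarrow> poly p l = 0"
    "\<And>s y. embedding K s \<Longrightarrow> poly (map_poly s p) y = 0 \<Longrightarrow>
      preperiodic (map_poly s f) (poly (map_poly s a) y)"
proof -
  note R = csubfield_imp_csubring[OF K]
  have "\<forall>l\<in>F. \<exists>p. p \<in> polys_over K \<and> p \<noteq> 0 \<and> poly p l = 0 \<and>
    (\<forall>s y. embedding K s \<longrightarrow> poly (map_poly s p) y = 0 \<longrightarrow>
      preperiodic (map_poly s f) (poly (map_poly s a) y))"
  proof
    fix l assume "l \<in> F"
    from preperiodic_poly_exists[OF K f a F(2)[OF this]]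
    show "\<exists>p. p \<in> polys_over K \<and> p \<noteq> 0 \<and> poly p l = 0 \<and>
      (\<forall>s y. embedding K s \<longrightarrow> poly (map_poly s p) y = 0 \<longrightarrow>
        preperiodic (map_poly s f) (poly (map_poly s a) y))" by metis
  qed
  then obtain g where g: "\<And>l. l \<in> F \<Longrightarrow> g l \<in> polys_over K" "\<And>l. l \<in> F \<Longrightarrow> g l \<noteq> 0"
    "\<And>l. l \<in> F \<Longrightarrow> poly (g l) l = 0"
    "\<And>l s y. l \<in> F \<Longrightarrow> embedding K s \<Longrightarrow> poly (map_poly s (g l)) y = 0 \<Longrightarrow>
      preperiodic (map_poly s f) (poly (map_poly s a) y)"
    unfolding bchoice_iff by blast
  show thesis
  proof (rule that[of "\<Prod>l\<in>F. g l"])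
    show "(\<Prod>l\<in>F. g l) \<in> polys_over K" by (intro polys_over_prod[OF R] g)
    show "(\<Prod>l\<in>F. g l) \<noteq> 0" using F(1) g(2) by auto
    show "poly (\<Prod>l\<in>F. g l) l = 0" if "l \<in> F" for l
      unfolding poly_prod using F(1) that g(3) by (intro prod_zero) auto
    show "preperiodic (map_poly s f) (poly (map_poly s a) y)"
      if s: "embedding K s" and y: "poly (map_poly s (\<Prod>l\<in>F. g l)) y = 0" for s y
    proof -
      have "(\<Prod>l\<in>F. poly (map_poly s (g l)) y) = 0"
        using y g(1) by (simp add: map_embedding_prod[OF K s] poly_prod)
      then obtain l where "l \<in> F" "poly (map_poly s (g l)) y = 0" using F(1) by (auto simp: prod_zero_iff)
      then show ?thesis using g(4) s by blast
    qed
  qed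
qed

text \<open>The minimal polynomial of \<open>n\<close> common parameters divides the relations found
  for \<open>a\<close> and for \<open>b\<close>, so all roots of its images are again common. Its
  discriminant is nonzero and remains so under embeddings, which keeps the roots distinct.\<close>

lemma galois_stable_preperiodic_set:
  assumes K: "csubfield K" and f: "f \<in> polys_over K" "degree f \<ge> 2"
    and a: "a \<in> polys_over K" "degree a > 0" and b: "b \<in> polys_over K" "degree b > 0"
    and inf: "infinite {l. preperiodic f (poly a l) \<and> preperiodic f (poly b l)}"
  obtains g where "g \<in> polys_over K" "lead_coeff g = 1" "degree g \<ge> n"
    "\<And>s. embedding K s \<Longrightarrow> rsquarefree (map_poly s g)"
    "\<And>s y. embedding K s \<Longrightarrow> poly (map_poly s g) y = 0 \<Longrightarrow>
      preperiodic (map_poly s f) (poly (map_poly s a) y) \<and> preperiodic (map_poly s f) (poly (map_poly s b) y)"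
proof -
  note R = csubfield_imp_csubring[OF K]
  obtain F where F: "F \<subseteq> {l. preperiodic f (poly a l) \<and> preperiodic f (poly b l)}" "finite F" "card F = n"
    using infinite_arbitrarily_large[OF inf] by blast
  obtain p where p: "p \<in> polys_over K" "p \<noteq> 0" "\<And>l. l \<in> F \<Longrightarrow> poly p l = 0"
    "\<And>s y. embedding K s \<Longrightarrow> poly (map_poly s p) y = 0 \<Longrightarrow>
      preperiodic (map_poly s f) (poly (map_poly s a) y)"
    using common_preperiodic_poly[OF K f a F(2)] F(1) by blast
  obtain q where q: "q \<in> polys_over K" "q \<noteq> 0" "\<And>l. l \<in> F \<Longrightarrow> poly q l = 0"
    "\<And>s y. embedding K s \<Longrightarrow> poly (map_poly s q) y = 0 \<Longrightarrow>
      preperiodic (map_poly s f) (poly (map_poly s b) y)"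
    using common_preperiodic_poly[OF K f b F(2)] F(1) by blast
  obtain g where g: "minimal_poly_of K F g"
    using minimal_poly_exists[OF K p(1,2,3)] by blast
  note gK = minimal_poly_ofD(1)[OF g] and g1 = minimal_poly_ofD(2)[OF g] and g0 = minimal_poly_ofD(3)[OF g]
  have sq: "rsquarefree g" by (rule minimal_poly_rsquarefree[OF K g])
  obtain u where u: "u \<in> polys_over K" "p = g * u" using minimal_poly_of_dvdE[OF K g p(1,3)] by blast
  obtain v where v: "v \<in> polys_over K" "q = g * v" using minimal_poly_of_dvdE[OF K g q(1,3)] by blast
  have "F \<subseteq> {x. poly g x = 0}" using minimal_poly_ofD(4)[OF g] by blast
  then have "card F \<le> card {x. poly g x = 0}"
    by (rule card_mono[OF poly_roots_finite[OF g0]])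
  then have deg: "degree g \<ge> n" using rsquarefree_diff_prod(2)[OF sq g1] F(3) by simp
  have disc: "root_prod g (pderiv g) \<noteq> 0"
    using sq g0 by (auto simp: root_prod_def rsquarefree_roots)
  have "rsquarefree (map_poly s g)" if s: "embedding K s" for s
  proof -
    have "s (root_prod g (pderiv g)) \<noteq> 0"
      using disc root_prod_embedding[OF K gK polys_over_pderiv[OF R gK] g0] by (simp add: embedding_eq_0_iff[OF K s])
    moreover have "s (root_prod g (pderiv g)) = root_prod (map_poly s g) (map_poly s (pderiv g))"
      using root_prod_embedding[OF K gK polys_over_pderiv[OF R gK] g0] s by blast
    ultimately have "root_prod (map_poly s g) (pderiv (map_poly s g)) \<noteq> 0"
      by (simp add: map_embedding_pderiv[OF K s gK])
    then show ?thesis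
      using map_embedding_eq_0_iff[OF K s gK] g0 by (auto simp: root_prod_def rsquarefree_roots)
  qed
  moreover have "preperiodic (map_poly s f) (poly (map_poly s a) y) \<and> preperiodic (map_poly s f) (poly (map_poly s b) y)"
    if s: "embedding K s" and y: "poly (map_poly s g) y = 0" for s y
  proof -
    have "poly (map_poly s p) y = 0" "poly (map_poly s q) y = 0"
      using y u v gK by (simp_all add: map_embedding_mult[OF K s])
    then show ?thesis using p(4)[OF s] q(4)[OF s] by blast
  qed
  ultimately show thesis using that[OF gK g1 deg] by blast
qed

section \<open>The monic case\<close>

text \<open>Fekete's estimate needs a monic polynomial in every degree; powers of the favourable
  \<open>T\<close> are filled up with monomials of degree below \<open>m\<close>.\<close>

lemma monic_div_mod_basis:
  fixes T :: "complex poly"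
  assumes "lead_coeff T = 1" "degree T = m" "m > 0"
  shows "degree (T ^ (j div m) * monom 1 (j mod m)) = j" "lead_coeff (T ^ (j div m) * monom 1 (j mod m)) = 1"
proof -
  have T0: "T \<noteq> 0" using assms by auto
  have "degree (T ^ (j div m) * monom 1 (j mod m)) = j div m * m + j mod m"
    using T0 assms by (simp add: degree_mult_eq degree_power_eq degree_monom_eq)
  then show "degree (T ^ (j div m) * monom 1 (j mod m)) = j" by simp
  show "lead_coeff (T ^ (j div m) * monom 1 (j mod m)) = 1"
    using assms by (simp only: lead_coeff_mult lead_coeff_power lead_coeff_monom) simp
qed

text \<open>Cauchy's bound for \<open>p\<close> minus the constant \<open>poly p y\<close>. It
  passes from a bound for the value of \<open>a\<close> to one for the parameter.\<close>

lemma monic_preimage_bound: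
  fixes p :: "complex poly"
  assumes p: "lead_coeff p = 1" "degree p > 0"
  shows "norm y \<le> 1 + (\<Sum>i<degree p. norm (coeff p i)) + norm (poly p y)"
proof -
  define x where "x = poly p y"
  define p' where "p' = p - [:x:]"
  have deg: "degree p' = degree p"
    unfolding p'_def diff_conv_add_uminus using p(2) by (subst degree_add_eq_left) auto
  have c: "coeff p' i = (if i = 0 then coeff p 0 - x else coeff p i)" for i
    by (simp add: p'_def coeff_pCons split: nat.split)
  have "lead_coeff p' = 1" using p by (simp add: deg c)
  moreover have "poly p' y = 0" by (simp add: p'_def x_def)
  ultimately have "norm y \<le> 1 + (\<Sum>i<degree p. norm (coeff p' i))"
    using monic_root_bound[of p' y] by (simp add: deg)
  also have "(\<Sum>i<degree p. norm (coeff p' i)) \<le>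
      (\<Sum>i<degree p. norm (coeff p i) + (if i = 0 then norm x else 0))"
    by (intro sum_mono) (auto simp: c norm_triangle_ineq4)
  also have "\<dots> = (\<Sum>i<degree p. norm (coeff p i)) + norm x"
    using p(2) by (simp add: sum.distrib)
  finally show ?thesis by (simp add: x_def)
qed

lemma polys_over_if_coeffs:
  assumes "csubring R" "coeff p ` {..degree p} \<subseteq> R" shows "p \<in> polys_over R"
  unfolding polys_over_def
proof (safe)
  fix i show "coeff p i \<in> R"
    using assms csubring_0[OF assms(1)] coeff_eq_0[of p i] by (cases "i \<le> degree p") auto
qed

lemma real_le_power_of_degree: "d \<ge> 2 \<Longrightarrow> real k \<le> real (d ^ k)" for d k :: nat
proof -
  assume "d \<ge> 2"
  then have "k < d ^ k" by (intro power_gt_expt) auto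
  then show ?thesis by (simp only: of_nat_le_iff less_imp_le)
qed

lemma corollary_monic:
  fixes f a b :: "complex poly"
  assumes f: "lead_coeff f = 1" "degree f \<ge> 2"
    and a: "lead_coeff a = 1" "degree a = D" and b: "lead_coeff b = 1" "degree b = D" and D: "D > 0"
    and inf: "infinite {l. preperiodic f (poly a l) \<and> preperiodic f (poly b l)}"
  shows "a = b"
proof (rule ccontr)
  assume ne: "a \<noteq> b"
  define d where "d = degree f"
  have d: "d \<ge> 2" using f by (simp add: d_def)
  obtain K X where good: "good_pair K X"
    and C: "coeff f ` {..degree f} \<union> coeff a ` {..degree a} \<union> coeff b ` {..degree b} \<subseteq> K"
    using good_pair_exists[of "coeff f ` {..degree f} \<union> coeff a ` {..degree a} \<union> coeff b ` {..degree b}"] by auto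
  note K = good_pairD(1)[OF good] and fX = good_pairD(3)[OF good]
    and XK = good_pairD(4)[OF good] and fr = good_pairD(5)[OF good]
  note R = csubfield_imp_csubring[OF K]
  have fK: "f \<in> polys_over K" and aK: "a \<in> polys_over K" and bK: "b \<in> polys_over K"
    using C by (auto intro!: polys_over_if_coeffs[OF R])
  obtain q1 where q1: "q1 \<in> ring_gen X" "q1 \<noteq> 0" "smult q1 f \<in> polys_over (ring_gen X)"
    using poly_common_denominator[OF K fr fK] by blast
  obtain q2 where q2: "q2 \<in> ring_gen X" "q2 \<noteq> 0" "smult q2 a \<in> polys_over (ring_gen X)"
    using poly_common_denominator[OF K fr aK] by blast
  \<comment> \<open>A common denominator for \<open>f\<close> and \<open>a\<close>; it then clears
    the parameters and the points of their orbits in every valuation ring containing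
    \<open>X\<close>.\<close>
  define q where "q = q1 * q2"
  note G = csubring_ring_gen[of X]
  have q: "q \<in> ring_gen X" "q \<noteq> 0" using q1 q2 csubring_mult[OF G] by (auto simp: q_def)
  have qK: "q \<in> K" using q ring_gen_subset[OF K XK] by blast
  have qf: "q * coeff f i \<in> ring_gen X" for i
    using csubring_mult[OF G q2(1) polys_over_coeff[OF q1(3), of i]] by (simp add: q_def mult_ac)
  have qa: "q * coeff a i \<in> ring_gen X" for i
    using csubring_mult[OF G q1(1) polys_over_coeff[OF q2(3), of i]] by (simp add: q_def mult_ac)
  \<comment> \<open>\<open>cf s\<close> bounds the preperiodic points of the image of
    \<open>f\<close>; \<open>ca s\<close> also bounds the parameters.\<close>
  define cf :: "(complex \<Rightarrow> complex) \<Rightarrow> real" where "cf = (\<lambda>s. 1 + (\<Sum>i<d. norm (s (coeff f i))))"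
  define ca :: "(complex \<Rightarrow> complex) \<Rightarrow> real" where "ca = (\<lambda>s. 1 + (\<Sum>i<D. norm (s (coeff a i))) + cf s)"
  have ca1: "1 \<le> ca s" "cf s \<le> ca s" for s by (auto simp: ca_def cf_def intro!: add_nonneg_nonneg sum_nonneg)
  have lc1: "lead_coeff (map_poly s p) = 1" if "embedding K s" "p \<in> polys_over K" "lead_coeff p = 1" for s p
    using lead_coeff_map_embedding[OF K that(1,2)] that(3) embedding_1[OF K that(1)] by simp
  have iter_le: "norm ((poly (map_poly s f) ^^ k) x) \<le> ca s"
    if s: "embedding K s" and x: "preperiodic (map_poly s f) x" for s k x
  proof -
    have "norm ((poly (map_poly s f) ^^ k) x) \<le> 1 + (\<Sum>i<degree (map_poly s f). norm (coeff (map_poly s f) i))"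
      by (rule preperiodic_norm_le[OF lc1[OF s fK f(1)] _ preperiodic_iterate[OF x]])
        (simp add: degree_map_embedding[OF K s fK] f)
    then show ?thesis
      using ca1(2)[of s] by (simp add: cf_def d_def degree_map_embedding[OF K s fK] coeff_map_embedding[OF K s])
  qed
  have l_le: "norm l \<le> ca s"
    if s: "embedding K s" and x: "preperiodic (map_poly s f) (poly (map_poly s a) l)" for s l
  proof -
    have "norm l \<le> 1 + (\<Sum>i<degree (map_poly s a). norm (coeff (map_poly s a) i)) + norm (poly (map_poly s a) l)"
      by (rule monic_preimage_bound[OF lc1[OF s aK a(1)]]) (simp add: degree_map_embedding[OF K s aK] a D)
    moreover have "norm (poly (map_poly s a) l) \<le> cf s"
      using preperiodic_norm_le[OF lc1[OF s fK f(1)] _ x] f(2)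
      by (simp add: cf_def d_def degree_map_embedding[OF K s fK] coeff_map_embedding[OF K s])
    ultimately show ?thesis
      by (simp add: ca_def degree_map_embedding[OF K s aK] coeff_map_embedding[OF K s] a)
  qed
  have "poly_bounded K X (\<lambda>s. norm (s q) * ca s)"
  proof (rule poly_bounded_mono)
    show "poly_bounded K X (\<lambda>s. norm (s q) + (\<Sum>i<D. norm (s (q * coeff a i))) +
        (norm (s q) + (\<Sum>i<d. norm (s (q * coeff f i)))))"
      by (intro poly_bounded_add poly_bounded_sum poly_bounded_ring_gen[OF K fX XK] q qa qf)
    fix s assume s: "embedding K s"
    show "norm (s q) * ca s \<le> norm (s q) + (\<Sum>i<D. norm (s (q * coeff a i))) +
        (norm (s q) + (\<Sum>i<d. norm (s (q * coeff f i))))"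
      using polys_over_coeff[OF aK] polys_over_coeff[OF fK] qK
      by (simp add: ca_def cf_def embedding_mult[OF K s] norm_mult distrib_left sum_distrib_left)
  qed
  then obtain B1 k1 where B1: "B1 \<ge> 1" "\<And>s. embedding K s \<Longrightarrow> norm (s q) * ca s \<le> (B1 * emb_size s X) ^ k1"
    unfolding poly_bounded_def by blast
  \<comment> \<open>Being at least 1, the exponent \<open>kap\<close> lets \<open>2 ^ kap\<close>
    absorb the factor 2 that \<open>est1\<close> leaves in place of the factorial.\<close>
  define kap where "kap = Suc k1"
  define E :: "(complex \<Rightarrow> complex) \<Rightarrow> real" where "E = (\<lambda>s. (B1 * emb_size s X) ^ kap)"
  have Bs: "1 \<le> B1 * emb_size s X" for s
    using B1(1) emb_size_ge_1[of s X] mult_mono[of 1 B1 1 "emb_size s X"] by simp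
  have E: "norm (s q) * ca s \<le> E s" if "embedding K s" for s
  proof -
    have "(B1 * emb_size s X) ^ k1 \<le> E s"
      unfolding E_def kap_def using Bs[of s] by (intro power_increasing) auto
    then show ?thesis using B1(2)[OF that] by linarith
  qed
  have E1: "1 \<le> E s" for s unfolding E_def using Bs[of s] by (rule one_le_power)

  define al e where "al = lead_coeff (a - b)" and "e = degree (a - b)"
  have al: "al \<noteq> 0" unfolding al_def leading_coeff_0_iff using ne by simp
  have abK: "a - b \<in> polys_over K" by (rule polys_over_diff[OF R aK bK])
  have alK: "al \<in> K" unfolding al_def by (rule polys_over_coeff[OF abK])
  \<comment> \<open>A common bound for \<open>ca s\<close> and \<open>norm (s q)\<close> near the
    identity; the added ones leave room for the perturbation.\<close>
  define R0 where "R0 = (ca (\<lambda>x. x) + 1) + (norm q + 1)"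
  have R0: "R0 \<ge> 1" using ca1(1)[of "\<lambda>x. x"] by (simp add: R0_def)
  note T = tendsto_near_id[OF K XK fr]
  have "(ca \<longlongrightarrow> ca (\<lambda>x. x)) (near_id K X)"
    unfolding ca_def cf_def by (intro tendsto_intros T polys_over_coeff aK fK)
  then have ev1: "eventually (\<lambda>s. ca s < ca (\<lambda>x. x) + 1) (near_id K X)" by (rule order_tendstoD) simp
  have "((\<lambda>s. norm (s q)) \<longlongrightarrow> norm q) (near_id K X)" by (intro tendsto_intros T qK)
  then have ev2: "eventually (\<lambda>s. norm (s q) < norm q + 1) (near_id K X)" by (rule order_tendstoD) simp
  have "((\<lambda>s. norm (s al)) \<longlongrightarrow> norm al) (near_id K X)" by (intro tendsto_intros T alK)
  then have ev3: "eventually (\<lambda>s. norm al / 2 < norm (s al)) (near_id K X)"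
    by (rule order_tendstoD) (use al in simp)
  have "eventually (\<lambda>s. ca s \<le> R0 \<and> norm (s q) \<le> R0 \<and> norm al / 2 < norm (s al)) (near_id K X)"
    using ev1 ev2 ev3
  proof eventually_elim
    case (elim s)
    have "0 \<le> ca (\<lambda>x. x)" "0 \<le> norm q" using ca1(1)[of "\<lambda>x. x"] by auto
    then show ?case using elim unfolding R0_def by linarith
  qed
  then obtain eta where eta: "eta > 0" "\<And>s. embedding K s \<Longrightarrow> \<forall>x\<in>X. dist (s x) x < eta \<Longrightarrow>
      ca s \<le> R0 \<and> norm (s q) \<le> R0 \<and> norm al / 2 < norm (s al)"
    unfolding eventually_near_id by auto

  \<comment> \<open>Iterates at a common parameter differ by at most \<open>2 * R0\<close>, and near
    the identity the leading coefficient exceeds \<open>real (d ^ k') * norm al / 2\<close>. A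
    quotient of at most \<open>1 / 2\<close> requires the factor 8.\<close>
  define k' where "k' = Suc (nat \<lceil>8 * R0 / norm al\<rceil>)"
  have k': "8 * R0 \<le> real (d ^ k') * norm al"
  proof -
    have "8 * R0 / norm al \<le> real k'" unfolding k'_def by linarith
    also have "\<dots> \<le> real (d ^ k')" by (rule real_le_power_of_degree[OF d])
    finally show ?thesis using al by (simp add: field_simps)
  qed
  define m where "m = D * (d ^ k' - 1) + e"
  have "d ^ k' > 1" using d by (intro one_less_power) (auto simp: k'_def)
  then have m: "m > 0" using D by (simp add: m_def)
  define Tp :: "(complex \<Rightarrow> complex) \<Rightarrow> complex poly" where "Tp = (\<lambda>s. smult (inverse (of_nat (d ^ k') * s al))
    (pcompose (iterate_poly (map_poly s f) k') (map_poly s a) - pcompose (iterate_poly (map_poly s f) k') (map_poly s b)))"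
  have Tp: "degree (Tp s) = m" "lead_coeff (Tp s) = 1" if s: "embedding K s" for s
  proof -
    let ?p = "iterate_poly (map_poly s f) k'" and ?u = "map_poly s a" and ?v = "map_poly s b"
    have df: "degree (map_poly s f) = d" by (simp add: degree_map_embedding[OF K s fK] d_def)
    have p: "lead_coeff ?p = 1" "degree ?p = d ^ k'" "d ^ k' > 0"
      using d lead_coeff_iterate_poly[OF lc1[OF s fK f(1)], of k'] by (simp_all add: df degree_iterate_poly)
    have uv: "?u - ?v = map_poly s (a - b)" by (simp add: map_embedding_diff[OF K s aK bK])
    have "?u \<noteq> ?v" using uv map_embedding_eq_0_iff[OF K s abK] ne by auto
    moreover have "degree ?u = D" "degree ?v = D"
      using a b by (simp_all add: degree_map_embedding[OF K s] aK bK)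
    ultimately have deg: "degree (pcompose ?p ?u - pcompose ?p ?v) = D * (d ^ k' - 1) + degree (?u - ?v)"
      "lead_coeff (pcompose ?p ?u - pcompose ?p ?v) = of_nat (d ^ k') * lead_coeff (?u - ?v)"
      using pcompose_diff_degree[OF p lc1[OF s aK a(1)] _ lc1[OF s bK b(1)] _ D] by blast+
    have uv': "degree (?u - ?v) = e" "lead_coeff (?u - ?v) = s al"
      unfolding uv e_def al_def
      by (rule degree_map_embedding[OF K s abK], rule lead_coeff_map_embedding[OF K s abK])
    have "s al \<noteq> 0" using al alK by (simp add: embedding_eq_0_iff[OF K s])
    moreover have "(of_nat (d ^ k') :: complex) \<noteq> 0" using p(3) by (simp only: of_nat_eq_0_iff)
    ultimately have nz: "of_nat (d ^ k') * s al \<noteq> 0" by (intro no_zero_divisors)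
    then show "degree (Tp s) = m"
      unfolding Tp_def degree_smult_eq by (simp only: deg(1) uv'(1) m_def inverse_nonzero_iff_nonzero if_False)
    show "lead_coeff (Tp s) = 1"
      unfolding Tp_def lead_coeff_smult deg(2) uv'(2) using nz by (rule left_inverse)
  qed
  have Tp_le: "norm (poly (Tp s) l) \<le> 1 / 2"
    if s: "embedding K s" and close: "ca s \<le> R0" "norm al / 2 < norm (s al)"
      and l: "preperiodic (map_poly s f) (poly (map_poly s a) l)" "preperiodic (map_poly s f) (poly (map_poly s b) l)" for s l
  proof -
    let ?x = "(poly (map_poly s f) ^^ k') (poly (map_poly s a) l)" and ?y = "(poly (map_poly s f) ^^ k') (poly (map_poly s b) l)"
    have "norm (?x - ?y) \<le> norm ?x + norm ?y" by (rule norm_triangle_ineq4)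
    also have "\<dots> \<le> 2 * R0" using iter_le[OF s l(1), of k'] iter_le[OF s l(2), of k'] close by linarith
    also have "\<dots> \<le> real (d ^ k') * (norm al / 2) / 2" using k' by simp
    also have "\<dots> \<le> real (d ^ k') * norm (s al) / 2"
      using close by (intro divide_right_mono mult_left_mono) auto
    finally have 1: "norm (?x - ?y) \<le> real (d ^ k') * norm (s al) / 2" .
    have "real (d ^ k') > 0" using d by simp
    moreover have "norm (s al) > 0" using close al by (meson half_gt_zero less_trans zero_less_norm_iff)
    ultimately have pos: "real (d ^ k') * norm (s al) > 0" by (rule mult_pos_pos)
    have "norm (poly (Tp s) l) = norm (?x - ?y) / (real (d ^ k') * norm (s al))"
      by (simp add: Tp_def poly_pcompose poly_iterate_poly norm_mult norm_inverse norm_power divide_inverse mult.commute)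
    also have "\<dots> \<le> 1 / 2" using 1 pos by (simp add: divide_le_eq)
    finally show ?thesis .
  qed

  have "2 * B1 \<ge> 1" using B1(1) by simp
  from good_pair_bound[OF good eta(1) this] obtain r where r: "r > 0"
    and liouville: "\<And>M D. M > 0 \<Longrightarrow> D \<in> K \<Longrightarrow> D \<in> integral_over X \<Longrightarrow> D \<noteq> 0 \<Longrightarrow>
      (\<And>s. embedding K s \<Longrightarrow> norm (s D) \<le> (2 * B1 * emb_size s X) ^ M) \<Longrightarrow>
      (\<exists>s. embedding K s \<and> (\<forall>x\<in>X. dist (s x) x < eta) \<and> norm (s D) \<ge> r ^ M)" by blast
  \<comment> \<open>Per unit of the exponent \<open>2 * H\<close>, the constant \<open>c\<close>
    measures the combined loss from denominators and from the Liouville inequality. It is fixed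
    before \<open>n\<close>.\<close>
  define c where "c = max 1 (R0 / r ^ kap)"
  have c: "c \<ge> 1" "R0 \<le> c * r ^ kap" using r by (auto simp: c_def field_simps max_def)
  \<comment> \<open>Large enough for the hypothesis of \<open>eventually_estimate\<close>; both
    \<open>m\<close> and \<open>c\<close> are already fixed.\<close>
  define k2 where "k2 = nat \<lceil>16 * real m * ln c / ln 4\<rceil>"
  define n where "n = d ^ k2 * D"
  have n: "n > 0" using d D by (simp add: n_def)
  have nle: "16 * real m * ln c \<le> real n * ln 4"
  proof -
    have "16 * real m * ln c / ln 4 \<le> real k2" unfolding k2_def by linarith
    also have "\<dots> \<le> real (d ^ k2)" by (rule real_le_power_of_degree[OF d])
    also have "\<dots> \<le> real n" unfolding n_def using D by (simp only: of_nat_le_iff) simp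
    finally show ?thesis by (simp add: field_simps)
  qed
  obtain N0 where N0: "\<And>N. N \<ge> N0 \<Longrightarrow> (fact N :: real)\<^sup>2 \<le> 2 ^ (2 * (\<Sum>j<N. j div n + j mod n)) \<and>
      c ^ (2 * (\<Sum>j<N. j div n + j mod n)) * (fact N)\<^sup>2 * R0 ^ (2 * N * m) < 4 ^ (\<Sum>j<N. j div m)"
    using eventually_conj[OF eventually_fact_le[OF n] eventually_estimate[OF n m c(1) R0 nle]]
    unfolding eventually_sequentially by blast
  have dab: "degree a > 0" "degree b > 0" using a b D by auto
  obtain g where g: "g \<in> polys_over K" "lead_coeff g = 1" "degree g \<ge> max N0 2"
    and gsq: "\<And>s. embedding K s \<Longrightarrow> rsquarefree (map_poly s g)"
    and gpre: "\<And>s y. embedding K s \<Longrightarrow> poly (map_poly s g) y = 0 \<Longrightarrow>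
      preperiodic (map_poly s f) (poly (map_poly s a) y) \<and> preperiodic (map_poly s f) (poly (map_poly s b) y)"
    using galois_stable_preperiodic_set[OF K fK f(2) aK dab(1) bK dab(2) inf, of "max N0 2"] by blast
  define N where "N = degree g"
  \<comment> \<open>The number of factors \<open>q\<close> that clear the \<open>j\<close>-th test
    polynomial: one for each factor \<open>A s\<close> and one for each factor
    \<open>x\<close>.\<close>
  define w where "w = (\<lambda>j. j div n + j mod n)"
  define H where "H = (\<Sum>j<N. w j)"
  have N: "N \<ge> 2" and est1: "(fact N :: real)\<^sup>2 \<le> 2 ^ (2 * H)"
    and est2: "c ^ (2 * H) * (fact N)\<^sup>2 * R0 ^ (2 * N * m) < 4 ^ (\<Sum>j<N. j div m)"
    using g(3) N0[of N] by (auto simp: N_def H_def w_def)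
  \<comment> \<open>The Liouville inequality needs a positive exponent; the term \<open>w 1\<close>
    occurs because \<open>N \<ge> 2\<close>.\<close>
  have H: "H > 0"
  proof -
    have "w 1 \<le> H" unfolding H_def using N by (intro member_le_sum) auto
    moreover have "w 1 > 0" by (cases "n = 1") (auto simp: w_def)
    ultimately show ?thesis by simp
  qed
  define L :: "(complex \<Rightarrow> complex) \<Rightarrow> complex set" where "L = (\<lambda>s. {x. poly (map_poly s g) x = 0})"
  have lcg: "lead_coeff (map_poly s g) = 1" if "embedding K s" for s by (rule lc1[OF that g(1,2)])
  have L: "finite (L s)" "card (L s) = N" "root_prod (map_poly s g) (pderiv (map_poly s g)) = diff_prod (L s)"
    if s: "embedding K s" for s
    using rsquarefree_diff_prod[OF gsq[OF s] lcg[OF s]]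
    by (simp_all add: L_def N_def degree_map_embedding[OF K s g(1)])
  define A :: "(complex \<Rightarrow> complex) \<Rightarrow> complex poly" where "A = (\<lambda>s. pcompose (iterate_poly (map_poly s f) k2) (map_poly s a))"
  have A: "lead_coeff (A s) = 1" "degree (A s) = n" if s: "embedding K s" for s
  proof -
    have dm: "degree (map_poly s f) = d" "degree (map_poly s a) = D"
      by (simp_all add: degree_map_embedding[OF K s] fK aK d_def a)
    show "degree (A s) = n" by (simp add: A_def degree_pcompose degree_iterate_poly dm n_def)
    have "lead_coeff (iterate_poly (map_poly s f) k2) = 1"
      using lead_coeff_iterate_poly[OF lc1[OF s fK f(1)]] d dm by simp
    then show "lead_coeff (A s) = 1"
      unfolding A_def using lead_coeff_comp[of "map_poly s a"] lc1[OF s aK a(1)] dm D by simp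
  qed
  define P :: "(complex \<Rightarrow> complex) \<Rightarrow> nat \<Rightarrow> complex poly" where "P = (\<lambda>s j. A s ^ (j div n) * monom 1 (j mod n))"
  have P: "degree (P s j) = j" "lead_coeff (P s j) = 1" if s: "embedding K s" for s j
    unfolding P_def using monic_div_mod_basis[OF A[OF s] n] by auto
  have Pval: "t ^ w j * poly (P s j) x = (t * poly (A s) x) ^ (j div n) * (t * x) ^ (j mod n)" for s j t x
    by (simp add: P_def w_def power_add power_mult_distrib poly_monom mult_ac)
  have Ax: "poly (A s) x = (poly (map_poly s f) ^^ k2) (poly (map_poly s a) x)" for s x
    by (simp add: A_def poly_pcompose poly_iterate_poly)
  let ?id = "\<lambda>x :: complex. x"
  \<comment> \<open>The exponent is twice the sum of the weights because the product of the
    denominators enters Fekete's estimate squared.\<close>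
  define Q where "Q = q ^ (2 * H) * diff_prod (L ?id)"
  have disc: "diff_prod (L ?id) \<in> K" "\<And>s. embedding K s \<Longrightarrow> s (diff_prod (L ?id)) = diff_prod (L s)"
  proof -
    have g0: "g \<noteq> 0" using g(2) by auto
    have *: "diff_prod (L ?id) = root_prod g (pderiv g)" using L(3)[OF embedding_id] by simp
    note rp = root_prod_embedding[OF K g(1) polys_over_pderiv[OF R g(1)] g0]
    show "diff_prod (L ?id) \<in> K" unfolding * using rp by blast
    show "s (diff_prod (L ?id)) = diff_prod (L s)" if s: "embedding K s" for s
    proof -
      have "s (root_prod g (pderiv g)) = root_prod (map_poly s g) (map_poly s (pderiv g))" using rp s by blast
      then show ?thesis unfolding * by (simp only: map_embedding_pderiv[OF K s g(1)] L(3)[OF s])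
    qed
  qed
  have QK: "Q \<in> K" unfolding Q_def by (intro csubring_mult[OF R] csubring_power[OF R] qK disc)
  have sQ: "s Q = s q ^ (2 * H) * diff_prod (L s)" if s: "embedding K s" for s
    unfolding Q_def by (simp add: embedding_mult[OF K s] embedding_power[OF K s] csubring_power[OF R] qK disc s)
  have Q0: "Q \<noteq> 0"
    unfolding Q_def diff_prod_def using q(2) L(1)[OF embedding_id] by auto
  have QI: "Q \<in> integral_over X"
    unfolding integral_over_def
  proof (safe)
    fix V assume V: "val_ring V" "X \<subseteq> V"
    note RV = val_ring_imp_csubring[OF V(1)]
    have sub: "ring_gen X \<subseteq> V" by (rule ring_gen_minimal[OF RV V(2)])
    have "(\<Prod>j<N. q ^ w j)\<^sup>2 * diff_prod (L ?id) \<in> V"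
    proof (rule val_ring_diff_prod[OF V(1) P[OF embedding_id] L(1,2)[OF embedding_id]])
      fix j x assume "x \<in> L ?id"
      then have pre: "preperiodic f (poly a x)" using gpre[OF embedding_id, of x] by (simp add: L_def)
      have "q * (poly f ^^ k2) (poly a x) \<in> V"
        by (rule preperiodic_val_ring[OF V(1) f _ preperiodic_iterate[OF pre]]) (use qf sub in auto)
      moreover obtain D' where D': "degree a = Suc D'" using a D by (cases D) auto
      have "q * x \<in> V"
      proof (rule val_ring_monic_bound[OF V(1) a(1) D'])
        show "q * coeff a i \<in> V" for i using qa sub by auto
        assume "inverse x \<in> V"
        moreover have "q * poly a x \<in> V"
          by (rule preperiodic_val_ring[OF V(1) f _ pre]) (use qf sub in auto)
        ultimately show "q * poly a x * inverse x ^ D' \<in> V"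
          by (intro csubring_mult[OF RV, of "q * poly a x"] csubring_power[OF RV])
      qed
      ultimately show "q ^ w j * poly (P ?id j) x \<in> V"
        unfolding Pval Ax by (intro csubring_mult[OF RV, of "_ ^ _"] csubring_power[OF RV]) auto
    qed
    also have "(\<Prod>j<N. q ^ w j)\<^sup>2 = q ^ (2 * H)" by (simp only: H_def power_sum[symmetric] power_mult[symmetric] mult.commute[of _ 2])
    finally show "Q \<in> V" by (simp add: Q_def)
  qed
  have Qb: "norm (s Q) \<le> (2 * B1 * emb_size s X) ^ (kap * (2 * H))" if s: "embedding K s" for s
  proof -
    have sq: "s q \<noteq> 0" using q(2) qK by (simp add: embedding_eq_0_iff[OF K s])
    have "norm (poly (P s j) x) \<le> (E s / norm (s q)) ^ w j" if x: "x \<in> L s" for j x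
    proof -
      have pre: "preperiodic (map_poly s f) (poly (map_poly s a) x)" using gpre[OF s] x by (auto simp: L_def)
      have "norm (s q * poly (A s) x) \<le> norm (s q) * ca s" "norm (s q * x) \<le> norm (s q) * ca s"
        unfolding Ax norm_mult using iter_le[OF s pre] l_le[OF s pre] by (auto intro!: mult_left_mono)
      then have "norm (s q * poly (A s) x) \<le> E s" "norm (s q * x) \<le> E s" using E[OF s] by linarith+
      then have "norm (s q ^ w j * poly (P s j) x) \<le> E s ^ (j div n) * E s ^ (j mod n)"
        unfolding Pval norm_mult[of "_ ^ _" "_ ^ _"] norm_power using E1[of s]
        by (intro mult_mono power_mono) auto
      then have "norm (s q) ^ w j * norm (poly (P s j) x) \<le> E s ^ w j"
        by (simp only: norm_mult norm_power w_def power_add)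
      then show ?thesis using sq by (simp add: power_divide field_simps)
    qed
    then have "norm (diff_prod (L s)) \<le> (\<Prod>j<N. real (Suc j) * (E s / norm (s q)) ^ w j)\<^sup>2"
      by (intro norm_diff_prod_le[OF P[OF s] L(1,2)[OF s]])
    also have "\<dots> = (fact N)\<^sup>2 * (E s / norm (s q)) ^ (2 * H)"
    proof -
      have "(\<Prod>j<N. real (Suc j)) = fact N" by (induction N) (auto simp: mult.commute)
      then show ?thesis
        by (simp only: prod.distrib H_def power_mult_distrib power_sum[symmetric] power_mult[symmetric]
            mult.commute[of _ 2])
    qed
    finally have "norm (s Q) \<le> norm (s q) ^ (2 * H) * ((fact N)\<^sup>2 * (E s / norm (s q)) ^ (2 * H))"
      unfolding sQ[OF s] norm_mult norm_power by (intro mult_left_mono) auto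
    also have "\<dots> = (fact N)\<^sup>2 * E s ^ (2 * H)" using sq by (simp add: power_divide)
    also have "\<dots> \<le> 2 ^ (2 * H) * E s ^ (2 * H)" using est1 E1[of s] by (intro mult_right_mono) auto
    also have "\<dots> \<le> (2 ^ kap) ^ (2 * H) * E s ^ (2 * H)"
      using E1[of s] by (intro mult_right_mono power_mono) (auto simp: kap_def)
    also have "\<dots> = (2 * B1 * emb_size s X) ^ (kap * (2 * H))"
      by (simp only: E_def power_mult power_mult_distrib mult.assoc)
    finally show ?thesis .
  qed
  have "kap * (2 * H) > 0" using H by (simp add: kap_def)
  from liouville[OF this QK QI Q0 Qb] obtain s where s: "embedding K s" "\<forall>x\<in>X. dist (s x) x < eta"
    "r ^ (kap * (2 * H)) \<le> norm (s Q)" by blast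
  have close: "ca s \<le> R0" "norm (s q) \<le> R0" "norm al / 2 < norm (s al)" using eta(2)[OF s(1,2)] by auto
  \<comment> \<open>At the embedding supplied by the Liouville inequality the small test polynomial
    applies; the monomials cost at most \<open>R0 ^ m\<close> in each degree, which is only linear
    in the final exponent.\<close>
  have "norm (poly (Tp s ^ (j div m) * monom 1 (j mod m)) x) \<le> (1 / 2) ^ (j div m) * R0 ^ m"
    if x: "x \<in> L s" for j x
  proof -
    have pre: "preperiodic (map_poly s f) (poly (map_poly s a) x)" "preperiodic (map_poly s f) (poly (map_poly s b) x)"
      using gpre[OF s(1)] x by (auto simp: L_def)
    have "norm x \<le> R0" using l_le[OF s(1) pre(1)] close(1) by linarith
    then have "norm x ^ (j mod m) \<le> R0 ^ (j mod m)" by (intro power_mono) auto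
    also have "\<dots> \<le> R0 ^ m" using R0 m by (intro power_increasing) (auto simp: less_imp_le)
    finally have "norm x ^ (j mod m) \<le> R0 ^ m" .
    moreover have "norm (poly (Tp s) x) ^ (j div m) \<le> (1 / 2) ^ (j div m)"
      using Tp_le[OF s(1) close(1,3) pre] by (intro power_mono) auto
    ultimately show ?thesis
      unfolding poly_mult poly_power poly_monom norm_mult norm_power using R0 by (intro mult_mono) auto
  qed
  then have "norm (diff_prod (L s)) \<le> (\<Prod>j<N. real (Suc j) * ((1 / 2) ^ (j div m) * R0 ^ m))\<^sup>2"
    by (intro norm_diff_prod_le[OF monic_div_mod_basis[OF Tp(2,1)[OF s(1)] m] L(1,2)[OF s(1)]])
  also have "\<dots> = (fact N)\<^sup>2 * (1 / 4) ^ (\<Sum>j<N. j div m) * R0 ^ (2 * N * m)"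
  proof -
    have 1: "(\<Prod>j<N. real (Suc j)) = fact N" by (induction N) (auto simp: mult.commute)
    have 2: "(\<Prod>j<N. (1 / 2 :: real) ^ (j div m)) = (1 / 2) ^ (\<Sum>j<N. j div m)" by (simp only: power_sum)
    have 3: "((1 / 2 :: real) ^ k)\<^sup>2 = (1 / 4) ^ k" for k
      by (simp add: power2_eq_square flip: power_mult_distrib)
    have 4: "((R0 ^ m) ^ N)\<^sup>2 = R0 ^ (2 * N * m)" by (simp add: mult_ac flip: power_mult)
    show ?thesis
      by (simp only: prod.distrib 1 2 power_mult_distrib 3 prod_constant card_lessThan 4 mult.assoc)
  qed
  finally have dp: "norm (diff_prod (L s)) \<le> (fact N)\<^sup>2 * (1 / 4) ^ (\<Sum>j<N. j div m) * R0 ^ (2 * N * m)" .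
  \<comment> \<open>The two bounds for \<open>norm (s Q)\<close> meet. Replacing \<open>R0\<close>
    by \<open>c * r ^ kap\<close> lets the powers of \<open>r\<close> cancel, and what remains
    contradicts \<open>est2\<close>.\<close>
  have "(r ^ kap) ^ (2 * H) \<le> norm (s q) ^ (2 * H) * norm (diff_prod (L s))"
    using s(3) by (simp only: sQ[OF s(1)] norm_mult norm_power power_mult)
  also have "\<dots> \<le> (c * r ^ kap) ^ (2 * H) * ((fact N)\<^sup>2 * (1 / 4) ^ (\<Sum>j<N. j div m) * R0 ^ (2 * N * m))"
    using close(2) c r dp by (intro mult_mono power_mono) auto
  also have "\<dots> = (r ^ kap) ^ (2 * H) *
      (c ^ (2 * H) * (fact N)\<^sup>2 * R0 ^ (2 * N * m) * (1 / 4) ^ (\<Sum>j<N. j div m))"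
    by (simp only: power_mult_distrib mult_ac)
  finally have "1 \<le> c ^ (2 * H) * (fact N)\<^sup>2 * R0 ^ (2 * N * m) * (1 / 4) ^ (\<Sum>j<N. j div m)"
    using r by (simp add: mult_le_cancel_left1)
  then have "4 ^ (\<Sum>j<N. j div m) \<le> c ^ (2 * H) * (fact N)\<^sup>2 * R0 ^ (2 * N * m)"
    by (simp add: power_one_over field_simps)
  then show False using est2 by simp
qed

section \<open>Reduction to the monic case\<close>

lemma complex_root_exists:
  fixes z :: complex
  assumes "n > 0" "z \<noteq> 0"
  obtains w where "w ^ n = z" "w \<noteq> 0"
proof -
  have "degree (monom 1 n + [:-z:]) = n"
    using assms(1) by (subst degree_add_eq_left) (auto simp: degree_monom_eq)
  then have "\<not> constant (poly (monom 1 n + [:-z:]))" using assms(1) by (simp add: constant_degree)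
  then obtain w where "poly (monom 1 n + [:-z:]) w = 0"
    using fundamental_theorem_of_algebra by blast
  then have "w ^ n = z" by (simp add: poly_monom)
  then show thesis using that assms by (cases "w = 0") auto
qed

theorem corollary1p8:
  fixes f a b :: "complex poly"
  assumes "degree f \<ge> 2"
    and "degree a = degree b"
    and "lead_coeff a = lead_coeff b"
    and "infinite {l :: complex. preperiodic f (poly a l) \<and> preperiodic f (poly b l)}"
  shows "a = b"
proof (cases "degree a = 0")
  case True
  then obtain x y where "a = [:x:]" "b = [:y:]" using assms(2) by (metis degree_eq_zeroE)
  then show ?thesis using assms(3) by simp
next
  case False
  define D where "D = degree a"
  have D: "D > 0" "degree b = D" using False assms(2) by (auto simp: D_def)
  have nz: "lead_coeff f \<noteq> 0" "lead_coeff a \<noteq> 0" using assms(1) False by auto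
  have "degree f - 1 > 0" using assms(1) by simp
  \<comment> \<open>The conjugate \<open>inverse c * f(c x)\<close> has leading coefficient
    \<open>lead_coeff f * c ^ (degree f - 1)\<close>, which becomes 1.\<close>
  then obtain c where c: "c ^ (degree f - 1) = inverse (lead_coeff f)" "c \<noteq> 0"
    using complex_root_exists[of "degree f - 1" "inverse (lead_coeff f)"] nz by auto
  \<comment> \<open>The same \<open>t\<close> normalises \<open>a\<close> and \<open>b\<close>,
    because they share degree and leading coefficient; the factor \<open>c\<close> compensates the
    conjugation of \<open>f\<close>.\<close>
  obtain t where t: "t ^ D = c / lead_coeff a" "t \<noteq> 0"
    using complex_root_exists[of D "c / lead_coeff a"] nz c D by auto
  define f1 where "f1 = smult (inverse c) (pcompose f [:0, c:])"
  define r where "r = (\<lambda>p. smult (inverse c) (pcompose p [:0, t:]))"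
  have "degree f = Suc (degree f - 1)" using assms(1) by simp
  then have "c ^ degree f = c * c ^ (degree f - 1)" by (metis power_Suc)
  then have "lead_coeff f * c ^ degree f = c" using c nz by (simp add: field_simps)
  then have fc: "lead_coeff f * c ^ degree f = c" .
  have pc: "degree (pcompose p [:0, u:]) = degree p" "lead_coeff (pcompose p [:0, u:]) = lead_coeff p * u ^ degree p"
    if "u \<noteq> 0" for p and u :: complex
    using that lead_coeff_comp[of "[:0, u:]" p] by (simp add: degree_pcompose, simp)
  have f1: "lead_coeff f1 = 1"
    unfolding f1_def lead_coeff_smult pc(2)[OF c(2)] fc using c(2) by (rule left_inverse)
  have df1: "degree f1 = degree f" using c(2) by (simp add: f1_def pc(1))
  have r: "lead_coeff (r p) = 1" if "lead_coeff p = lead_coeff a" "degree p = D" for p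
  proof -
    have "lead_coeff (r p) = inverse c * (lead_coeff p * t ^ degree p)"
      unfolding r_def lead_coeff_smult pc(2)[OF t(2)] ..
    also have "\<dots> = inverse c * (lead_coeff a * (c / lead_coeff a))"
      unfolding that(1) unfolding that(2) t(1) ..
    finally show ?thesis using c(2) nz(2) by simp
  qed
  have dr: "degree (r p) = degree p" for p using c(2) t(2) by (simp add: r_def pc(1))
  have rp: "poly (r p) x = inverse c * poly p (t * x)" for p x
    by (simp add: r_def poly_pcompose mult.commute[of t])
  have step: "poly f1 y = inverse c * poly f (c * y)" for y
    by (simp add: f1_def poly_pcompose mult.commute[of c])
  have cancel: "c * (inverse c * y) = y" for y
    using c(2) by (simp flip: mult.assoc)
  have "(poly f1 ^^ k) y = inverse c * (poly f ^^ k) (c * y)" for k y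
  proof (induction k)
    case 0
    show ?case using c(2) by (simp flip: mult.assoc)
  next
    case (Suc k)
    then show ?case by (simp only: funpow.simps comp_apply step cancel)
  qed
  then have pre: "preperiodic f1 (inverse c * y) \<longleftrightarrow> preperiodic f y" for y
    using c(2) by (simp only: preperiodic_def cancel mult_cancel_left inverse_nonzero_iff_nonzero) simp
  let ?S = "{l. preperiodic f (poly a l) \<and> preperiodic f (poly b l)}"
  let ?S1 = "{l. preperiodic f1 (poly (r a) l) \<and> preperiodic f1 (poly (r b) l)}"
  have "?S \<subseteq> (\<lambda>l. t * l) ` ?S1"
  proof
    fix l assume "l \<in> ?S"
    moreover have lt: "t * (inverse t * l) = l" using t(2) by (simp flip: mult.assoc)
    ultimately have "inverse t * l \<in> ?S1" by (simp only: mem_Collect_eq rp lt pre)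
    moreover have "l = t * (inverse t * l)" by (simp only: lt)
    ultimately show "l \<in> (\<lambda>l. t * l) ` ?S1" by (rule image_eqI[rotated])
  qed
  then have inf1: "infinite ?S1" using assms(4) finite_subset by blast
  have "r a = r b"
  proof (rule corollary_monic[of f1 "r a" D "r b"])
    show "lead_coeff f1 = 1" by (rule f1)
    show "2 \<le> degree f1" unfolding df1 by (rule assms(1))
    show "lead_coeff (r a) = 1" by (rule r[OF refl D_def[symmetric]])
    show "lead_coeff (r b) = 1" by (rule r[OF assms(3)[symmetric] D(2)])
    show "degree (r a) = D" unfolding dr D_def ..
    show "degree (r b) = D" unfolding dr by (rule D(2))
  qed (rule D(1), rule inf1)
  then have "smult c (r a) = smult c (r b)" by (simp only:)
  then have "pcompose (a - b) [:0, t:] = 0" using c(2) by (simp add: r_def pcompose_diff)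
  then show "a = b" using t by (simp add: pcompose_eq_0_iff)
qed

end
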